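(* Let $(q_k,p_{k1},p_{k2})_{k\ge2}$ be real numbers with $q_k>0$, $p_{k1}\ge0$, $p_{k2}>0$ and $q_k+p_{k1}+p_{k2}=1$ for all $k\ge2$, let $X$, $Y$ be the (2,1) and (1,2) random walks defined in the context, and let $Z\in\{X,Y\}$. For $n\ge2$ let $S_n=\#\{k\in[2,n]: k \text{ is a cutpoint of } Z\}$. Suppose that $a_k\to a>0$ and $b_k\to b>0$ as $k\to\infty$. Fix $\beta\ge0$ and let $r_n$ be as in the context. Assume $\varrho_k=1-3r_k+O(r_k^2)$ as $k\to\infty$ if $Z=X$, and $\varrho_k=1+3r_k+O(r_k^2)$ as $k\to\infty$ if $Z=Y$. If $0\le\beta<1$, then there are constants $0<c_3<c_4<\infty$ such that $$c_3\le \liminf_{n\to\infty}\frac{ES_n}{\log n(\log\log n)^{-\beta}}\le\limsup_{n\to\infty}\frac{ES_n}{\log n(\log\log n)^{-\beta}}\le c_4,$$ and for each $\varepsilon>0$, $$\lim_{n\to\infty}\frac{S_n}{(\log n)^{1+\varepsilon}(\log\log n)^{-\beta}}=0\quad\text{almost surely.}$$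
   Context: $\mathbb Z_+=\{0,1,2,\dots\}$. The (2,1) random walk $X$ is the Markov chain on $\mathbb Z_+$ with $X_0=2$, $P(X_{k+1}=1\mid X_k=0)=P(X_{k+1}=2\mid X_k=1)=1$ and, for $n\ge2$, $P(X_{k+1}=n+1\mid X_k=n)=q_n$, $P(X_{k+1}=n-1\mid X_k=n)=p_{n1}$, $P(X_{k+1}=n-2\mid X_k=n)=p_{n2}$. The (1,2) random walk $Y$ is the Markov chain on $\mathbb Z_+$ with $Y_0=2$, $P(Y_{k+1}=0\mid Y_k=1)=P(Y_{k+1}=2\mid Y_k=0)=1$ and, for $n\ge2$, $P(Y_{k+1}=n-1\mid Y_k=n)=q_n$, $P(Y_{k+1}=n+1\mid Y_k=n)=p_{n1}$, $P(Y_{k+1}=n+2\mid Y_k=n)=p_{n2}$. For $k\ge2$, $a_k=(p_{k1}+p_{k2})/q_k$, $b_k=p_{k2}/q_k$, $\varrho_k=\frac{a_k+\sqrt{a_k^2+4b_k}}{2}$. A site $k$ is a cutpoint of $X$ if $X$ visits $k$ exactly once; $k$ is a cutpoint of $Y$ if $Y$ never visits $k$. For fixed $\beta\ge0$: $r_n=\frac13\left(\frac1n+\frac{1}{n(\log\log n)^\beta}\right)$ for $n\ge4$ and $r_2=r_3=r_4$. *)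

theory Defs
  imports "HOL-Probability.Probability" "HOL-Library.Landau_Symbols"
begin

definition trans_kernel :: "bool \<Rightarrow> (nat \<Rightarrow> real) \<Rightarrow> (nat \<Rightarrow> real) \<Rightarrow> (nat \<Rightarrow> real)
    \<Rightarrow> nat \<Rightarrow> nat \<Rightarrow> real" where
  "trans_kernel isX q p1 p2 n m =
     (if isX then
        (if n = 0 then (if m = 1 then 1 else 0)
         else if n = 1 then (if m = 2 then 1 else 0)
         else if m = n + 1 then q n
         else if m = n - 1 then p1 n
         else if m = n - 2 then p2 n else 0)
      else
        (if n = 1 then (if m = 0 then 1 else 0)
         else if n = 0 then (if m = 2 then 1 else 0)
         else if m = n - 1 then q n
         else if m = n + 1 then p1 n
         else if m = n + 2 then p2 n else 0))"

definition is_markov_chain :: "'a measure \<Rightarrow> (nat \<Rightarrow> 'a \<Rightarrow> nat) \<Rightarrow> nat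
    \<Rightarrow> (nat \<Rightarrow> nat \<Rightarrow> real) \<Rightarrow> bool" where
  "is_markov_chain M Z x0 P \<longleftrightarrow>
     prob_space M \<and> (\<forall>n. Z n \<in> M \<rightarrow>\<^sub>M count_space UNIV) \<and>
     (\<forall>n (x :: nat \<Rightarrow> nat).
        measure M {\<omega> \<in> space M. \<forall>i\<le>n. Z i \<omega> = x i} =
        (if x 0 = x0 then 1 else 0) * (\<Prod>i<n. P (x i) (x (i + 1))))"

definition is_cutpoint :: "bool \<Rightarrow> (nat \<Rightarrow> nat) \<Rightarrow> nat \<Rightarrow> bool" where
  "is_cutpoint isX pth k =
     (if isX then card {n. pth n = k} = 1 else (\<forall>n. pth n \<noteq> k))"

definition num_cutpoints :: "bool \<Rightarrow> (nat \<Rightarrow> nat) \<Rightarrow> nat \<Rightarrow> nat" where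
  "num_cutpoints isX pth n = card {k \<in> {2..n}. is_cutpoint isX pth k}"

definition rho_walk :: "(nat \<Rightarrow> real) \<Rightarrow> (nat \<Rightarrow> real) \<Rightarrow> (nat \<Rightarrow> real) \<Rightarrow> nat \<Rightarrow> real" where
  "rho_walk q p1 p2 k =
     (let a = (p1 k + p2 k) / q k; b = p2 k / q k in (a + sqrt (a\<^sup>2 + 4 * b)) / 2)"

definition r_seq :: "real \<Rightarrow> nat \<Rightarrow> real" where
  "r_seq \<beta> n = (let m = max n 4 in
     (1 / real m + 1 / (real m * (ln (ln (real m))) powr \<beta>)) / 3)"

end

theory Submission
  imports Defs "HOL-Real_Asymp.Real_Asymp"
begin

text \<open>
  Write a harmonic function of the walk as \<open>h k = (\<Sum>j\<ge>k. u j)\<close>. Harmonicity turns into a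
  two-term recursion for \<open>u\<close>, forward for \<open>X\<close> and backward for \<open>Y\<close>, whose coefficients are
  \<open>a\<^sub>k, b\<^sub>k\<close>. The ratio of consecutive increments obeys a contracting continued-fraction
  recursion with approximate fixed point \<open>\<rho>\<^sub>k\<close> (or its inverse), so in both cases
  \<open>u (k+1) / u k = 1 - 3 r\<^sub>k + O(1/k\<^sup>2)\<close>. With \<open>V k = k (ln ln k) powr \<beta>\<close> this gives
  \<open>V k * u k - V (k+1) * u (k+1) \<sim> u k\<close>, and summing, \<open>u k / h k \<sim> 1 / V k\<close>.

  Since \<open>sqrt h\<close> is strictly superharmonic, the walk is transient. A site \<open>k\<close> is then almost
  surely a cutpoint iff the walk steps to \<open>k + 1\<close> from its first visit to \<open>k\<close> (for \<open>X\<close>) or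
  from \<open>k - 1\<close> before any visit to \<open>k\<close> (for \<open>Y\<close>), and stays above \<open>k\<close> ever after. Optional
  stopping of \<open>h\<close> bounds the probability of the last event by constants times \<open>u k / h k\<close>, so
  \<open>k\<close> is a cutpoint with probability of order \<open>1 / V k\<close>, and \<open>\<Sum>k\<le>n. 1 / V k\<close> is of order
  \<open>ln n (ln ln n) powr (- \<beta>)\<close>. The almost sure statement follows from the bound on the
  expectation along \<open>n = 2 ^ 2 ^ j\<close> and monotonicity of the counts.
\<close>

section \<open>The scales\<close>

text \<open>For large \<open>k\<close>, \<open>3 * r_seq \<beta> k\<close> is
  \<open>1 / k + 1 / V k\<close>. In \<open>V k * u k - V (k+1) * u (k+1)\<close> the term
  \<open>1 / k\<close> offsets the growth of the factor \<open>k\<close> in \<open>V\<close>, and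
  \<open>1 / V k\<close> leaves the main term \<open>u k\<close>. An error \<open>O(1/k^2)\<close>
  in the ratio of increments vanishes after multiplication by \<open>V\<close>, so this is all the
  precision needed from \<open>\<rho>\<close>. The recursion \<open>x = a + b / x'\<close> contracts
  only once the ratios are known to stay away from \<open>b\<close>; that bound has to be won before
  \<open>\<rho>\<close> can be compared with them. For \<open>X\<close> errors are carried forward
  and die out whatever the positive starting values. For \<open>Y\<close> they come from infinity: a
  positive solution must first be shown to exist, and an a priori bound takes the place of an
  initial value. The chain is known only through its cylinder probabilities, without shifts or
  conditional expectations. Random times are therefore resolved into disjoint events at fixed times
  \<open>n\<close>; each estimate is made on an event decided by time \<open>n\<close> and summed
  over \<open>n\<close>.\<close>

definition vscale :: "real \<Rightarrow> nat \<Rightarrow> real" where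
  "vscale \<beta> n = real n * ln (ln (real n)) powr \<beta>"

text \<open>This is the normalisation of the theorem and, up to a factor tending to 1, a discrete
  antiderivative of \<open>1 / vscale \<beta>\<close>.\<close>

definition gscale :: "real \<Rightarrow> nat \<Rightarrow> real" where
  "gscale \<beta> n = ln (real n) * ln (ln (real n)) powr (- \<beta>)"

lemma r_seq_ge4:
  "n \<ge> 4 \<Longrightarrow> r_seq \<beta> n = (1 / real n + 1 / (real n * ln (ln (real n)) powr \<beta>)) / 3"
  by (simp add: r_seq_def Let_def max_def)

lemma ln_ln_pos: "n \<ge> 4 \<Longrightarrow> 0 < ln (ln (real n))"
proof -
  assume "n \<ge> 4"
  have "exp (1::real) < 4" using exp_le by simp
  hence "1 < ln (4::real)"
    by (metis exp_less_cancel_iff exp_ln zero_less_numeral)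
  also have "\<dots> \<le> ln (real n)" using \<open>n \<ge> 4\<close> by simp
  finally show ?thesis by simp
qed

lemma vscale_pos: "n \<ge> 4 \<Longrightarrow> 0 < vscale \<beta> n"
  using ln_ln_pos[of n] by (simp add: vscale_def)

lemma gscale_pos: "n \<ge> 4 \<Longrightarrow> 0 < gscale \<beta> n"
  using ln_ln_pos[of n] by (simp add: gscale_def)

text \<open>With \<open>L n = ln (ln n) powr \<beta>\<close> the expression is
  \<open>n * (L n - L (n+1)) + 1\<close>, and \<open>L\<close> varies too slowly for the first term
  to survive.\<close>

lemma vscale_step:
  assumes "0 \<le> \<beta>" "\<beta> < 1"
  shows "(\<lambda>n. vscale \<beta> n - vscale \<beta> (Suc n) + vscale \<beta> (Suc n) * (3 * r_seq \<beta> (Suc n))) \<longlonglongrightarrow> 1"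
proof -
  have "((\<lambda>x::real. x * ln (ln x) powr \<beta> - (x+1) * ln (ln (x+1)) powr \<beta> + ln (ln (x+1)) powr \<beta> + 1) \<longlongrightarrow> 1) at_top"
    \<comment> \<open>The expansion has a different shape for \<open>\<beta> > 0\<close> and
      \<open>\<beta> = 0\<close>; hence the case split here and in the limits below.\<close>
    using assms(2) order_le_imp_less_or_eq[OF assms(1)]
    by (elim disjE) (real_asymp, hypsubst, real_asymp)
  from filterlim_compose[OF this filterlim_real_sequentially]
  have "(\<lambda>n. vscale \<beta> n - vscale \<beta> (Suc n) + ln (ln (real (Suc n))) powr \<beta> + 1) \<longlonglongrightarrow> 1"
    by (simp add: vscale_def add_ac)
  moreover have "eventually (\<lambda>n. vscale \<beta> n - vscale \<beta> (Suc n) + ln (ln (real (Suc n))) powr \<beta> + 1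
      = vscale \<beta> n - vscale \<beta> (Suc n) + vscale \<beta> (Suc n) * (3 * r_seq \<beta> (Suc n))) sequentially"
    using eventually_ge_at_top[of 4]
  proof eventually_elim
    case (elim n)
    hence "ln (ln (real (Suc n))) > 0" by (intro ln_ln_pos) auto
    hence L: "ln (ln (real (Suc n))) powr \<beta> > 0" by simp
    have *: "S * L * (3 * ((1 / S + 1 / (S * L)) / 3)) = L + 1" if "S > 0" "L > 0" for S L :: real
      using that by (simp add: field_simps)
    have "Suc n \<ge> 4" using elim by simp
    hence "vscale \<beta> (Suc n) * (3 * r_seq \<beta> (Suc n)) = ln (ln (real (Suc n))) powr \<beta> + 1"
      unfolding vscale_def r_seq_ge4[OF \<open>Suc n \<ge> 4\<close>] by (intro * L) simp
    thus ?case by simp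
  qed
  ultimately show ?thesis by (rule Lim_transform_eventually)
qed

lemma vscale_over_square:
  assumes "0 \<le> \<beta>" "\<beta> < 1"
  shows "(\<lambda>n. vscale \<beta> (Suc n) / real n ^ 2) \<longlonglongrightarrow> 0"
proof -
  have "((\<lambda>x::real. (x+1) * ln (ln (x+1)) powr \<beta> / x ^ 2) \<longlongrightarrow> 0) at_top"
    using assms(2) order_le_imp_less_or_eq[OF assms(1)]
    by (elim disjE) (real_asymp, hypsubst, real_asymp)
  from filterlim_compose[OF this filterlim_real_sequentially]
  show ?thesis by (simp add: vscale_def add_ac)
qed

lemma vscale_ratio:
  assumes "0 \<le> \<beta>" "\<beta> < 1"
  shows "(\<lambda>n. vscale \<beta> (Suc n) / vscale \<beta> n) \<longlonglongrightarrow> 1"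
proof -
  have "((\<lambda>x::real. ((x + 1) * ln (ln (x + 1)) powr \<beta>) / (x * ln (ln x) powr \<beta>)) \<longlongrightarrow> 1) at_top"
    using assms(2) order_le_imp_less_or_eq[OF assms(1)]
    by (elim disjE) (real_asymp, hypsubst, real_asymp)
  from filterlim_compose[OF this filterlim_real_sequentially]
  show ?thesis by (simp add: vscale_def add_ac)
qed

lemma gscale_step:
  assumes "0 \<le> \<beta>" "\<beta> < 1"
  shows "(\<lambda>n. (gscale \<beta> (Suc n) - gscale \<beta> n) * vscale \<beta> (Suc n)) \<longlonglongrightarrow> 1"
proof -
  have "((\<lambda>x::real. (ln (x+1) * ln (ln (x+1)) powr (-\<beta>) - ln x * ln (ln x) powr (-\<beta>)) * ((x+1) * ln (ln (x+1)) powr \<beta>)) \<longlongrightarrow> 1) at_top"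
    using assms(2) order_le_imp_less_or_eq[OF assms(1)]
    by (elim disjE) (real_asymp, hypsubst, real_asymp)
  from filterlim_compose[OF this filterlim_real_sequentially]
  show ?thesis by (simp add: vscale_def gscale_def add_ac)
qed

lemma gscale_at_top:
  assumes "0 \<le> \<beta>" "\<beta> < 1"
  shows "filterlim (gscale \<beta>) at_top sequentially"
proof -
  have "filterlim (\<lambda>x::real. ln x * ln (ln x) powr (-\<beta>)) at_top at_top"
    using assms(2) order_le_imp_less_or_eq[OF assms(1)]
    by (elim disjE) (real_asymp, hypsubst, real_asymp)
  from filterlim_compose[OF this filterlim_real_sequentially]
  show ?thesis by (simp add: gscale_def[abs_def])
qed

lemma r_seq_diff_bigo:
  assumes "0 \<le> \<beta>" "\<beta> < 1"
  shows "(\<lambda>n. r_seq \<beta> (Suc n) - r_seq \<beta> n) \<in> O(\<lambda>n. 1 / real n ^ 2)"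
proof -
  have "(\<lambda>x::real. (1/(x+1) + 1/((x+1) * ln (ln (x+1)) powr \<beta>)) / 3 - (1/x + 1/(x * ln (ln x) powr \<beta>)) / 3) \<in> O(\<lambda>x. 1/x^2)"
    using assms(2) order_le_imp_less_or_eq[OF assms(1)]
    by (elim disjE) (real_asymp, hypsubst, real_asymp)
  from landau_o.big.compose[OF this filterlim_real_sequentially]
  have *: "(\<lambda>n. (1/(real n+1) + 1/((real n+1) * ln (ln (real n+1)) powr \<beta>)) / 3 - (1/real n + 1/(real n * ln (ln (real n)) powr \<beta>)) / 3) \<in> O(\<lambda>n. 1 / real n ^ 2)"
    by simp
  have "eventually (\<lambda>n. (1/(real n+1) + 1/((real n+1) * ln (ln (real n+1)) powr \<beta>)) / 3 - (1/real n + 1/(real n * ln (ln (real n)) powr \<beta>)) / 3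
       = r_seq \<beta> (Suc n) - r_seq \<beta> n) sequentially"
    using eventually_ge_at_top[of 4]
  proof eventually_elim
    case (elim n)
    thus ?case by (simp add: r_seq_ge4 add_ac)
  qed
  from landau_o.big.in_cong[OF this] * show ?thesis by simp
qed

lemma r_seq_bigo:
  assumes "0 \<le> \<beta>" "\<beta> < 1"
  shows "r_seq \<beta> \<in> O(\<lambda>n. 1 / real n)"
proof -
  have "(\<lambda>x::real. (1/x + 1/(x * ln (ln x) powr \<beta>)) / 3) \<in> O(\<lambda>x. 1/x)"
    using assms(2) order_le_imp_less_or_eq[OF assms(1)]
    by (elim disjE) (real_asymp, hypsubst, real_asymp)
  from landau_o.big.compose[OF this filterlim_real_sequentially]
  have *: "(\<lambda>n. (1/real n + 1/(real n * ln (ln (real n)) powr \<beta>)) / 3) \<in> O(\<lambda>n. 1 / real n)"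
    by simp
  have "eventually (\<lambda>n. (1/real n + 1/(real n * ln (ln (real n)) powr \<beta>)) / 3
       = r_seq \<beta> n) sequentially"
    using eventually_ge_at_top[of 4]
  proof eventually_elim
    case (elim n)
    thus ?case by (simp add: r_seq_ge4)
  qed
  from landau_o.big.in_cong[OF this] * show ?thesis by simp
qed

text \<open>For \<open>v = vscale \<beta> * u\<close> the differences \<open>v n - v (n+1)\<close>
  are asymptotic to \<open>u n\<close>. Hence \<open>v\<close> eventually decreases, its telescoping
  series dominates that of \<open>u\<close>, and once \<open>v\<close> is known to tend to 0,
  summing from \<open>k\<close> on compares \<open>v k\<close> with the tail of
  \<open>u\<close>.\<close>

lemma tail_asymptotic:
  fixes u :: "nat \<Rightarrow> real"
  assumes \<beta>: "0 \<le> \<beta>" "\<beta> < 1" and pos: "\<And>n. u n > 0"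
    and ratio: "(\<lambda>n. u (Suc n) / u n - (1 - 3 * r_seq \<beta> (Suc n))) \<in> O(\<lambda>n. 1 / real n ^ 2)"
  shows "summable u" "(\<lambda>k. u k * vscale \<beta> k / (\<Sum>j. u (j + k))) \<longlonglongrightarrow> 1"
proof -
  define err where "err n = u (Suc n) / u n - (1 - 3 * r_seq \<beta> (Suc n))" for n
  define v where "v n = vscale \<beta> n * u n" for n
  have "(\<lambda>n. vscale \<beta> (Suc n) * err n) \<in> O(\<lambda>n. vscale \<beta> (Suc n) * (1 / real n ^ 2))"
    using ratio unfolding err_def by (intro landau_o.big.mult_left)
  also have "(\<lambda>n. vscale \<beta> (Suc n) * (1 / real n ^ 2)) \<in> o(\<lambda>_. 1)"
    using vscale_over_square[OF \<beta>] by (intro smalloI_tendsto) auto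
  finally have "(\<lambda>n. vscale \<beta> (Suc n) * err n) \<longlonglongrightarrow> 0"
    by (auto dest: smalloD_tendsto)
  from tendsto_diff[OF vscale_step[OF \<beta>] this]
  have "(\<lambda>n. vscale \<beta> n - vscale \<beta> (Suc n) + vscale \<beta> (Suc n) * (3 * r_seq \<beta> (Suc n))
      - vscale \<beta> (Suc n) * err n) \<longlonglongrightarrow> 1" by simp
  also have "(\<lambda>n. vscale \<beta> n - vscale \<beta> (Suc n) + vscale \<beta> (Suc n) * (3 * r_seq \<beta> (Suc n))
      - vscale \<beta> (Suc n) * err n) = (\<lambda>n. (v n - v (Suc n)) / u n)"
    using pos by (auto simp: err_def v_def field_simps less_imp_neq[symmetric])
  finally have lim: "(\<lambda>n. (v n - v (Suc n)) / u n) \<longlonglongrightarrow> 1" .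
  have bounds: "eventually (\<lambda>n. n \<ge> 4 \<and> (1 - \<epsilon>) * u n \<le> v n - v (Suc n) \<and> v n - v (Suc n) \<le> (1 + \<epsilon>) * u n) sequentially"
    if "\<epsilon> > 0" for \<epsilon>
  proof -
    have "eventually (\<lambda>n. dist ((v n - v (Suc n)) / u n) 1 < \<epsilon>) sequentially"
      using lim that by (rule tendstoD)
    thus ?thesis using eventually_ge_at_top[of 4]
    proof eventually_elim
      case (elim n)
      hence "1 - \<epsilon> \<le> (v n - v (Suc n)) / u n" "(v n - v (Suc n)) / u n \<le> 1 + \<epsilon>"
        by (auto simp: dist_real_def)
      thus ?case using pos[of n] elim by (auto simp: field_simps)
    qed
  qed
  obtain N where N: "\<And>n. n \<ge> N \<Longrightarrow> n \<ge> 4 \<and> u n \<le> 2 * (v n - v (Suc n))"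
    using bounds[of "1/2"] unfolding eventually_sequentially by (auto simp: field_simps)
  have vnn: "0 \<le> v n" if "n \<ge> N" for n
    using vscale_pos[of n \<beta>] pos[of n] N[OF that] by (simp add: v_def)
  have "summable (\<lambda>n. u (n + N))"
  proof (rule summableI_nonneg_bounded)
    fix m
    have "(\<Sum>i<m. u (i + N)) \<le> (\<Sum>i<m. 2 * (v (i + N) - v (Suc i + N)))"
      using N by (intro sum_mono) auto
    also have "\<dots> = 2 * (v N - v (m + N))"
      by (subst sum_distrib_left[symmetric], subst sum_lessThan_telescope') simp
    also have "\<dots> \<le> 2 * v N" using vnn[of "m + N"] by simp
    finally show "(\<Sum>i<m. u (i + N)) \<le> 2 * v N" .
  qed (use pos in \<open>auto intro: less_imp_le\<close>)
  thus sum: "summable u" by (simp add: summable_iff_shift)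
  have "decseq (\<lambda>n. v (n + N))"
    by (rule decseq_SucI) (use N pos less_imp_le in \<open>smt (verit) add_Suc le_add2\<close>)
  then obtain l where l: "(\<lambda>n. v (n + N)) \<longlonglongrightarrow> l" "\<And>i. l \<le> v (i + N)"
    using decseq_convergent[of "\<lambda>n. v (n + N)" 0] vnn by (metis le_add2)
  have l0: "l \<ge> 0" using l(1) vnn by (intro tendsto_lowerbound[OF l(1)]) auto
  \<comment> \<open>If \<open>l > 0\<close>, then \<open>u n \<ge> l / vscale \<beta> n\<close>, so
    \<open>1 / vscale \<beta>\<close> would be summable. But the increments of
    \<open>gscale \<beta>\<close> are eventually at most twice these terms, and
    \<open>gscale \<beta>\<close> is unbounded.\<close>
  have "l = 0"
  proof (rule ccontr)
    assume "l \<noteq> 0"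
    hence lp: "l > 0" using l0 by simp
    have "summable (\<lambda>n. u (n + N) / l)"
      using \<open>summable (\<lambda>n. u (n + N))\<close> by (rule summable_divide)
    hence "summable (\<lambda>n. 1 / vscale \<beta> (n + N))"
    proof (rule summable_comparison_test'[where N = 0])
      fix n :: nat
      have "l \<le> vscale \<beta> (n + N) * u (n + N)" using l(2)[of n] by (simp add: v_def)
      moreover have "vscale \<beta> (n + N) > 0" using N[of "n + N"] by (intro vscale_pos) auto
      ultimately show "norm (1 / vscale \<beta> (n + N)) \<le> u (n + N) / l"
        using lp by (simp add: field_simps)
    qed
    hence S: "summable (\<lambda>n. 1 / vscale \<beta> n)"
      using summable_iff_shift[of "\<lambda>n. 1 / vscale \<beta> n" N] by simp
    have "eventually (\<lambda>n. (gscale \<beta> (Suc n) - gscale \<beta> n) * vscale \<beta> (Suc n) < 2) sequentially"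
      using gscale_step[OF \<beta>] by (rule order_tendstoD) simp
    then obtain K where K: "\<And>n. n \<ge> K \<Longrightarrow> (gscale \<beta> (Suc n) - gscale \<beta> n) * vscale \<beta> (Suc n) < 2"
      unfolding eventually_sequentially by auto
    define L where "L = max K 4"
    have L: "gscale \<beta> (Suc n) - gscale \<beta> n \<le> 2 * (1 / vscale \<beta> (Suc n))" if "n \<ge> L" for n
      using K[of n] that vscale_pos[of "Suc n" \<beta>] by (simp add: L_def field_simps)
    have bd: "gscale \<beta> (m + L) \<le> gscale \<beta> L + 2 * (\<Sum>n. 1 / vscale \<beta> (Suc (n + L)))" for m
    proof -
      have S': "summable (\<lambda>n. 1 / vscale \<beta> (Suc (n + L)))"
        using summable_ignore_initial_segment[OF S, of "Suc L"] by simp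
      have "gscale \<beta> (m + L) - gscale \<beta> L = (\<Sum>i<m. gscale \<beta> (Suc i + L) - gscale \<beta> (i + L))"
        by (subst sum_lessThan_telescope) simp
      also have "\<dots> \<le> (\<Sum>i<m. 2 * (1 / vscale \<beta> (Suc (i + L))))"
        using L by (intro sum_mono) auto
      also have "\<dots> = 2 * (\<Sum>i<m. 1 / vscale \<beta> (Suc (i + L)))" by (simp add: sum_distrib_left)
      also have "(\<Sum>i<m. 1 / vscale \<beta> (Suc (i + L))) \<le> (\<Sum>n. 1 / vscale \<beta> (Suc (n + L)))"
        using S' by (rule sum_le_suminf) (auto intro!: less_imp_le vscale_pos simp: L_def)
      finally show ?thesis by simp
    qed
    have "eventually (\<lambda>n. gscale \<beta> n > gscale \<beta> L + 2 * (\<Sum>n. 1 / vscale \<beta> (Suc (n + L)))) sequentially"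
      using gscale_at_top[OF \<beta>] by (simp add: filterlim_at_top_dense)
    then obtain m where "m \<ge> L" "gscale \<beta> m > gscale \<beta> L + 2 * (\<Sum>n. 1 / vscale \<beta> (Suc (n + L)))"
      unfolding eventually_sequentially by (metis nle_le)
    with bd[of "m - L"] show False by simp
  qed
  hence v0: "v \<longlonglongrightarrow> 0" using l(1) by (simp add: LIMSEQ_ignore_initial_segment LIMSEQ_offset)
  show "(\<lambda>k. u k * vscale \<beta> k / (\<Sum>j. u (j + k))) \<longlonglongrightarrow> 1"
  proof (rule tendstoI)
    fix e :: real assume "e > 0"
    define \<epsilon> where "\<epsilon> = e / 2"
    have \<epsilon>: "\<epsilon> > 0" "\<epsilon> < e" using \<open>e > 0\<close> by (auto simp: \<epsilon>_def)
    obtain K where K: "\<And>n. n \<ge> K \<Longrightarrow> (1 - \<epsilon>) * u n \<le> v n - v (Suc n) \<and> v n - v (Suc n) \<le> (1 + \<epsilon>) * u n"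
      using bounds[OF \<epsilon>(1)] unfolding eventually_sequentially by blast
    show "eventually (\<lambda>k. dist (u k * vscale \<beta> k / (\<Sum>j. u (j + k))) 1 < e) sequentially"
      using eventually_ge_at_top[of K]
    proof eventually_elim
      case (elim k)
      have s: "summable (\<lambda>j. u (j + k))" using sum by (rule summable_ignore_initial_segment)
      have hp: "(\<Sum>j. u (j + k)) > 0" using s pos by (intro suminf_pos)
      have t: "(\<lambda>j. v (j + k) - v (Suc j + k)) sums (v k)"
        using telescope_sums'[of "\<lambda>j. v (j + k)" 0] v0 LIMSEQ_ignore_initial_segment[OF v0, of k] by simp
      have "(1 - \<epsilon>) * (\<Sum>j. u (j + k)) \<le> v k"
        by (rule sums_le[OF _ sums_mult[OF summable_sums[OF s]] t]) (use K elim in auto)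
      moreover have "v k \<le> (1 + \<epsilon>) * (\<Sum>j. u (j + k))"
        by (rule sums_le[OF _ t sums_mult[OF summable_sums[OF s]]]) (use K elim in auto)
      ultimately have "1 - \<epsilon> \<le> v k / (\<Sum>j. u (j + k))" "v k / (\<Sum>j. u (j + k)) \<le> 1 + \<epsilon>"
        using hp by (auto simp: field_simps)
      hence "dist (v k / (\<Sum>j. u (j + k))) 1 \<le> \<epsilon>" by (auto simp: dist_real_def)
      thus ?case using \<epsilon> by (simp add: v_def mult.commute)
    qed
  qed
qed

section \<open>Increments of harmonic functions\<close>

text \<open>The weight \<open>n^2\<close> does not spoil the contraction: consecutive weights have
  ratio tending to 1, so the weighted factor stays below \<open>(1 + \<theta>) / 2\<close>.\<close>

lemma contraction_forward_bigo:
  fixes e :: "nat \<Rightarrow> real"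
  assumes nn: "\<And>n. e n \<ge> 0" and \<theta>: "0 \<le> \<theta>" "\<theta> < 1" and "C \<ge> 0"
    and step: "eventually (\<lambda>n. e (Suc n) \<le> \<theta> * e n + C / real n ^ 2) sequentially"
  shows "e \<in> O(\<lambda>n. 1 / real n ^ 2)"
proof -
  have "((\<lambda>x::real. \<theta> * ((x + 1)\<^sup>2 / x\<^sup>2)) \<longlongrightarrow> \<theta> * 1) at_top"
    by (rule tendsto_mult[OF tendsto_const]) real_asymp
  from filterlim_compose[OF this filterlim_real_sequentially]
  have "(\<lambda>n. \<theta> * ((real n + 1)\<^sup>2 / (real n)\<^sup>2)) \<longlonglongrightarrow> \<theta>" by simp
  hence "eventually (\<lambda>n. \<theta> * ((real n + 1)\<^sup>2 / (real n)\<^sup>2) < (1 + \<theta>) / 2) sequentially"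
    using \<theta> by (intro order_tendstoD) auto
  from eventually_conj[OF this step] obtain N0 where
    N0: "\<And>n. n \<ge> N0 \<Longrightarrow> \<theta> * ((real n + 1)\<^sup>2 / (real n)\<^sup>2) < (1 + \<theta>) / 2 \<and> e (Suc n) \<le> \<theta> * e n + C / real n ^ 2"
    unfolding eventually_sequentially by blast
  define N where "N = Suc N0"
  \<comment> \<open>A level preserved by the induction step: since
    \<open>(n + 1)^2 \<le> 4 * n^2\<close> the forcing adds at most \<open>4 * C\<close>, and this
    is at most \<open>(1 - \<theta>) / 2 * D\<close> when
    \<open>D \<ge> 8 * C / (1 - \<theta>)\<close>.\<close>
  define D where "D = max (8 * C / (1 - \<theta>)) (e N * real N ^ 2)"
  have bd: "e n * real n ^ 2 \<le> D" if "n \<ge> N" for n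
    using that
  proof (induction rule: dec_induct)
    case base thus ?case by (simp add: D_def)
  next
    case (step n)
    have n: "real n \<ge> 1" using step by (simp add: N_def)
    have "e (Suc n) * real (Suc n) ^ 2 \<le> (\<theta> * e n + C / real n ^ 2) * real (Suc n) ^ 2"
      using N0[of n] step by (intro mult_right_mono) (auto simp: N_def)
    also have "\<dots> = (\<theta> * ((real n + 1)\<^sup>2 / (real n)\<^sup>2)) * (e n * real n ^ 2) + C * ((real n + 1)\<^sup>2 / (real n)\<^sup>2)"
      using n by (simp add: field_simps)
    also have "\<dots> \<le> (1 + \<theta>) / 2 * (e n * real n ^ 2) + C * 4"
    proof (intro add_mono mult_mono mult_left_mono)
      have "(real n + 1)\<^sup>2 \<le> (2 * real n)\<^sup>2" using n by (intro power_mono) auto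
      thus "(real n + 1)\<^sup>2 / (real n)\<^sup>2 \<le> 4" using n by (simp add: divide_le_eq power_mult_distrib)
      show "\<theta> * ((real n + 1)\<^sup>2 / (real n)\<^sup>2) \<le> (1 + \<theta>) / 2" using N0[of n] step by (simp add: N_def)
    qed (use \<open>C \<ge> 0\<close> \<theta> nn in auto)
    also have "\<dots> \<le> (1 + \<theta>) / 2 * D + (1 - \<theta>) / 2 * D"
    proof (intro add_mono mult_left_mono)
      have "8 * C / (1 - \<theta>) \<le> D" by (simp add: D_def)
      thus "C * 4 \<le> (1 - \<theta>) / 2 * D" using \<theta> by (simp add: field_simps)
    qed (use step \<theta> in auto)
    also have "\<dots> = D" by (simp add: field_simps)
    finally show ?case .
  qed
  show ?thesis
  proof (rule bigoI[of _ D])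
    show "eventually (\<lambda>n. norm (e n) \<le> D * norm (1 / real n ^ 2)) sequentially"
      using eventually_ge_at_top[of N]
    proof eventually_elim
      case (elim n)
      hence "n > 0" by (simp add: N_def)
      thus ?case using bd[OF elim] nn[of n] by (simp add: field_simps)
    qed
  qed
qed

text \<open>Iterating \<open>m\<close> steps towards infinity, the forcing terms met on the way only
  get smaller and form a geometric series, while the unknown far value enters as
  \<open>\<theta> ^ m * B\<close>. Letting \<open>m\<close> grow removes it; boundedness is what
  excludes solutions that blow up.\<close>

lemma contraction_backward_bigo:
  fixes e :: "nat \<Rightarrow> real"
  assumes nn: "\<And>n. e n \<ge> 0" and \<theta>: "0 \<le> \<theta>" "\<theta> < 1" and "C \<ge> 0"
    and step: "eventually (\<lambda>n. e n \<le> \<theta> * e (Suc n) + C / real n ^ 2) sequentially"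
    and bdd: "eventually (\<lambda>n. e n \<le> B) sequentially"
  shows "e \<in> O(\<lambda>n. 1 / real n ^ 2)"
proof -
  from eventually_conj[OF bdd step] obtain N where
    N: "\<And>n. n \<ge> N \<Longrightarrow> e n \<le> B \<and> e n \<le> \<theta> * e (Suc n) + C / real n ^ 2"
    unfolding eventually_sequentially by blast
  have it: "e n \<le> \<theta> ^ m * B + C / (1 - \<theta>) / real n ^ 2" if "n \<ge> Suc N" for n m
    using that
  proof (induction m arbitrary: n)
    case 0
    have "0 \<le> C / (1 - \<theta>) / real n ^ 2" using \<open>C \<ge> 0\<close> \<theta> by simp
    with N[of n] 0 show ?case by auto
  next
    case (Suc m)
    have "e n \<le> \<theta> * e (Suc n) + C / real n ^ 2" using N Suc by simp
    also have "\<dots> \<le> \<theta> * (\<theta> ^ m * B + C / (1 - \<theta>) / real (Suc n) ^ 2) + C / real n ^ 2"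
      using Suc.prems \<theta> by (intro add_right_mono mult_left_mono Suc.IH) auto
    also have "\<dots> \<le> \<theta> * (\<theta> ^ m * B + C / (1 - \<theta>) / real n ^ 2) + C / real n ^ 2"
      using Suc.prems \<theta> \<open>C \<ge> 0\<close>
      by (intro add_right_mono mult_left_mono add_left_mono divide_left_mono power_mono) auto
    also have "\<dots> = \<theta> ^ Suc m * B + C / (1 - \<theta>) / real n ^ 2"
      using \<theta> Suc.prems by (simp add: field_simps)
    finally show ?case .
  qed
  have bd: "e n \<le> C / (1 - \<theta>) / real n ^ 2" if "n \<ge> Suc N" for n
  proof -
    have "(\<lambda>m. \<theta> ^ m * B + C / (1 - \<theta>) / real n ^ 2) \<longlonglongrightarrow> 0 * B + C / (1 - \<theta>) / real n ^ 2"
      using \<theta> by (intro tendsto_intros LIMSEQ_power_zero) auto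
    from tendsto_lowerbound[OF this] it[OF that] show ?thesis by auto
  qed
  show ?thesis
    using nn by (intro bigoI[of _ "C / (1 - \<theta>)"] eventually_mono[OF eventually_ge_at_top[of "Suc N"]])
      (auto dest: bd)
qed

text \<open>The lower bound improves on the trivial one \<open>a n\<close>: the contraction factor of
  \<open>x \<mapsto> a + b / x\<close> near \<open>1\<close> is \<open>b / x\<close>, and \<open>a0 = b0\<close> is possible. Any constant strictly
  between \<open>1\<close> and \<open>4 / 3\<close> would do in place of \<open>7 / 6\<close>.\<close>

lemma continued_fraction_bounds:
  fixes a a' b x x' :: "nat \<Rightarrow> real"
  assumes lim: "a \<longlonglongrightarrow> a0" "a' \<longlonglongrightarrow> a0" "b \<longlonglongrightarrow> b0"
    and ab: "0 < b0" "b0 \<le> a0" "a0 \<le> 1"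
    and x: "eventually (\<lambda>n. x n = a n + b n / x' n) sequentially"
  shows "eventually (\<lambda>n. a' n \<le> x' n) sequentially \<Longrightarrow> eventually (\<lambda>n. x n \<le> 3) sequentially"
    and "eventually (\<lambda>n. 0 < x' n \<and> x' n \<le> 3) sequentially \<Longrightarrow> eventually (\<lambda>n. 7 / 6 * b0 \<le> x n) sequentially"
proof -
  have b: "eventually (\<lambda>n. b n > 0) sequentially"
    using lim(3) ab by (intro order_tendstoD)
  {
    assume *: "eventually (\<lambda>n. a' n \<le> x' n) sequentially"
    have a': "eventually (\<lambda>n. a' n > 0) sequentially"
      using ab by (intro order_tendstoD(1)[OF lim(2)]) simp
    have "(\<lambda>n. a n + b n / a' n) \<longlonglongrightarrow> a0 + b0 / a0"
      using ab by (intro tendsto_intros lim) auto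
    \<comment> \<open>The limit \<open>a0 + b0 / a0\<close> is at most 2, so 3 leaves room for the
      convergence.\<close>
    moreover have "b0 / a0 \<le> 1" using ab by simp
    hence "a0 + b0 / a0 < 3" using ab by linarith
    ultimately have "eventually (\<lambda>n. a n + b n / a' n < 3) sequentially"
      by (intro order_tendstoD)
    thus "eventually (\<lambda>n. x n \<le> 3) sequentially"
      using * a' b x
    proof eventually_elim
      case (elim n)
      have "b n / x' n \<le> b n / a' n" using elim by (intro divide_left_mono) auto
      thus ?case using elim by simp
    qed
  next
    assume *: "eventually (\<lambda>n. 0 < x' n \<and> x' n \<le> 3) sequentially"
    have "(\<lambda>n. a n + b n / 3) \<longlonglongrightarrow> a0 + b0 / 3"
      by (intro tendsto_intros lim) auto
    moreover have "a0 + b0 / 3 > 7 / 6 * b0" using ab by linarith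
    ultimately have "eventually (\<lambda>n. a n + b n / 3 > 7 / 6 * b0) sequentially"
      by (intro order_tendstoD)
    thus "eventually (\<lambda>n. 7 / 6 * b0 \<le> x n) sequentially"
      using * b x
    proof eventually_elim
      case (elim n)
      have "b n / 3 \<le> b n / x' n" using elim by (intro divide_left_mono) auto
      thus ?case using elim by simp
    qed
  }
qed

text \<open>Subtracting the two fixed-point forms gives
  \<open>x - \<rho> = - b / (\<rho> * x') * (x' - \<rho>)\<close>. Here \<open>x'\<close> is the
  preceding ratio for a forward recursion and the following one for a backward recursion, so both
  directions share the estimate.\<close>

lemma continued_fraction_contraction:
  fixes a b x x' \<rho> :: "nat \<Rightarrow> real"
  assumes lim: "b \<longlonglongrightarrow> b0" "\<rho> \<longlonglongrightarrow> 1" and "0 < b0"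
    and x: "eventually (\<lambda>n. x n = a n + b n / x' n) sequentially"
    and \<rho>: "eventually (\<lambda>n. \<rho> n = a n + b n / \<rho> n) sequentially"
    and lower: "eventually (\<lambda>n. 7 / 6 * b0 \<le> x' n) sequentially"
  shows "eventually (\<lambda>n. \<bar>x n - \<rho> n\<bar> \<le> 13 / 14 * \<bar>x' n - \<rho> n\<bar>) sequentially"
proof -
  have "(\<lambda>n. b n / \<rho> n) \<longlonglongrightarrow> b0 / 1"
    by (intro tendsto_intros lim) auto
  \<comment> \<open>Any constant strictly between 1 and \<open>7 / 6\<close> would do in place of
    \<open>13 / 12\<close>; the contraction factor is
    \<open>(13 / 12) / (7 / 6) = 13 / 14\<close>.\<close>
  hence 1: "eventually (\<lambda>n. b n / \<rho> n < 13 / 12 * b0) sequentially"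
    using \<open>0 < b0\<close> by (intro order_tendstoD) auto
  have 2: "eventually (\<lambda>n. \<rho> n > 0) sequentially" "eventually (\<lambda>n. b n > 0) sequentially"
    using lim \<open>0 < b0\<close> by (auto intro: order_tendstoD)
  show ?thesis using 1 2 x \<rho> lower
  proof eventually_elim
    case (elim n)
    have xp: "x' n > 0" using elim(6) \<open>0 < b0\<close> by linarith
    have "x n - \<rho> n = b n / x' n - b n / \<rho> n" using elim(4,5) by linarith
    also have "\<dots> = - (b n / \<rho> n / x' n) * (x' n - \<rho> n)"
      using elim(2) xp by (simp add: field_simps)
    finally have "\<bar>x n - \<rho> n\<bar> = b n / \<rho> n / x' n * \<bar>x' n - \<rho> n\<bar>"
      using elim(2,3) xp by (simp add: abs_mult)
    also have "\<dots> \<le> 13 / 14 * \<bar>x' n - \<rho> n\<bar>"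
    proof (rule mult_right_mono)
      have "b n / \<rho> n / x' n \<le> (13 / 12 * b0) / (7 / 6 * b0)"
        using elim(1,2,3,6) \<open>0 < b0\<close> by (intro frac_le) auto
      thus "b n / \<rho> n / x' n \<le> 13 / 14" using \<open>0 < b0\<close> by simp
    qed simp
    finally show ?case .
  qed
qed

text \<open>The bounds bootstrap: \<open>a \<le> x\<close> yields \<open>x \<le> 3\<close>, which
  yields \<open>7 / 6 * b0 \<le> x\<close>. The step then contracts towards
  \<open>\<rho> (Suc n)\<close>; replacing it by \<open>\<rho> n\<close> costs the drift of the
  fixed point, which is \<open>O(1/n^2)\<close> and becomes the forcing term.\<close>

lemma forward_ratio_bigo:
  fixes a b x \<rho> :: "nat \<Rightarrow> real"
  assumes lim: "a \<longlonglongrightarrow> a0" "b \<longlonglongrightarrow> b0" "\<rho> \<longlonglongrightarrow> 1"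
    and ab: "0 < b0" "b0 \<le> a0" "a0 \<le> 1"
    and x: "eventually (\<lambda>n. x (Suc n) = a (Suc n) + b (Suc n) / x n) sequentially"
    and xpos: "\<And>n. x n > 0"
    and \<rho>: "eventually (\<lambda>n. \<rho> n = a n + b n / \<rho> n) sequentially"
    and \<rho>_diff: "(\<lambda>n. \<rho> (Suc n) - \<rho> n) \<in> O(\<lambda>n. 1 / real n ^ 2)"
  shows "(\<lambda>n. x n - \<rho> n) \<in> O(\<lambda>n. 1 / real n ^ 2)"
proof -
  have limS: "(\<lambda>n. a (Suc n)) \<longlonglongrightarrow> a0" "(\<lambda>n. b (Suc n)) \<longlonglongrightarrow> b0" "(\<lambda>n. \<rho> (Suc n)) \<longlonglongrightarrow> 1"
    using lim by (simp_all add: filterlim_sequentially_Suc)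
  note cf = continued_fraction_bounds[OF limS(1) lim(1) limS(2) ab x]
  have bS: "eventually (\<lambda>n. b (Suc n) > 0) sequentially"
    using limS ab by (intro order_tendstoD)
  have "eventually (\<lambda>n. a (Suc n) \<le> x (Suc n)) sequentially"
    using x bS
  proof eventually_elim
    case (elim n)
    thus ?case using xpos[of n] by simp
  qed
  hence "eventually (\<lambda>n. a n \<le> x n) sequentially"
    by (subst (asm) eventually_sequentially_Suc[of "\<lambda>n. a n \<le> x n"])
  from cf(1)[OF this] have "eventually (\<lambda>n. x n \<le> 3) sequentially"
    by (subst (asm) eventually_sequentially_Suc[of "\<lambda>n. x n \<le> 3"])
  hence "eventually (\<lambda>n. 0 < x n \<and> x n \<le> 3) sequentially" using xpos by simp
  from cf(2)[OF this] have "eventually (\<lambda>n. 7 / 6 * b0 \<le> x n) sequentially"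
    by (subst (asm) eventually_sequentially_Suc[of "\<lambda>n. 7 / 6 * b0 \<le> x n"])
  moreover have "eventually (\<lambda>n. \<rho> (Suc n) = a (Suc n) + b (Suc n) / \<rho> (Suc n)) sequentially"
    using \<rho> by (subst eventually_sequentially_Suc[of "\<lambda>n. \<rho> n = a n + b n / \<rho> n"])
  ultimately have contr: "eventually (\<lambda>n. \<bar>x (Suc n) - \<rho> (Suc n)\<bar> \<le> 13 / 14 * \<bar>x n - \<rho> (Suc n)\<bar>) sequentially"
    using continued_fraction_contraction[OF limS(2,3) ab(1) x] by blast
  from \<rho>_diff obtain C where C: "C > 0" "eventually (\<lambda>n. \<bar>\<rho> (Suc n) - \<rho> n\<bar> \<le> C * (1 / real n ^ 2)) sequentially"
    by (elim landau_o.bigE) simp_all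
  have "(\<lambda>n. \<bar>x n - \<rho> n\<bar>) \<in> O(\<lambda>n. 1 / real n ^ 2)"
  proof (rule contraction_forward_bigo[of _ "13/14" C])
    show "eventually (\<lambda>n. \<bar>x (Suc n) - \<rho> (Suc n)\<bar> \<le> 13 / 14 * \<bar>x n - \<rho> n\<bar> + C / real n ^ 2) sequentially"
      using contr C(2)
    proof eventually_elim
      case (elim n)
      have "y \<le> 13 / 14 * B + c" if "y \<le> 13 / 14 * A" "A \<le> B + c" "0 \<le> c" for y A B c :: real
        using that by linarith
      note this[OF elim(1)]
      moreover have "\<bar>x n - \<rho> (Suc n)\<bar> \<le> \<bar>x n - \<rho> n\<bar> + C / real n ^ 2" using elim(2) by simp
      moreover have "0 \<le> C / real n ^ 2" using C by simp
      ultimately show ?case by blast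
    qed
  qed (use C in auto)
  thus ?thesis by simp
qed

text \<open>Same bootstrap with the neighbour on the other side. The backward contraction also asks
  for a bound on the error itself; \<open>5 = 3 + 2\<close> comes from \<open>x \<le> 3\<close> and
  \<open>\<rho> < 2\<close>.\<close>

lemma backward_ratio_bigo:
  fixes a b x \<rho> :: "nat \<Rightarrow> real"
  assumes lim: "a \<longlonglongrightarrow> a0" "b \<longlonglongrightarrow> b0" "\<rho> \<longlonglongrightarrow> 1"
    and ab: "0 < b0" "b0 \<le> a0" "a0 \<le> 1"
    and x: "eventually (\<lambda>n. x n = a n + b n / x (Suc n)) sequentially"
    and xpos: "\<And>n. x n > 0"
    and \<rho>: "eventually (\<lambda>n. \<rho> n = a n + b n / \<rho> n) sequentially"
    and \<rho>_diff: "(\<lambda>n. \<rho> (Suc n) - \<rho> n) \<in> O(\<lambda>n. 1 / real n ^ 2)"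
  shows "(\<lambda>n. x n - \<rho> n) \<in> O(\<lambda>n. 1 / real n ^ 2)"
proof -
  have limS: "(\<lambda>n. a (Suc n)) \<longlonglongrightarrow> a0"
    using lim by (simp add: filterlim_sequentially_Suc)
  note cf = continued_fraction_bounds[OF lim(1) limS lim(2) ab x]
  have bS: "eventually (\<lambda>n. b n > 0) sequentially"
    using lim ab by (intro order_tendstoD)
  have "eventually (\<lambda>n. a n \<le> x n) sequentially"
    using x bS
  proof eventually_elim
    case (elim n)
    thus ?case using xpos[of "Suc n"] by simp
  qed
  hence "eventually (\<lambda>n. a (Suc n) \<le> x (Suc n)) sequentially"
    by (subst eventually_sequentially_Suc[of "\<lambda>n. a n \<le> x n"])
  from cf(1)[OF this] have upper: "eventually (\<lambda>n. x n \<le> 3) sequentially" .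
  hence "eventually (\<lambda>n. x (Suc n) \<le> 3) sequentially"
    by (subst eventually_sequentially_Suc[of "\<lambda>n. x n \<le> 3"])
  hence "eventually (\<lambda>n. 0 < x (Suc n) \<and> x (Suc n) \<le> 3) sequentially" using xpos by simp
  from cf(2)[OF this] have "eventually (\<lambda>n. 7 / 6 * b0 \<le> x (Suc n)) sequentially"
    by (subst eventually_sequentially_Suc[of "\<lambda>n. 7 / 6 * b0 \<le> x n"])
  from continued_fraction_contraction[OF lim(2,3) ab(1) x \<rho> this]
  have contr: "eventually (\<lambda>n. \<bar>x n - \<rho> n\<bar> \<le> 13 / 14 * \<bar>x (Suc n) - \<rho> n\<bar>) sequentially" .
  from \<rho>_diff obtain C where C: "C > 0" "eventually (\<lambda>n. \<bar>\<rho> (Suc n) - \<rho> n\<bar> \<le> C * (1 / real n ^ 2)) sequentially"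
    by (elim landau_o.bigE) simp_all
  have "(\<lambda>n. \<bar>x n - \<rho> n\<bar>) \<in> O(\<lambda>n. 1 / real n ^ 2)"
  proof (rule contraction_backward_bigo[of _ "13/14" C 5])
    show "eventually (\<lambda>n. \<bar>x n - \<rho> n\<bar> \<le> 13 / 14 * \<bar>x (Suc n) - \<rho> (Suc n)\<bar> + C / real n ^ 2) sequentially"
      using contr C(2)
    proof eventually_elim
      case (elim n)
      have "y \<le> 13 / 14 * B + c" if "y \<le> 13 / 14 * A" "A \<le> B + c" "0 \<le> c" for y A B c :: real
        using that by linarith
      note this[OF elim(1)]
      moreover have "\<bar>x (Suc n) - \<rho> n\<bar> \<le> \<bar>x (Suc n) - \<rho> (Suc n)\<bar> + C / real n ^ 2" using elim(2) by simp
      moreover have "0 \<le> C / real n ^ 2" using C by simp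
      ultimately show ?case by blast
    qed
    have "eventually (\<lambda>n. \<rho> n > 0) sequentially" "eventually (\<lambda>n. \<rho> n < 2) sequentially"
      using lim(3) by (auto intro: order_tendstoD)
    with upper show "eventually (\<lambda>n. \<bar>x n - \<rho> n\<bar> \<le> 5) sequentially"
    proof eventually_elim
      case (elim n)
      thus ?case using xpos[of n] by simp
    qed
  qed (use C in auto)
  thus ?thesis by simp
qed

section \<open>Positive solutions of the backward recursion\<close>

fun fwd_sol :: "(nat \<Rightarrow> real) \<Rightarrow> (nat \<Rightarrow> real) \<Rightarrow> real \<Rightarrow> nat \<Rightarrow> real" where
  "fwd_sol a b t 0 = 1"
| "fwd_sol a b t (Suc 0) = t"
| "fwd_sol a b t (Suc (Suc n)) = (fwd_sol a b t n - a n * fwd_sol a b t (Suc n)) / b n"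

text \<open>The dominant root of the forward recursion has alternating sign, so positivity of the
  whole sequence pins down the initial slope \<open>t\<close>; it is found by intersecting the nested compact
  sets of slopes for which the first terms are nonnegative.\<close>

lemma positive_backward_solution:
  fixes a b :: "nat \<Rightarrow> real"
  assumes a: "\<And>n. a n > 0" and b: "\<And>n. b n > 0"
  shows "\<exists>d. (\<forall>n. d n > 0) \<and> (\<forall>n. d n = a n * d (Suc n) + b n * d (Suc (Suc n)))"
proof -
  \<comment> \<open>The offset 2 makes already \<open>S 0\<close> bounded: the term of index 1
    forces \<open>t \<ge> 0\<close>, the term of index 2 forces
    \<open>t \<le> 1 / a 0\<close>.\<close>
  define S where "S N = {t. \<forall>n\<le>N+2. fwd_sol a b t n \<ge> 0}" for N
  have rec: "fwd_sol a b t n = a n * fwd_sol a b t (Suc n) + b n * fwd_sol a b t (Suc (Suc n))" for t n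
    using b[of n] by simp
  have cont: "continuous_on UNIV (\<lambda>t. fwd_sol a b t n)" for n
  proof (induction n rule: induct_nat_012)
    case (ge2 n)
    thus ?case using b[of n] by (auto intro!: continuous_intros)
  qed auto
  have closed: "closed (S N)" for N
  proof -
    have "S N = (\<Inter>n\<in>{..N+2}. {t. 0 \<le> fwd_sol a b t n})" by (auto simp: S_def)
    also have "closed \<dots>" by (intro closed_INT ballI closed_Collect_le continuous_on_const cont)
    finally show ?thesis .
  qed
  have "bounded (S 0)"
  proof (rule bounded_subset[OF bounded_closed_interval])
    show "S 0 \<subseteq> {0..1 / a 0}"
    proof
      fix t assume "t \<in> S 0"
      hence "fwd_sol a b t 1 \<ge> 0" "fwd_sol a b t 2 \<ge> 0" by (auto simp: S_def)
      thus "t \<in> {0..1 / a 0}" using a[of 0] b[of 0] by (auto simp: numeral_2_eq_2 field_simps)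
    qed
  qed
  have nonempty: "S N \<noteq> {}" for N
  proof -
    \<comment> \<open>On a finite stretch the recursion is run downwards from the value 1 at
      \<open>M\<close> and \<open>M + 1\<close>, where positivity is automatic; below,
      \<open>k\<close> counts the downward steps. The slope \<open>d 1 / d 0\<close> of the result
      lies in \<open>S N\<close>.\<close>
    have "\<exists>d. (\<forall>n\<le>M+1. d n > (0::real)) \<and> (\<forall>n<M. d n = a n * d (Suc n) + b n * d (Suc (Suc n)))" for M
    proof -
      have "\<exists>d. (\<forall>n. n \<ge> M - k \<and> n \<le> M + 1 \<longrightarrow> d n > (0::real)) \<and>
          (\<forall>n. n \<ge> M - k \<and> n < M \<longrightarrow> d n = a n * d (Suc n) + b n * d (Suc (Suc n)))" for k
      proof (induction k)
        case 0
        show ?case by (intro exI[of _ "\<lambda>_. 1"]) auto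
      next
        case (Suc k)
        then obtain d where d: "\<And>n. n \<ge> M - k \<Longrightarrow> n \<le> M + 1 \<Longrightarrow> d n > (0::real)"
          "\<And>n. n \<ge> M - k \<Longrightarrow> n < M \<Longrightarrow> d n = a n * d (Suc n) + b n * d (Suc (Suc n))" by blast
        show ?case
        proof (cases "k < M")
          case True
          define m where "m = M - Suc k"
          have m: "M - k = Suc m" "m < M" using True by (auto simp: m_def)
          define d' where "d' = d(m := a m * d (Suc m) + b m * d (Suc (Suc m)))"
          have "d' n > 0" if "n \<ge> m" "n \<le> M + 1" for n
          proof (cases "n = m")
            case True
            have "d (Suc m) > 0" "d (Suc (Suc m)) > 0" using m by (auto intro!: d(1))
            thus ?thesis using True a[of m] b[of m] by (simp add: d'_def add_pos_pos)
          next
            case False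
            thus ?thesis using that m by (simp add: d'_def d(1))
          qed
          moreover have "d' n = a n * d' (Suc n) + b n * d' (Suc (Suc n))" if "n \<ge> m" "n < M" for n
            using that m d(2)[of n] by (cases "n = m") (auto simp: d'_def)
          ultimately show ?thesis unfolding m_def by blast
        next
          case False
          hence "M - Suc k = M - k" by simp
          thus ?thesis using Suc by simp
        qed
      qed
      from this[of M] show ?thesis by simp
    qed
    from this[of "N + 1"] obtain d where d: "\<And>n. n \<le> N + 2 \<Longrightarrow> d n > (0::real)"
      "\<And>n. n < N + 1 \<Longrightarrow> d n = a n * d (Suc n) + b n * d (Suc (Suc n))" by auto
    have "n \<le> N + 2 \<longrightarrow> fwd_sol a b (d 1 / d 0) n = d n / d 0" for n
    proof (induction n rule: induct_nat_012)
      case (ge2 n)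
      show ?case
      proof
        assume n: "Suc (Suc n) \<le> N + 2"
        hence "d n - a n * d (Suc n) = b n * d (Suc (Suc n))" using d(2)[of n] by simp
        hence "(d n / d 0 - a n * (d (Suc n) / d 0)) / b n = d (Suc (Suc n)) / d 0"
          using b[of n] by (simp add: diff_divide_distrib[symmetric])
        thus "fwd_sol a b (d 1 / d 0) (Suc (Suc n)) = d (Suc (Suc n)) / d 0"
          using ge2 n by simp
      qed
    qed (use d(1)[of 0] in auto)
    moreover have "d n / d 0 \<ge> 0" if "n \<le> N + 2" for n
      using d(1)[OF that] d(1)[of 0] by simp
    ultimately have "d 1 / d 0 \<in> S N" unfolding S_def by simp
    thus ?thesis by blast
  qed
  have "\<exists>t. \<forall>N. t \<in> S N"
  proof (rule bounded_closed_nest)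
    show "S n \<subseteq> S m" if "m \<le> n" for m n using that by (auto simp: S_def)
  qed (use closed nonempty \<open>bounded (S 0)\<close> in auto)
  then obtain t where "\<And>N. t \<in> S N" by auto
  hence "t \<in> S n" for n .
  hence nn: "fwd_sol a b t n \<ge> 0" for n unfolding S_def using trans_le_add1[OF order_refl] by blast
  define d where "d = fwd_sol a b t"
  have d0: "d 0 = 1" by (simp add: d_def)
  have dnn: "d n \<ge> 0" for n unfolding d_def by (rule nn)
  have drec: "d n = a n * d (Suc n) + b n * d (Suc (Suc n))" for n unfolding d_def by (rule rec)
  \<comment> \<open>The limit slope only gives nonnegative terms. With positive coefficients a zero
    at \<open>n\<close> forces a zero at \<open>n + 1\<close>, and two consecutive zeros propagate
    down to index 0, where the value is 1.\<close>
  have pos: "d n > 0" for n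
  proof (rule ccontr)
    assume "\<not> d n > 0"
    hence 0: "d n = 0" using dnn[of n] by simp
    have "a n * d (Suc n) \<ge> 0" "b n * d (Suc (Suc n)) \<ge> 0"
      by (intro mult_nonneg_nonneg dnn less_imp_le[OF a] less_imp_le[OF b])+
    hence "a n * d (Suc n) = 0" using drec[of n] 0 by linarith
    hence "d (Suc n) = 0" using a[of n] by simp
    have "d m = 0 \<and> d (Suc m) = 0" if "m \<le> n" for m
      using that
    proof (induction rule: inc_induct)
      case base show ?case using 0 \<open>d (Suc n) = 0\<close> by simp
    next
      case (step m) thus ?case using drec[of m] by simp
    qed
    from this[of 0] show False using d0 by simp
  qed
  show ?thesis by (intro exI[of _ d] conjI allI pos drec)
qed

section \<open>Asymptotics of \<open>rho_walk\<close>\<close>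

lemma rho_walk_fixed_point:
  assumes "q k > 0" "p1 k \<ge> 0" "p2 k > 0"
  shows "rho_walk q p1 p2 k > 0"
    and "rho_walk q p1 p2 k = (p1 k + p2 k) / q k + p2 k / q k / rho_walk q p1 p2 k"
proof -
  define a b where "a = (p1 k + p2 k) / q k" and "b = p2 k / q k"
  have ab: "a > 0" "b > 0" using assms by (auto simp: a_def b_def)
  define s where "s = sqrt (a\<^sup>2 + 4 * b)"
  have s: "s \<ge> 0" "s * s = a * a + 4 * b" using ab by (auto simp: s_def power2_eq_square)
  have \<rho>: "rho_walk q p1 p2 k = (a + s) / 2"
    by (simp add: rho_walk_def Let_def a_def b_def s_def)
  show pos: "rho_walk q p1 p2 k > 0" using ab s \<rho> by simp
  \<comment> \<open>\<open>rho_walk\<close> is the positive root of \<open>x^2 = a * x + b\<close>;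
    dividing by \<open>x\<close> gives the fixed-point form.\<close>
  have "(a + s) / 2 * ((a + s) / 2) = a * ((a + s) / 2) + b" using s(2) by (simp add: field_simps)
  hence "(a + s) / 2 = a + b / ((a + s) / 2)" using ab s by (simp add: field_simps)
  thus "rho_walk q p1 p2 k = (p1 k + p2 k) / q k + p2 k / q k / rho_walk q p1 p2 k"
    unfolding \<rho> a_def[symmetric] b_def[symmetric] .
qed

lemma bigo_Suc_inverse_square:
  assumes "f \<in> O(\<lambda>n. 1 / real n ^ 2)"
  shows "(\<lambda>n. f (Suc n)) \<in> O(\<lambda>n. 1 / real n ^ 2)"
proof -
  have "(\<lambda>n. f (Suc n)) \<in> O(\<lambda>n. 1 / real (Suc n) ^ 2)"
    using landau_o.big.compose[OF assms filterlim_Suc] by simp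
  also have "(\<lambda>n. 1 / real (Suc n) ^ 2) \<in> O(\<lambda>n. 1 / real n ^ 2)"
  proof (rule bigoI[of _ 1])
    show "eventually (\<lambda>n. norm (1 / real (Suc n) ^ 2) \<le> 1 * norm (1 / real n ^ 2)) sequentially"
      using eventually_gt_at_top[of 0]
    proof eventually_elim
      case (elim n)
      have "1 / real (Suc n) ^ 2 \<le> 1 / real n ^ 2"
        using elim by (intro divide_left_mono power_mono) auto
      thus ?case by simp
    qed
  qed
  finally show ?thesis .
qed

lemma bigo_inverse_square_tendsto_0:
  fixes f :: "nat \<Rightarrow> real"
  assumes "f \<in> O(\<lambda>n. 1 / real n ^ 2)"
  shows "f \<longlonglongrightarrow> 0"
proof -
  have "(\<lambda>n. (1 / real n) ^ 2) \<longlonglongrightarrow> 0\<^sup>2" by (intro tendsto_power lim_1_over_n)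
  hence "(\<lambda>n. 1 / real n ^ 2) \<in> o(\<lambda>_. 1 :: real)"
    by (intro smalloI_tendsto) (auto simp: power_one_over)
  from landau_o.big_small_trans[OF assms this] show ?thesis by (auto dest: smalloD_tendsto)
qed

lemma r_seq_tendsto_0:
  assumes "0 \<le> \<beta>" "\<beta> < 1"
  shows "r_seq \<beta> \<longlonglongrightarrow> 0"
proof -
  have "(\<lambda>n. 1 / real n) \<in> o(\<lambda>_. 1 :: real)"
    by (intro smalloI_tendsto) (auto intro: lim_1_over_n)
  from landau_o.big_small_trans[OF r_seq_bigo[OF assms] this] show ?thesis
    by (auto dest: smalloD_tendsto)
qed

text \<open>The sign \<open>\<sigma>\<close> is -1 for \<open>X\<close> and 1 for \<open>Y\<close>.
  Since \<open>r_seq \<beta>\<close> is \<open>O(1/n)\<close>, the error \<open>O(r^2)\<close>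
  becomes \<open>O(1/n^2)\<close>, the order of the increments of \<open>r_seq \<beta>\<close> as
  well.\<close>

lemma perturbed_rho_asymptotics:
  fixes \<rho> :: "nat \<Rightarrow> real"
  assumes \<beta>: "0 \<le> \<beta>" "\<beta> < 1"
    and \<rho>: "(\<lambda>k. \<rho> k - (1 + \<sigma> * (3 * r_seq \<beta> k))) \<in> O(\<lambda>k. (r_seq \<beta> k)\<^sup>2)"
  shows "(\<lambda>k. \<rho> k - (1 + \<sigma> * (3 * r_seq \<beta> k))) \<in> O(\<lambda>n. 1 / real n ^ 2)"
    and "\<rho> \<longlonglongrightarrow> 1"
    and "(\<lambda>n. \<rho> (Suc n) - \<rho> n) \<in> O(\<lambda>n. 1 / real n ^ 2)"
proof -
  define e where "e k = \<rho> k - (1 + \<sigma> * (3 * r_seq \<beta> k))" for k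
  have "e \<in> O(\<lambda>k. (r_seq \<beta> k)\<^sup>2)" using \<rho> by (simp add: e_def[abs_def])
  also have "(\<lambda>k. (r_seq \<beta> k)\<^sup>2) \<in> O(\<lambda>n. (1 / real n)\<^sup>2)"
    by (intro landau_o.big_power r_seq_bigo \<beta>)
  finally have e: "e \<in> O(\<lambda>n. 1 / real n ^ 2)" by (simp add: power_divide)
  thus "(\<lambda>k. \<rho> k - (1 + \<sigma> * (3 * r_seq \<beta> k))) \<in> O(\<lambda>n. 1 / real n ^ 2)"
    by (simp add: e_def[abs_def])
  note r0 = r_seq_tendsto_0[OF \<beta>]
  have e0: "e \<longlonglongrightarrow> 0" using e by (rule bigo_inverse_square_tendsto_0)
  have "(\<lambda>k. e k + (1 + \<sigma> * (3 * r_seq \<beta> k))) \<longlonglongrightarrow> 0 + (1 + \<sigma> * (3 * 0))"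
    by (intro tendsto_intros e0 r0)
  thus "\<rho> \<longlonglongrightarrow> 1" by (simp add: e_def)
  have "(\<lambda>n. e (Suc n) - e n + (\<sigma> * 3) * (r_seq \<beta> (Suc n) - r_seq \<beta> n)) \<in> O(\<lambda>n. 1 / real n ^ 2)"
  proof (intro sum_in_bigo bigo_Suc_inverse_square e)
    show "(\<lambda>n. \<sigma> * 3 * (r_seq \<beta> (Suc n) - r_seq \<beta> n)) \<in> O(\<lambda>n. 1 / real n ^ 2)"
      using landau_o.big.mult[OF _ r_seq_diff_bigo[OF \<beta>], of "\<lambda>_. \<sigma> * 3" "\<lambda>_. 1"] by simp
  qed
  also have "(\<lambda>n. e (Suc n) - e n + (\<sigma> * 3) * (r_seq \<beta> (Suc n) - r_seq \<beta> n)) = (\<lambda>n. \<rho> (Suc n) - \<rho> n)"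
    by (auto simp: e_def algebra_simps)
  finally show "(\<lambda>n. \<rho> (Suc n) - \<rho> n) \<in> O(\<lambda>n. 1 / real n ^ 2)" .
qed

section \<open>Harmonic increments of the two walks\<close>

fun up_sol :: "(nat \<Rightarrow> real) \<Rightarrow> (nat \<Rightarrow> real) \<Rightarrow> nat \<Rightarrow> real" where
  "up_sol a b 0 = 1"
| "up_sol a b (Suc 0) = 1"
| "up_sol a b (Suc (Suc n)) = a (Suc (Suc n)) * up_sol a b (Suc n) + b (Suc (Suc n)) * up_sol a b n"

context
  fixes q p1 p2 :: "nat \<Rightarrow> real" and \<beta> \<sigma> :: real
  assumes probs: "\<And>k. k \<ge> 2 \<Longrightarrow> q k > 0 \<and> p1 k \<ge> 0 \<and> p2 k > 0 \<and> q k + p1 k + p2 k = 1"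
    and a_lim: "\<exists>a>0. (\<lambda>k. (p1 k + p2 k) / q k) \<longlonglongrightarrow> a"
    and b_lim: "\<exists>b>0. (\<lambda>k. p2 k / q k) \<longlonglongrightarrow> b"
    and \<beta>: "0 \<le> \<beta>" "\<beta> < 1"
    and \<rho>: "(\<lambda>k. rho_walk q p1 p2 k - (1 + \<sigma> * (3 * r_seq \<beta> k))) \<in> O(\<lambda>k. (r_seq \<beta> k)\<^sup>2)"
begin

private definition "aa k = (p1 k + p2 k) / q k"
private definition "bb k = p2 k / q k"
private definition "rh k = rho_walk q p1 p2 k"

text \<open>\<open>b0 \<le> a0\<close> because \<open>p1\<close> is nonnegative, and
  \<open>a0 \<le> 1\<close> because \<open>\<rho> = a + b / \<rho>\<close> exceeds \<open>a\<close>
  and tends to 1. These are the inequalities under which the continued fraction contracts.\<close>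

private lemma ab_limits:
  obtains a0 b0 where "aa \<longlonglongrightarrow> a0" "bb \<longlonglongrightarrow> b0" "0 < b0" "b0 \<le> a0" "a0 \<le> 1"
proof -
  obtain a0 where a0: "aa \<longlonglongrightarrow> a0" using a_lim by (auto simp: aa_def[abs_def])
  obtain b0 where b0: "b0 > 0" "bb \<longlonglongrightarrow> b0" using b_lim by (auto simp: bb_def[abs_def])
  have "b0 \<le> a0"
  proof (rule LIMSEQ_le[OF b0(2) a0], intro exI[of _ 2] allI impI)
    fix n :: nat assume "n \<ge> 2"
    thus "bb n \<le> aa n" using probs[of n] by (simp add: aa_def bb_def divide_right_mono)
  qed
  moreover have "a0 \<le> 1"
  proof (rule LIMSEQ_le[OF a0 perturbed_rho_asymptotics(2)[OF \<beta> \<rho>]], intro exI[of _ 2] allI impI)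
    fix n :: nat assume n: "n \<ge> 2"
    have "0 < p2 n / q n / rho_walk q p1 p2 n" using probs[OF n] rho_walk_fixed_point(1)[of q n p1 p2] by simp
    thus "aa n \<le> rho_walk q p1 p2 n"
      using rho_walk_fixed_point(2)[of q n p1 p2] probs[OF n] unfolding aa_def by linarith
  qed
  ultimately show ?thesis using that a0 b0 by blast
qed

private lemma rh_fixed: "eventually (\<lambda>n. rh n = aa n + bb n / rh n) sequentially"
  using eventually_ge_at_top[of 2]
proof eventually_elim
  case (elim n)
  show ?case unfolding rh_def aa_def bb_def
    by (rule rho_walk_fixed_point(2)) (use probs[OF elim] in auto)
qed

private lemma ab_pos:
  assumes "n \<ge> 2"
  shows "aa n > 0" "bb n > 0"
proof -
  have "q n > 0" "p1 n \<ge> 0" "p2 n > 0" using probs[OF assms] by auto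
  thus "aa n > 0" "bb n > 0" unfolding aa_def bb_def by (auto intro!: divide_pos_pos)
qed

private lemmas rh_asymp = perturbed_rho_asymptotics[OF \<beta> \<rho>, folded rh_def]

text \<open>Harmonicity at \<open>n\<close> expresses \<open>u n = h n - h (n+1)\<close> by the two
  preceding increments and is required only for \<open>n \<ge> 2\<close>. So \<open>u 0\<close> and
  \<open>u 1\<close> are free; positive seeds keep every term positive, and the contraction makes
  the ratios forget them.\<close>

lemma harmonic_increments_X:
  assumes "\<sigma> = -1"
  obtains u where "\<And>n. u n > 0"
    and "\<And>n. n \<ge> 2 \<Longrightarrow> q n * u n = (p1 n + p2 n) * u (n - 1) + p2 n * u (n - 2)"
    and "(\<lambda>n. u (Suc n) / u n - (1 - 3 * r_seq \<beta> (Suc n))) \<in> O(\<lambda>n. 1 / real n ^ 2)"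
proof -
  define u where "u = up_sol aa bb"
  have pos: "u n > 0" for n
    unfolding u_def by (induction n rule: induct_nat_012) (auto intro!: add_pos_pos mult_pos_pos ab_pos)
  have rec: "u (Suc (Suc n)) = aa (Suc (Suc n)) * u (Suc n) + bb (Suc (Suc n)) * u n" for n
    by (simp add: u_def)
  have 1: "q n * u n = (p1 n + p2 n) * u (n - 1) + p2 n * u (n - 2)" if n2: "n \<ge> 2" for n
  proof -
    obtain m where m: "n = Suc (Suc m)" using n2 by (metis add_2_eq_Suc le_Suc_ex)
    have "q n > 0" using probs[OF n2] by simp
    thus ?thesis unfolding m rec by (simp add: aa_def bb_def field_simps)
  qed
  obtain a0 b0 where l: "aa \<longlonglongrightarrow> a0" "bb \<longlonglongrightarrow> b0" "0 < b0" "b0 \<le> a0" "a0 \<le> 1"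
    by (rule ab_limits)
  \<comment> \<open>The ratio with index \<open>n + 1\<close> is governed by the coefficients with
    index \<open>n + 2\<close>, hence the shift by one of \<open>aa\<close>, \<open>bb\<close> and
    \<open>rh\<close>.\<close>
  have "(\<lambda>n. u (Suc n) / u n - rh (Suc n)) \<in> O(\<lambda>n. 1 / real n ^ 2)"
  proof (rule forward_ratio_bigo[where a = "\<lambda>n. aa (Suc n)" and b = "\<lambda>n. bb (Suc n)"])
    show "(\<lambda>n. aa (Suc n)) \<longlonglongrightarrow> a0" "(\<lambda>n. bb (Suc n)) \<longlonglongrightarrow> b0" "(\<lambda>n. rh (Suc n)) \<longlonglongrightarrow> 1"
      using l rh_asymp(2) by (simp_all add: filterlim_sequentially_Suc)
    show "eventually (\<lambda>n. u (Suc (Suc n)) / u (Suc n) = aa (Suc (Suc n)) + bb (Suc (Suc n)) / (u (Suc n) / u n)) sequentially"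
      unfolding rec using pos by (intro always_eventually allI) (simp add: field_simps less_imp_neq[symmetric])
    show "eventually (\<lambda>n. rh (Suc n) = aa (Suc n) + bb (Suc n) / rh (Suc n)) sequentially"
      using rh_fixed by (subst eventually_sequentially_Suc[of "\<lambda>n. rh n = aa n + bb n / rh n"])
    show "(\<lambda>n. rh (Suc (Suc n)) - rh (Suc n)) \<in> O(\<lambda>n. 1 / (real n)\<^sup>2)"
      using bigo_Suc_inverse_square[OF rh_asymp(3)] .
  qed (use l pos in auto)
  from sum_in_bigo(1)[OF this bigo_Suc_inverse_square[OF rh_asymp(1)]]
  have "(\<lambda>n. u (Suc n) / u n - (1 - 3 * r_seq \<beta> (Suc n))) \<in> O(\<lambda>n. 1 / real n ^ 2)"
    unfolding assms by (simp add: algebra_simps)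
  with that pos 1 show ?thesis by blast
qed

text \<open>Harmonicity now expresses \<open>u (n-1)\<close> by the two following increments. The
  natural ratio is \<open>x n = u (n-1) / u n\<close>, which follows
  \<open>\<rho> = 1 + 3 * r\<close>; the claim concerns its reciprocal, so the expansion is inverted
  at the end.\<close>

lemma harmonic_increments_Y:
  assumes "\<sigma> = 1"
  obtains u where "\<And>n. u n > 0"
    and "\<And>n. n \<ge> 2 \<Longrightarrow> q n * u (n - 1) = (p1 n + p2 n) * u n + p2 n * u (n + 1)"
    and "(\<lambda>n. u (Suc n) / u n - (1 - 3 * r_seq \<beta> (Suc n))) \<in> O(\<lambda>n. 1 / real n ^ 2)"
proof -
  have "\<exists>d. (\<forall>n. d n > 0) \<and> (\<forall>n. d n = aa (n + 2) * d (Suc n) + bb (n + 2) * d (Suc (Suc n)))"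
    by (rule positive_backward_solution) (simp_all add: ab_pos)
  then obtain d where pos: "\<And>n. d n > 0" and
    rec: "\<And>n. d n = aa (n + 2) * d (Suc n) + bb (n + 2) * d (Suc (Suc n))" by metis
  \<comment> \<open>The recursion for \<open>u\<close> starts at \<open>n = 2\<close> and involves
    the indices 1, 2, 3, whereas \<open>d\<close> starts at 0. Truncated subtraction gives
    \<open>u 0 = d 0\<close>, which is positive as required.\<close>
  define u where "u n = d (n - 1)" for n
  have 1: "q n * u (n - 1) = (p1 n + p2 n) * u n + p2 n * u (n + 1)" if n2: "n \<ge> 2" for n
  proof -
    obtain m where m: "n = Suc (Suc m)" using n2 by (metis add_2_eq_Suc le_Suc_ex)
    have "q n * d m = q n * (aa n * d (Suc m) + bb n * d (Suc (Suc m)))"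
      by (subst rec) (simp add: m)
    also have "\<dots> = (p1 n + p2 n) * d (Suc m) + p2 n * d (Suc (Suc m))"
      using probs[OF n2, THEN conjunct1] by (simp add: aa_def bb_def field_simps)
    finally show ?thesis by (simp add: u_def m)
  qed
  obtain a0 b0 where l: "aa \<longlonglongrightarrow> a0" "bb \<longlonglongrightarrow> b0" "0 < b0" "b0 \<le> a0" "a0 \<le> 1"
    by (rule ab_limits)
  define x where "x n = d (n - 2) / d (Suc (n - 2))" for n
  have xpos: "x n > 0" for n using pos by (simp add: x_def)
  have "eventually (\<lambda>n. x n = aa n + bb n / x (Suc n)) sequentially"
    using eventually_ge_at_top[of 2]
  proof eventually_elim
    case (elim n)
    then obtain m where m: "n = m + 2" by (metis add.commute le_Suc_ex)
    have "d m / d (Suc m) = aa (m + 2) + bb (m + 2) / (d (Suc m) / d (Suc (Suc m)))"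
      using pos[of "Suc m"] pos[of "Suc (Suc m)"] by (subst rec[of m]) (simp add: field_simps)
    thus ?case by (simp add: x_def m)
  qed
  from backward_ratio_bigo[OF l(1,2) rh_asymp(2) l(3-5) this xpos rh_fixed rh_asymp(3)]
  have xrh: "(\<lambda>n. x n - rh n) \<in> O(\<lambda>n. 1 / real n ^ 2)" .
  from sum_in_bigo(1)[OF this rh_asymp(1)]
  have x1: "(\<lambda>n. x n - (1 + 3 * r_seq \<beta> n)) \<in> O(\<lambda>n. 1 / real n ^ 2)"
    unfolding assms by (simp add: algebra_simps)
  have r2: "(\<lambda>k. (r_seq \<beta> k)\<^sup>2) \<in> O(\<lambda>n. 1 / real n ^ 2)"
    using landau_o.big_power[OF r_seq_bigo[OF \<beta>], of 2] by (simp add: power_divide)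
  have "(\<lambda>n. x n - rh n) \<longlonglongrightarrow> 0" using xrh by (rule bigo_inverse_square_tendsto_0)
  from tendsto_add[OF this rh_asymp(2)] have xlim: "x \<longlonglongrightarrow> 1" by simp
  have xinv: "(\<lambda>n. 1 / x n) \<in> O(\<lambda>_. 1)"
    by (intro bigoI_tendsto[of _ _ 1]) (auto intro!: tendsto_eq_intros xlim)
  have r1: "(\<lambda>n. 1 - 3 * r_seq \<beta> n) \<in> O(\<lambda>_. 1)"
    by (intro bigoI_tendsto[of _ _ 1]) (auto intro!: tendsto_eq_intros r_seq_tendsto_0[OF \<beta>])
  \<comment> \<open>From \<open>(1 - 3 * r) * (1 + 3 * r) = 1 - 9 * r^2\<close>: writing
    \<open>x = (1 + 3 * r) + error\<close> in \<open>1 - (1 - 3 * r) * x\<close> leaves the bracket,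
    in which both terms are \<open>O(1/n^2)\<close>.\<close>
  have "(\<lambda>n. 1 / x n * (9 * (r_seq \<beta> n)\<^sup>2 - (1 - 3 * r_seq \<beta> n) * (x n - (1 + 3 * r_seq \<beta> n)))) \<in> O(\<lambda>n. 1 * (1 / real n ^ 2))"
  proof (intro landau_o.big.mult[OF xinv] sum_in_bigo)
    show "(\<lambda>n. 9 * (r_seq \<beta> n)\<^sup>2) \<in> O(\<lambda>n. 1 / real n ^ 2)" using r2 by simp
    show "(\<lambda>n. (1 - 3 * r_seq \<beta> n) * (x n - (1 + 3 * r_seq \<beta> n))) \<in> O(\<lambda>n. 1 / real n ^ 2)"
      using landau_o.big.mult[OF r1 x1] by simp
  qed
  also have "(\<lambda>n. 1 / x n * (9 * (r_seq \<beta> n)\<^sup>2 - (1 - 3 * r_seq \<beta> n) * (x n - (1 + 3 * r_seq \<beta> n))))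
      = (\<lambda>n. 1 / x n - (1 - 3 * r_seq \<beta> n))"
  proof
    fix n
    show "1 / x n * (9 * (r_seq \<beta> n)\<^sup>2 - (1 - 3 * r_seq \<beta> n) * (x n - (1 + 3 * r_seq \<beta> n))) = 1 / x n - (1 - 3 * r_seq \<beta> n)"
      using xpos[of n] by (simp add: field_simps power2_eq_square)
  qed
  finally have "(\<lambda>n. 1 / x n - (1 - 3 * r_seq \<beta> n)) \<in> O(\<lambda>n. 1 / real n ^ 2)" by simp
  from bigo_Suc_inverse_square[OF this]
  have *: "(\<lambda>n. 1 / x (Suc n) - (1 - 3 * r_seq \<beta> (Suc n))) \<in> O(\<lambda>n. 1 / real n ^ 2)" .
  have "eventually (\<lambda>n. 1 / x (Suc n) - (1 - 3 * r_seq \<beta> (Suc n)) = u (Suc n) / u n - (1 - 3 * r_seq \<beta> (Suc n))) sequentially"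
    using eventually_gt_at_top[of 0]
  proof eventually_elim
    case (elim n)
    then obtain m where "n = Suc m" by (cases n) auto
    thus ?case by (simp add: x_def u_def)
  qed
  from landau_o.big.in_cong[OF this] *
  have "(\<lambda>n. u (Suc n) / u n - (1 - 3 * r_seq \<beta> (Suc n))) \<in> O(\<lambda>n. 1 / real n ^ 2)" by simp
  moreover have "\<And>n. u n > 0" by (simp add: u_def pos)
  ultimately show ?thesis using that 1 by blast
qed

end

section \<open>Markov chains on the natural numbers\<close>

text \<open>Plays the part of the natural filtration for events written as predicates on paths.
  Dependence on finitely many integer coordinates makes such events measurable without further
  conditions.\<close>

definition adapted :: "nat \<Rightarrow> ((nat \<Rightarrow> nat) \<Rightarrow> bool) \<Rightarrow> bool" where
  "adapted n \<Phi> \<longleftrightarrow> (\<forall>f g. (\<forall>i\<le>n. f i = g i) \<longrightarrow> \<Phi> f = \<Phi> g)"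

text \<open>The common frame of both walks. Upward jumps of at most 2 make one-step averages and the
  laws of \<open>Z n\<close> finite sums.\<close>

locale nat_chain = prob_space M for M :: "'a measure" +
  fixes Z :: "nat \<Rightarrow> 'a \<Rightarrow> nat" and x0 :: nat and P :: "nat \<Rightarrow> nat \<Rightarrow> real"
  assumes Z_meas [measurable]: "\<And>n. Z n \<in> M \<rightarrow>\<^sub>M count_space UNIV"
    and cylinder: "\<And>n x. prob {\<omega> \<in> space M. \<forall>i\<le>n. Z i \<omega> = x i} =
        (if x 0 = x0 then 1 else 0) * (\<Prod>i<n. P (x i) (x (i + 1)))"
    and P_nonneg: "\<And>x y. P x y \<ge> 0"
    and P_sum: "\<And>x. (\<Sum>y\<le>x+2. P x y) = 1"
    and P_zero: "\<And>x y. y > x + 2 \<Longrightarrow> P x y = 0"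
begin

definition ev :: "((nat \<Rightarrow> nat) \<Rightarrow> bool) \<Rightarrow> 'a set" where
  "ev \<Phi> = {\<omega> \<in> space M. \<Phi> (\<lambda>i. Z i \<omega>)}"

definition PP :: "(nat \<Rightarrow> real) \<Rightarrow> nat \<Rightarrow> real" where
  "PP f x = (\<Sum>y\<le>x+2. P x y * f y)"

text \<open>The expectation of \<open>f (Z n)\<close> on the event \<open>\<Phi>\<close>; the sum is finite because
  \<open>Z n \<le> x0 + 2 * n\<close> almost surely.\<close>

definition Ex :: "(nat \<Rightarrow> real) \<Rightarrow> nat \<Rightarrow> ((nat \<Rightarrow> nat) \<Rightarrow> bool) \<Rightarrow> real" where
  "Ex f n \<Phi> = (\<Sum>x\<le>x0+2*n. f x * prob (ev (\<lambda>p. \<Phi> p \<and> p n = x)))"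

text \<open>There are only countably many histories of length \<open>n + 1\<close>. The values of
  \<open>nth xs\<close> beyond the list are unspecified, but an adapted predicate does not see
  them.\<close>

lemma adapted_union:
  assumes "adapted n \<Phi>"
  shows "ev \<Phi> = (\<Union>xs\<in>{xs. length xs = Suc n \<and> \<Phi> (nth xs)}. {\<omega> \<in> space M. \<forall>i\<le>n. Z i \<omega> = xs ! i})"
proof safe
  fix \<omega> assume \<omega>: "\<omega> \<in> ev \<Phi>"
  define xs where "xs = map (\<lambda>i. Z i \<omega>) [0..<Suc n]"
  have xs: "length xs = Suc n" "\<forall>i\<le>n. Z i \<omega> = xs ! i"
    by (auto simp: xs_def simp del: upt_Suc)
  hence "\<Phi> (nth xs)" using assms \<omega> unfolding adapted_def ev_def
    by (metis (no_types, lifting) mem_Collect_eq)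
  with xs \<omega> show "\<omega> \<in> (\<Union>xs\<in>{xs. length xs = Suc n \<and> \<Phi> (nth xs)}. {\<omega> \<in> space M. \<forall>i\<le>n. Z i \<omega> = xs ! i})"
    by (auto simp: ev_def)
next
  fix \<omega> xs assume "\<Phi> (nth xs)" "\<omega> \<in> space M" "\<forall>i\<le>n. Z i \<omega> = xs ! i"
  moreover from this have "\<Phi> (\<lambda>i. Z i \<omega>) = \<Phi> (nth xs)"
    using assms[unfolded adapted_def, rule_format, of "\<lambda>i. Z i \<omega>" "nth xs"] by simp
  ultimately show "\<omega> \<in> ev \<Phi>" by (simp add: ev_def)
qed

lemma ev_adapted_sets:
  assumes "adapted n \<Phi>"
  shows "ev \<Phi> \<in> events"
  unfolding adapted_union[OF assms] by (rule sets.countable_UN') auto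

lemma ev_conj_coord: "ev \<Phi> \<in> events \<Longrightarrow> ev (\<lambda>p. \<Phi> p \<and> Q (p n)) \<in> events"
proof -
  assume [measurable]: "ev \<Phi> \<in> events"
  have "ev (\<lambda>p. \<Phi> p \<and> Q (p n)) = ev \<Phi> \<inter> {\<omega> \<in> space M. Q (Z n \<omega>)}" by (auto simp: ev_def)
  also have "\<dots> \<in> events" by measurable
  finally show ?thesis .
qed

text \<open>The event splits into countably many cylinders ending in \<open>x\<close>. Extending
  each of them by \<open>y\<close> multiplies its probability by \<open>P x y\<close>, and countable
  additivity sums the pieces.\<close>

lemma markov_property:
  assumes "adapted n \<Phi>"
  shows "prob (ev (\<lambda>p. \<Phi> p \<and> p n = x \<and> p (Suc n) = y)) = prob (ev (\<lambda>p. \<Phi> p \<and> p n = x)) * P x y"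
proof -
  define I where "I = {xs. length xs = Suc n \<and> \<Phi> (nth xs) \<and> xs ! n = x}"
  define C where "C xs = {\<omega> \<in> space M. \<forall>i\<le>n. Z i \<omega> = xs ! i}" for xs :: "nat list"
  have C_sets [measurable]: "C xs \<in> events" for xs unfolding C_def by measurable
  have I: "countable I" by (auto intro: countable_subset[OF subset_UNIV])
  have disj: "disjoint_family_on C I"
    unfolding disjoint_family_on_def
  proof safe
    fix xs ys \<omega> assume "xs \<in> I" "ys \<in> I" "xs \<noteq> ys" "\<omega> \<in> C xs" "\<omega> \<in> C ys"
    hence "xs = ys" by (intro nth_equalityI) (auto simp: C_def I_def)
    with \<open>xs \<noteq> ys\<close> show "\<omega> \<in> {}" by simp
  qed
  have ad: "adapted n (\<lambda>p. \<Phi> p \<and> p n = x)" using assms by (auto simp: adapted_def)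
  have U: "ev (\<lambda>p. \<Phi> p \<and> p n = x) = (\<Union>xs\<in>I. C xs)"
    using adapted_union[OF ad] unfolding I_def C_def by simp
  have U': "ev (\<lambda>p. \<Phi> p \<and> p n = x \<and> p (Suc n) = y) = (\<Union>xs\<in>I. C xs \<inter> {\<omega> \<in> space M. Z (Suc n) \<omega> = y})"
  proof -
    have "ev (\<lambda>p. \<Phi> p \<and> p n = x \<and> p (Suc n) = y) = ev (\<lambda>p. \<Phi> p \<and> p n = x) \<inter> {\<omega> \<in> space M. Z (Suc n) \<omega> = y}"
      by (auto simp: ev_def)
    thus ?thesis unfolding U by blast
  qed
  have step: "prob (C xs \<inter> {\<omega> \<in> space M. Z (Suc n) \<omega> = y}) = prob (C xs) * P x y" if "xs \<in> I" for xs
  proof -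
    define z where "z i = (if i \<le> n then xs ! i else y)" for i
    have "C xs \<inter> {\<omega> \<in> space M. Z (Suc n) \<omega> = y} = {\<omega> \<in> space M. \<forall>i\<le>Suc n. Z i \<omega> = z i}"
      by (auto simp: C_def z_def le_Suc_eq)
    moreover have "C xs = {\<omega> \<in> space M. \<forall>i\<le>n. Z i \<omega> = z i}"
      by (auto simp: C_def z_def)
    moreover have "z n = x" "z (Suc n) = y" using that by (auto simp: z_def I_def)
    ultimately show ?thesis by (simp add: cylinder)
  qed
  have "emeasure M (ev (\<lambda>p. \<Phi> p \<and> p n = x \<and> p (Suc n) = y))
      = (\<integral>\<^sup>+xs. emeasure M (C xs \<inter> {\<omega> \<in> space M. Z (Suc n) \<omega> = y}) \<partial>count_space I)"
    unfolding U' using disj I by (intro emeasure_UN_countable) (auto simp: disjoint_family_on_def)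
  also have "\<dots> = (\<integral>\<^sup>+xs. emeasure M (C xs) * ennreal (P x y) \<partial>count_space I)"
    by (intro nn_integral_cong) (simp add: emeasure_eq_measure step ennreal_mult' P_nonneg)
  also have "\<dots> = (\<integral>\<^sup>+xs. emeasure M (C xs) \<partial>count_space I) * ennreal (P x y)"
    by (rule nn_integral_multc) simp
  also have "(\<integral>\<^sup>+xs. emeasure M (C xs) \<partial>count_space I) = emeasure M (ev (\<lambda>p. \<Phi> p \<and> p n = x))"
    unfolding U using disj I by (intro emeasure_UN_countable[symmetric]) auto
  finally show ?thesis
    by (simp add: emeasure_eq_measure P_nonneg flip: ennreal_mult')
qed

lemma markov_step:
  assumes "adapted n \<Phi>" and x: "\<And>p. \<Phi> p \<Longrightarrow> p n = x"
  shows "prob (ev (\<lambda>p. \<Phi> p \<and> p (Suc n) = y)) = prob (ev \<Phi>) * P x y"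
proof -
  have "(\<lambda>p. \<Phi> p \<and> p n = x \<and> p (Suc n) = y) = (\<lambda>p. \<Phi> p \<and> p (Suc n) = y)"
    "(\<lambda>p. \<Phi> p \<and> p n = x) = \<Phi>" using x by blast+
  thus ?thesis using markov_property[OF assms(1), of x y] by simp
qed

lemma AE_start: "AE \<omega> in M. Z 0 \<omega> = x0"
proof -
  have "prob {\<omega> \<in> space M. Z 0 \<omega> = x0} = 1"
    using cylinder[of 0 "\<lambda>_. x0"] by simp
  from prob_eq_1[THEN iffD1, OF _ this] show ?thesis by simp
qed

text \<open>Each forbidden pair at each time is a null event, and there are countably many. This
  turns zeros of the kernel into step bounds for almost every path, as the pathwise descriptions of
  cutpoints require.\<close>

lemma AE_steps: "AE \<omega> in M. \<forall>i. P (Z i \<omega>) (Z (Suc i) \<omega>) \<noteq> 0"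
proof -
  have "AE \<omega> in M. \<forall>xy. P (fst xy) (snd xy) = 0 \<longrightarrow> \<not> (Z i \<omega> = fst xy \<and> Z (Suc i) \<omega> = snd xy)" for i
    unfolding AE_all_countable
  proof
    fix xy :: "nat \<times> nat"
    obtain x y where xy: "xy = (x, y)" by (cases xy)
    show "AE \<omega> in M. P (fst xy) (snd xy) = 0 \<longrightarrow> \<not> (Z i \<omega> = fst xy \<and> Z (Suc i) \<omega> = snd xy)"
    proof (cases "P x y = 0")
      case True
      have "prob (ev (\<lambda>p. True \<and> p i = x \<and> p (Suc i) = y)) = 0"
        by (subst markov_property) (auto simp: adapted_def True)
      hence "prob {\<omega> \<in> space M. Z i \<omega> = x \<and> Z (Suc i) \<omega> = y} = 0"
        by (simp add: ev_def)
      hence "AE \<omega> in M. \<not> (Z i \<omega> = x \<and> Z (Suc i) \<omega> = y)"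
        by (subst (asm) prob_eq_0) auto
      thus ?thesis by (simp add: xy)
    qed (simp add: xy)
  qed
  hence "AE \<omega> in M. \<forall>i. \<forall>xy. P (fst xy) (snd xy) = 0 \<longrightarrow> \<not> (Z i \<omega> = fst xy \<and> Z (Suc i) \<omega> = snd xy)"
    by (rule AE_all_countable[THEN iffD2, OF allI])
  thus ?thesis by (rule AE_mp) (auto intro!: AE_I2)
qed

lemma AE_bound: "AE \<omega> in M. \<forall>n. Z n \<omega> \<le> x0 + 2 * n"
  using AE_start AE_steps
proof eventually_elim
  case (elim \<omega>)
  show ?case
  proof
    fix n show "Z n \<omega> \<le> x0 + 2 * n"
    proof (induction n)
      case (Suc n)
      have "Z (Suc n) \<omega> \<le> Z n \<omega> + 2" using elim(2) P_zero by (meson not_le)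
      with Suc show ?case by simp
    qed (use elim in simp)
  qed
qed

lemma prob_sum_coord:
  assumes [measurable]: "ev \<Phi> \<in> events"
  shows "prob (ev \<Phi>) = (\<Sum>x\<le>x0+2*n. prob (ev (\<lambda>p. \<Phi> p \<and> p n = x)))"
proof -
  have m: "ev (\<lambda>p. \<Phi> p \<and> p n = x) \<in> events" for x
    using ev_conj_coord[OF assms, of "\<lambda>y. y = x" n] .
  have "(\<Sum>x\<le>x0+2*n. prob (ev (\<lambda>p. \<Phi> p \<and> p n = x))) = prob (\<Union>x\<in>{..x0+2*n}. ev (\<lambda>p. \<Phi> p \<and> p n = x))"
    using m by (intro finite_measure_finite_Union[symmetric]) (auto simp: disjoint_family_on_def ev_def)
  also have "\<dots> = prob (ev \<Phi>)"
  proof (rule finite_measure_eq_AE)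
    show "AE \<omega> in M. (\<omega> \<in> (\<Union>x\<in>{..x0+2*n}. ev (\<lambda>p. \<Phi> p \<and> p n = x))) = (\<omega> \<in> ev \<Phi>)"
      using AE_bound by eventually_elim (auto simp: ev_def)
  qed (use m in auto)
  finally show ?thesis by simp
qed

section \<open>Calculus of restricted expectations\<close>

lemma Ex_const: "ev \<Phi> \<in> events \<Longrightarrow> Ex (\<lambda>_. c) n \<Phi> = c * prob (ev \<Phi>)"
  by (simp add: Ex_def prob_sum_coord[of \<Phi> n] sum_distrib_left)

lemma Ex_mono:
  assumes "\<And>p. \<Phi> p \<Longrightarrow> f (p n) \<le> g (p n)"
  shows "Ex f n \<Phi> \<le> Ex g n \<Phi>"
  unfolding Ex_def
proof (rule sum_mono)
  fix x
  show "f x * prob (ev (\<lambda>p. \<Phi> p \<and> p n = x)) \<le> g x * prob (ev (\<lambda>p. \<Phi> p \<and> p n = x))"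
  proof (cases "\<exists>p. \<Phi> p \<and> p n = x")
    case True
    thus ?thesis using assms by (auto intro!: mult_right_mono)
  next
    case False
    hence "ev (\<lambda>p. \<Phi> p \<and> p n = x) = {}" by (auto simp: ev_def)
    thus ?thesis by simp
  qed
qed

lemma Ex_cong: "(\<And>p. \<Phi> p \<Longrightarrow> f (p n) = g (p n)) \<Longrightarrow> Ex f n \<Phi> = Ex g n \<Phi>"
  by (intro antisym Ex_mono) auto

lemma Ex_add: "Ex (\<lambda>x. f x + g x) n \<Phi> = Ex f n \<Phi> + Ex g n \<Phi>"
  by (simp add: Ex_def sum.distrib ring_distribs)

lemma Ex_cmult: "Ex (\<lambda>x. c * f x) n \<Phi> = c * Ex f n \<Phi>"
  by (simp add: Ex_def sum_distrib_left mult.assoc)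

lemma Ex_if: "Ex (\<lambda>x. if Q x then f x else 0) n \<Phi> = Ex f n (\<lambda>p. \<Phi> p \<and> Q (p n))"
  unfolding Ex_def
proof (rule sum.cong)
  fix x
  show "(if Q x then f x else 0) * prob (ev (\<lambda>p. \<Phi> p \<and> p n = x)) = f x * prob (ev (\<lambda>p. (\<Phi> p \<and> Q (p n)) \<and> p n = x))"
  proof (cases "Q x")
    case True
    hence "(\<lambda>p. (\<Phi> p \<and> Q (p n)) \<and> p n = x) = (\<lambda>p. \<Phi> p \<and> p n = x)" by auto
    thus ?thesis using True by simp
  next
    case False
    hence "(\<lambda>p. (\<Phi> p \<and> Q (p n)) \<and> p n = x) = (\<lambda>p. False)" by auto
    thus ?thesis using False by (simp add: ev_def)
  qed
qed simp

lemma Ex_split: "Ex f n \<Phi> = Ex f n (\<lambda>p. \<Phi> p \<and> Q (p n)) + Ex f n (\<lambda>p. \<Phi> p \<and> \<not> Q (p n))"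
proof -
  have "Ex f n \<Phi> = Ex (\<lambda>x. (if Q x then f x else 0) + (if \<not> Q x then f x else 0)) n \<Phi>"
    by (rule Ex_cong) simp
  thus ?thesis by (simp only: Ex_add Ex_if)
qed

lemma Ex_subset:
  assumes "\<And>x. f x \<ge> 0" "\<And>p. \<Phi> p \<Longrightarrow> \<Psi> p" "ev \<Psi> \<in> events"
  shows "Ex f n \<Phi> \<le> Ex f n \<Psi>"
  unfolding Ex_def
proof (intro sum_mono mult_left_mono finite_measure_mono assms(1))
  fix x show "ev (\<lambda>p. \<Psi> p \<and> p n = x) \<in> events"
    using ev_conj_coord[OF assms(3), of "\<lambda>y. y = x" n] .
qed (use assms(2) in \<open>auto simp: ev_def\<close>)

lemma Ex_markov:
  assumes "adapted n \<Phi>"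
  shows "Ex f (Suc n) \<Phi> = Ex (PP f) n \<Phi>"
proof -
  have y: "prob (ev (\<lambda>p. \<Phi> p \<and> p (Suc n) = y)) = (\<Sum>x\<le>x0+2*n. prob (ev (\<lambda>p. \<Phi> p \<and> p n = x)) * P x y)" for y
  proof -
    have "prob (ev (\<lambda>p. \<Phi> p \<and> p (Suc n) = y))
        = (\<Sum>x\<le>x0+2*n. prob (ev (\<lambda>p. (\<Phi> p \<and> p (Suc n) = y) \<and> p n = x)))"
      using ev_conj_coord[OF ev_adapted_sets[OF assms], of "\<lambda>z. z = y" "Suc n"] by (rule prob_sum_coord)
    also have "\<dots> = (\<Sum>x\<le>x0+2*n. prob (ev (\<lambda>p. \<Phi> p \<and> p n = x)) * P x y)"
      by (simp add: markov_property[OF assms, symmetric] conj_ac)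
    finally show ?thesis .
  qed
  have "Ex f (Suc n) \<Phi> = (\<Sum>y\<le>x0+2*Suc n. \<Sum>x\<le>x0+2*n. prob (ev (\<lambda>p. \<Phi> p \<and> p n = x)) * (P x y * f y))"
    unfolding Ex_def y by (simp add: sum_distrib_left mult_ac)
  also have "\<dots> = (\<Sum>x\<le>x0+2*n. prob (ev (\<lambda>p. \<Phi> p \<and> p n = x)) * (\<Sum>y\<le>x0+2*Suc n. P x y * f y))"
    by (subst sum.swap) (simp only: sum_distrib_left)
  also have "\<dots> = (\<Sum>x\<le>x0+2*n. prob (ev (\<lambda>p. \<Phi> p \<and> p n = x)) * PP f x)"
  proof (intro sum.cong refl)
    fix x assume "x \<in> {..x0+2*n}"
    hence "(\<Sum>y\<le>x0+2*Suc n. P x y * f y) = PP f x"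
      unfolding PP_def by (intro sum.mono_neutral_right) (auto simp: P_zero)
    thus "prob (ev (\<lambda>p. \<Phi> p \<and> p n = x)) * (\<Sum>y\<le>x0+2*Suc n. P x y * f y) = prob (ev (\<lambda>p. \<Phi> p \<and> p n = x)) * PP f x"
      by simp
  qed
  also have "\<dots> = Ex (PP f) n \<Phi>" by (simp add: Ex_def mult.commute)
  finally show ?thesis .
qed

section \<open>Transience and escape\<close>

lemma ev_True [simp]: "ev (\<lambda>p. True) = space M"
  by (simp add: ev_def)

text \<open>Strict Jensen inequality made explicit: with \<open>s = sqrt (h x)\<close>, averaging
  \<open>2 * s * sqrt (h y) = h y + h x - (sqrt (h y) - s)^2\<close> over the step loses a positive
  amount as soon as one reachable \<open>y\<close> has \<open>h y \<noteq> h x\<close>.\<close>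

lemma PP_sqrt_less:
  assumes h: "\<And>x. h x > 0" "PP h x \<le> h x" and y: "P x y > 0" "h y \<noteq> h x"
  shows "PP (\<lambda>x. sqrt (h x)) x < sqrt (h x)"
proof -
  define s where "s = sqrt (h x)"
  have s: "s > 0" "s * s = h x" using h(1)[of x] by (auto simp: s_def)
  have yx: "y \<le> x + 2" using y(1) P_zero[of x y] by (cases "y > x + 2") auto
  have "2 * s * PP (\<lambda>x. sqrt (h x)) x = (\<Sum>y\<le>x+2. P x y * (h y + h x - (sqrt (h y) - s)\<^sup>2))"
  proof -
    have "2 * s * sqrt (h y) = h y + h x - (sqrt (h y) - s)\<^sup>2" for y
      using s(2) h(1)[of y] by (simp add: power2_eq_square algebra_simps)
    thus ?thesis unfolding PP_def sum_distrib_left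
      by (intro sum.cong) (auto simp: mult.left_commute)
  qed
  also have "\<dots> = PP h x + h x * (\<Sum>y\<le>x+2. P x y) - (\<Sum>y\<le>x+2. P x y * (sqrt (h y) - s)\<^sup>2)"
    by (simp add: PP_def sum.distrib sum_subtractf sum_distrib_left algebra_simps)
  also have "\<dots> < PP h x + h x * (\<Sum>y\<le>x+2. P x y)"
  proof -
    have "sqrt (h y) \<noteq> s" using y(2) by (simp add: s_def)
    hence "0 < P x y * (sqrt (h y) - s)\<^sup>2" using y by simp
    also have "\<dots> \<le> (\<Sum>y\<le>x+2. P x y * (sqrt (h y) - s)\<^sup>2)"
      using yx by (intro member_le_sum) (auto simp: P_nonneg)
    finally show ?thesis by simp
  qed
  also have "\<dots> \<le> 2 * s * s" using h(2) s P_sum[of x] by simp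
  finally have "PP (\<lambda>x. sqrt (h x)) x < s" using s(1) by (subst (asm) mult_less_cancel_left_pos) auto
  thus ?thesis by (simp add: s_def)
qed

text \<open>On the finite set \<open>{..K}\<close> the drift of \<open>\<phi>\<close> is at least
  some \<open>\<delta> > 0\<close>. The expectation of \<open>\<phi> (Z n)\<close> loses
  \<open>\<delta>\<close> times the probability of being there at each step and stays nonnegative,
  so the expected time in \<open>{..K}\<close> is at most its initial value over
  \<open>\<delta>\<close>.\<close>

lemma transient_summable:
  assumes \<phi>: "\<And>x. \<phi> x \<ge> 0" "\<And>x. PP \<phi> x < \<phi> x"
  shows "summable (\<lambda>n. prob {\<omega> \<in> space M. Z n \<omega> \<le> K})"
proof -
  define \<delta> where "\<delta> = Min ((\<lambda>x. \<phi> x - PP \<phi> x) ` {..K})"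
  have \<delta>: "\<delta> > 0" unfolding \<delta>_def using \<phi>(2) by (subst Min_gr_iff) auto
  have \<delta>': "\<delta> \<le> \<phi> x - PP \<phi> x" if "x \<le> K" for x unfolding \<delta>_def using that by (intro Min_le) auto
  have ad: "adapted n (\<lambda>_. True)" for n by (simp add: adapted_def)
  have K: "{\<omega> \<in> space M. Z n \<omega> \<le> K} = ev (\<lambda>p. True \<and> p n \<le> K)" for n by (simp add: ev_def)
  have step: "Ex \<phi> (Suc n) (\<lambda>_. True) + \<delta> * prob {\<omega> \<in> space M. Z n \<omega> \<le> K} \<le> Ex \<phi> n (\<lambda>_. True)" for n
  proof -
    have "\<delta> * prob {\<omega> \<in> space M. Z n \<omega> \<le> K} = Ex (\<lambda>_. \<delta>) n (\<lambda>p. True \<and> p n \<le> K)"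
      unfolding K by (rule Ex_const[symmetric], rule ev_conj_coord) simp
    also have "\<dots> = Ex (\<lambda>x. if x \<le> K then \<delta> else 0) n (\<lambda>_. True)" by (simp add: Ex_if)
    finally have "Ex \<phi> (Suc n) (\<lambda>_. True) + \<delta> * prob {\<omega> \<in> space M. Z n \<omega> \<le> K}
        = Ex (\<lambda>x. PP \<phi> x + (if x \<le> K then \<delta> else 0)) n (\<lambda>_. True)"
      by (simp add: Ex_add Ex_markov[OF ad])
    also have "\<dots> \<le> Ex \<phi> n (\<lambda>_. True)"
    proof (rule Ex_mono)
      fix p :: "nat \<Rightarrow> nat"
      show "PP \<phi> (p n) + (if p n \<le> K then \<delta> else 0) \<le> \<phi> (p n)"
        using \<delta>'[of "p n"] \<phi>(2)[of "p n"] by auto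
    qed
    finally show ?thesis .
  qed
  have bound: "Ex \<phi> N (\<lambda>_. True) + \<delta> * (\<Sum>n<N. prob {\<omega> \<in> space M. Z n \<omega> \<le> K}) \<le> Ex \<phi> 0 (\<lambda>_. True)" for N
  proof (induction N)
    case (Suc N)
    thus ?case using step[of N] by (simp add: ring_distribs)
  qed simp
  have nn: "Ex \<phi> N (\<lambda>_. True) \<ge> 0" for N
    unfolding Ex_def by (intro sum_nonneg mult_nonneg_nonneg \<phi>(1)) simp
  show ?thesis
  proof (rule summableI_nonneg_bounded)
    fix N
    have "\<delta> * (\<Sum>n<N. prob {\<omega> \<in> space M. Z n \<omega> \<le> K}) \<le> Ex \<phi> 0 (\<lambda>_. True)"
      using bound[of N] nn[of N] by linarith
    thus "(\<Sum>n<N. prob {\<omega> \<in> space M. Z n \<omega> \<le> K}) \<le> Ex \<phi> 0 (\<lambda>_. True) / \<delta>"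
      using \<delta> by (simp add: field_simps)
  qed simp
qed

lemma AE_transient:
  assumes "\<And>K. summable (\<lambda>n. prob {\<omega> \<in> space M. Z n \<omega> \<le> K})"
  shows "AE \<omega> in M. filterlim (\<lambda>n. Z n \<omega>) at_top sequentially"
proof -
  have "AE \<omega> in M. eventually (\<lambda>n. \<omega> \<in> space M - {\<omega> \<in> space M. Z n \<omega> \<le> K}) sequentially" for K
    by (rule borel_cantelli_AE1) (auto simp: emeasure_eq_measure assms)
  hence "AE \<omega> in M. \<forall>K. eventually (\<lambda>n. \<omega> \<in> space M - {\<omega> \<in> space M. Z n \<omega> \<le> K}) sequentially"
    by (rule AE_all_countable[THEN iffD2, OF allI])
  thus ?thesis
  proof eventually_elim
    case (elim \<omega>)
    show ?case unfolding filterlim_at_top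
    proof
      fix K
      show "eventually (\<lambda>n. K \<le> Z n \<omega>) sequentially"
        using elim[rule_format, of K] by eventually_elim auto
    qed
  qed
qed

text \<open>\<open>h\<close> is small beyond some \<open>K\<close> and bounded below it, and the
  chain is in \<open>{..K}\<close> with vanishing probability.\<close>

lemma Ex_tendsto_0:
  assumes sm: "\<And>K. summable (\<lambda>n. prob {\<omega> \<in> space M. Z n \<omega> \<le> K})"
    and h: "\<And>x. h x \<ge> 0" "h \<longlonglongrightarrow> 0"
  shows "(\<lambda>n. Ex h n (\<lambda>_. True)) \<longlonglongrightarrow> 0"
proof (rule LIMSEQ_I)
  fix e :: real assume e: "e > 0"
  obtain H where H: "\<And>x. h x \<le> H" "H > 0"
  proof -
    have "Bseq h" using h(2) by (intro convergent_imp_Bseq convergentI)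
    then obtain H where "H > 0" "\<And>x. norm (h x) \<le> H" by (auto elim: BseqE)
    thus ?thesis using that[of H] h(1) by auto
  qed
  obtain K where K: "\<And>x. x \<ge> K \<Longrightarrow> h x < e / 2"
    using order_tendstoD(2)[OF h(2), of "e / 2"] e unfolding eventually_sequentially by auto
  have "(\<lambda>n. H * prob {\<omega> \<in> space M. Z n \<omega> \<le> K}) \<longlonglongrightarrow> H * 0"
    by (intro tendsto_intros summable_LIMSEQ_zero sm)
  hence "eventually (\<lambda>n. H * prob {\<omega> \<in> space M. Z n \<omega> \<le> K} < e / 2) sequentially"
    using e by (intro order_tendstoD(2)[of _ 0]) auto
  then obtain N where N: "\<And>n. n \<ge> N \<Longrightarrow> H * prob {\<omega> \<in> space M. Z n \<omega> \<le> K} < e / 2"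
    unfolding eventually_sequentially by auto
  show "\<exists>N. \<forall>n\<ge>N. norm (Ex h n (\<lambda>_. True) - 0) < e"
  proof (intro exI[of _ N] allI impI)
    fix n assume n: "n \<ge> N"
    have "Ex h n (\<lambda>_. True) \<le> Ex (\<lambda>x. e / 2 + (if x \<le> K then H else 0)) n (\<lambda>_. True)"
    proof (rule Ex_mono)
      fix p :: "nat \<Rightarrow> nat"
      show "h (p n) \<le> e / 2 + (if p n \<le> K then H else 0)"
        using H(1)[of "p n"] K[of "p n"] e by auto
    qed
    also have "\<dots> = e / 2 + H * prob (ev (\<lambda>p. True \<and> p n \<le> K))"
    proof -
      have "ev (\<lambda>p. True \<and> p n \<le> K) \<in> events" by (rule ev_conj_coord) simp
      thus ?thesis unfolding Ex_add Ex_if by (simp add: Ex_const prob_space)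
    qed
    also have "\<dots> < e" using N[OF n] by (simp add: ev_def)
    finally have "Ex h n (\<lambda>_. True) < e" .
    moreover have "Ex h n (\<lambda>_. True) \<ge> 0"
      unfolding Ex_def by (intro sum_nonneg mult_nonneg_nonneg h(1)) simp
    ultimately show "norm (Ex h n (\<lambda>_. True) - 0) < e" by simp
  qed
qed

text \<open>Optional stopping at the first return to \<open>{..k}\<close> after time
  \<open>n\<close>. Downward jumps are at most 2, so the return lands on \<open>k\<close> or
  \<open>k - 1\<close>, where \<open>h\<close> lies between \<open>h k\<close> and
  \<open>h (k - 1)\<close>. As no part of \<open>h\<close> survives at infinity,
  \<open>h (k + 1) * prob (ev \<Phi>)\<close> lies between these two values times the probability of
  returning.\<close>

lemma escape_bounds:
  assumes ad: "adapted n \<Phi>" and \<Phi>: "\<And>p. \<Phi> p \<Longrightarrow> p n = k + 1"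
    and h: "\<And>x. h x \<ge> 0" "h k \<le> h (k - 1)"
    and harmonic: "\<And>x. x > k \<Longrightarrow> PP h x = h x"
    and jump: "\<And>x y. x > k \<Longrightarrow> P x y \<noteq> 0 \<Longrightarrow> k - 1 \<le> y"
    and lim: "(\<lambda>j. Ex h j (\<lambda>_. True)) \<longlonglongrightarrow> 0"
  shows "ev (\<lambda>p. \<Phi> p \<and> (\<forall>j\<ge>n. p j > k)) \<in> events"
    and "(h k - h (k + 1)) * prob (ev \<Phi>) \<le> h k * prob (ev (\<lambda>p. \<Phi> p \<and> (\<forall>j\<ge>n. p j > k)))"
    and "h (k - 1) * prob (ev (\<lambda>p. \<Phi> p \<and> (\<forall>j\<ge>n. p j > k))) \<le> (h (k - 1) - h (k + 1)) * prob (ev \<Phi>)"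
proof -
  define \<Psi> where "\<Psi> m p \<longleftrightarrow> \<Phi> p \<and> (\<forall>j\<le>m. p (n + j) > k)" for m p
  define e where "e m = Ex h (n + m) (\<Psi> m)" for m
  define P' where "P' m = prob (ev (\<Psi> m))" for m
  have ad\<Psi>: "adapted (n + m) (\<Psi> m)" for m
    unfolding adapted_def \<Psi>_def using ad unfolding adapted_def
    by (metis le_add1 order_trans add_left_mono)
  note m\<Psi> = ev_adapted_sets[OF ad\<Psi>]
  have \<Psi>0: "\<Psi> 0 = \<Phi>" by (auto simp: \<Psi>_def fun_eq_iff dest: \<Phi>)
  have \<Psi>Suc: "\<Psi> (Suc m) = (\<lambda>p. \<Psi> m p \<and> p (Suc (n + m)) > k)" for m
    by (auto simp: \<Psi>_def fun_eq_iff le_Suc_eq)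
  have \<Psi>_gt: "\<Psi> m p \<Longrightarrow> p (n + m) > k" for m p by (auto simp: \<Psi>_def)
  \<comment> \<open>\<open>PP g\<close> is the probability of returning at the next step, and
    \<open>PP f\<close> below is the same weighted by \<open>h\<close>; \<open>fg\<close> compares
    the two pointwise.\<close>
  define g where "g x = (if x \<le> k then 1 else 0 :: real)" for x
  have Pdiff: "Ex (PP g) (n + m) (\<Psi> m) = P' m - P' (Suc m)" for m
  proof -
    have "Ex (PP g) (n + m) (\<Psi> m) = Ex g (Suc (n + m)) (\<Psi> m)"
      by (rule Ex_markov[OF ad\<Psi>, symmetric])
    also have "\<dots> = Ex (\<lambda>_. 1) (Suc (n + m)) (\<lambda>p. \<Psi> m p \<and> p (Suc (n + m)) \<le> k)"
      unfolding g_def by (rule Ex_if)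
    finally have "Ex (PP g) (n + m) (\<Psi> m) = Ex (\<lambda>_. 1) (Suc (n + m)) (\<lambda>p. \<Psi> m p \<and> \<not> p (Suc (n + m)) > k)"
      by (simp add: not_less)
    moreover have "Ex (\<lambda>_. 1) (Suc (n + m)) (\<Psi> m) = P' m" by (simp add: Ex_const m\<Psi> P'_def)
    moreover have "Ex (\<lambda>_. 1) (Suc (n + m)) (\<lambda>p. \<Psi> m p \<and> p (Suc (n + m)) > k) = P' (Suc m)"
      unfolding \<Psi>Suc[symmetric] by (simp add: Ex_const m\<Psi> P'_def)
    ultimately show ?thesis using Ex_split[of "\<lambda>_. 1" "Suc (n + m)" "\<Psi> m" "\<lambda>x. x > k"] by simp
  qed
  define f where "f x = (if x \<le> k then h x else 0)" for x
  have ediff: "e m = e (Suc m) + Ex (PP f) (n + m) (\<Psi> m)" for m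
  proof -
    have "e m = Ex (PP h) (n + m) (\<Psi> m)"
      unfolding e_def by (rule Ex_cong) (simp add: harmonic \<Psi>_gt)
    also have "\<dots> = Ex h (Suc (n + m)) (\<Psi> m)" by (rule Ex_markov[OF ad\<Psi>, symmetric])
    also have "\<dots> = e (Suc m) + Ex h (Suc (n + m)) (\<lambda>p. \<Psi> m p \<and> p (Suc (n + m)) \<le> k)"
      using Ex_split[of h "Suc (n + m)" "\<Psi> m" "\<lambda>x. x > k"] unfolding e_def \<Psi>Suc by (simp add: not_less)
    also have "Ex h (Suc (n + m)) (\<lambda>p. \<Psi> m p \<and> p (Suc (n + m)) \<le> k) = Ex f (Suc (n + m)) (\<Psi> m)"
      unfolding f_def by (rule Ex_if[symmetric])
    also have "\<dots> = Ex (PP f) (n + m) (\<Psi> m)" by (rule Ex_markov[OF ad\<Psi>])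
    finally show ?thesis .
  qed
  have fg: "h k * PP g x \<le> PP f x" "PP f x \<le> h (k - 1) * PP g x" if "x > k" for x
  proof -
    have *: "P x y * (h k * g y) \<le> P x y * f y \<and> P x y * f y \<le> P x y * (h (k - 1) * g y)" for y
    proof (cases "P x y = 0 \<or> y > k")
      case False
      hence "y = k - 1 \<or> y = k" using jump[OF that, of y] by auto
      hence "h k \<le> h y" "h y \<le> h (k - 1)" using h(2) by auto
      thus ?thesis using False P_nonneg[of x y] by (auto simp: f_def g_def intro!: mult_left_mono)
    qed (auto simp: f_def g_def)
    have **: "c * PP g x = (\<Sum>y\<le>x+2. P x y * (c * g y))" for c
      unfolding PP_def sum_distrib_left by (simp only: mult.left_commute)
    show "h k * PP g x \<le> PP f x" "PP f x \<le> h (k - 1) * PP g x"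
      unfolding ** unfolding PP_def using * by (auto intro!: sum_mono simp del: sum.atMost_Suc add_2_eq_Suc')
  qed
  have lo: "h k * (P' m - P' (Suc m)) \<le> e m - e (Suc m)" for m
    unfolding Pdiff[symmetric] Ex_cmult[symmetric] ediff[of m]
    using Ex_mono[of "\<Psi> m" "\<lambda>x. h k * PP g x" "n + m" "PP f"] fg(1) \<Psi>_gt by simp
  have hi: "e m - e (Suc m) \<le> h (k - 1) * (P' m - P' (Suc m))" for m
    unfolding Pdiff[symmetric] Ex_cmult[symmetric] ediff[of m]
    using Ex_mono[of "\<Psi> m" "PP f" "n + m" "\<lambda>x. h (k - 1) * PP g x"] fg(2) \<Psi>_gt by simp
  have lo': "h k * (P' 0 - P' m) \<le> e 0 - e m" for m
  proof (induction m)
    case (Suc m) thus ?case using lo[of m] by (simp add: algebra_simps)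
  qed simp
  have hi': "e 0 - e m \<le> h (k - 1) * (P' 0 - P' m)" for m
  proof (induction m)
    case (Suc m) thus ?case using hi[of m] by (simp add: algebra_simps)
  qed simp
  have e0: "e 0 = h (k + 1) * P' 0"
  proof -
    have "e 0 = Ex (\<lambda>_. h (k + 1)) n \<Phi>" unfolding e_def \<Psi>0 using \<Phi> by (auto intro!: Ex_cong)
    thus ?thesis using m\<Psi>[of 0] by (simp add: Ex_const P'_def \<Psi>0)
  qed
  have e_nn: "e m \<ge> 0" for m unfolding e_def Ex_def by (intro sum_nonneg mult_nonneg_nonneg h(1)) simp
  have e_le: "e m \<le> Ex h (n + m) (\<lambda>_. True)" for m
    unfolding e_def by (rule Ex_subset) (auto simp: h(1))
  have e_lim: "e \<longlonglongrightarrow> 0"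
  proof (rule tendsto_sandwich[OF _ _ tendsto_const])
    show "(\<lambda>m. Ex h (n + m) (\<lambda>_. True)) \<longlonglongrightarrow> 0"
      using LIMSEQ_ignore_initial_segment[OF lim, of n] by (simp add: add.commute)
  qed (use e_nn e_le in auto)
  have INT: "ev (\<lambda>p. \<Phi> p \<and> (\<forall>j\<ge>n. p j > k)) = (\<Inter>m. ev (\<Psi> m))"
    by (auto simp: ev_def \<Psi>_def le_iff_add)
  show "ev (\<lambda>p. \<Phi> p \<and> (\<forall>j\<ge>n. p j > k)) \<in> events"
    unfolding INT using m\<Psi> by (intro sets.countable_INT) auto
  have P'_lim: "P' \<longlonglongrightarrow> prob (ev (\<lambda>p. \<Phi> p \<and> (\<forall>j\<ge>n. p j > k)))"
    unfolding INT P'_def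
  proof (rule finite_Lim_measure_decseq)
    show "range (\<lambda>m. ev (\<Psi> m)) \<subseteq> events" using m\<Psi> by auto
    show "decseq (\<lambda>m. ev (\<Psi> m))" by (intro decseq_SucI) (auto simp: \<Psi>Suc ev_def)
  qed
  \<comment> \<open>The lower bound uses only that the remaining mass \<open>e m\<close> is
    nonnegative; the upper bound after it needs \<open>e m\<close> to vanish in the limit.\<close>
  have "(\<lambda>m. h k * P' m - (h k - h (k + 1)) * P' 0) \<longlonglongrightarrow> h k * prob (ev (\<lambda>p. \<Phi> p \<and> (\<forall>j\<ge>n. p j > k))) - (h k - h (k + 1)) * P' 0"
    by (intro tendsto_intros P'_lim)
  moreover have "h k * P' m - (h k - h (k + 1)) * P' 0 \<ge> 0" for m
    using lo'[of m] e0 e_nn[of m] by (simp add: algebra_simps)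
  ultimately have "h k * prob (ev (\<lambda>p. \<Phi> p \<and> (\<forall>j\<ge>n. p j > k))) - (h k - h (k + 1)) * P' 0 \<ge> 0"
    by (intro tendsto_lowerbound[where F = sequentially]) auto
  thus "(h k - h (k + 1)) * prob (ev \<Phi>) \<le> h k * prob (ev (\<lambda>p. \<Phi> p \<and> (\<forall>j\<ge>n. p j > k)))"
    by (simp add: P'_def \<Psi>0)
  have "(\<lambda>m. (h (k - 1) - h (k + 1)) * P' 0 + e m - h (k - 1) * P' m) \<longlonglongrightarrow>
      (h (k - 1) - h (k + 1)) * P' 0 + 0 - h (k - 1) * prob (ev (\<lambda>p. \<Phi> p \<and> (\<forall>j\<ge>n. p j > k)))"
    by (intro tendsto_intros P'_lim e_lim)
  moreover have "(h (k - 1) - h (k + 1)) * P' 0 + e m - h (k - 1) * P' m \<ge> 0" for m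
    using hi'[of m] e0 by (simp add: algebra_simps)
  ultimately have "(h (k - 1) - h (k + 1)) * P' 0 + 0 - h (k - 1) * prob (ev (\<lambda>p. \<Phi> p \<and> (\<forall>j\<ge>n. p j > k))) \<ge> 0"
    by (intro tendsto_lowerbound[where F = sequentially]) auto
  thus "h (k - 1) * prob (ev (\<lambda>p. \<Phi> p \<and> (\<forall>j\<ge>n. p j > k))) \<le> (h (k - 1) - h (k + 1)) * prob (ev \<Phi>)"
    by (simp add: P'_def \<Psi>0)
qed

lemma prob_union_sums:
  fixes T :: "nat \<Rightarrow> (nat \<Rightarrow> nat) \<Rightarrow> bool"
  assumes "\<And>n. ev (T n) \<in> events" "\<And>n m p. T n p \<Longrightarrow> T m p \<Longrightarrow> n = m"
  shows "(\<lambda>n. prob (ev (T n))) sums prob (ev (\<lambda>p. \<exists>n. T n p))"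
proof -
  have "ev (\<lambda>p. \<exists>n. T n p) = (\<Union>n. ev (T n))" by (auto simp: ev_def)
  moreover have "disjoint_family (\<lambda>n. ev (T n))"
    using assms(2) by (auto simp: disjoint_family_on_def ev_def)
  ultimately show ?thesis using assms(1) by (auto intro!: finite_measure_UNION)
qed

text \<open>\<open>T n\<close> reads as the event that an almost surely finite stopping time equals
  \<open>n\<close>. If at every such time a fraction \<open>c\<close> of the mass succeeds, so does
  a fraction \<open>c\<close> of the whole.\<close>

lemma prob_stopping_lower:
  fixes T E :: "nat \<Rightarrow> (nat \<Rightarrow> nat) \<Rightarrow> bool"
  assumes T: "\<And>n. ev (T n) \<in> events" "\<And>n m p. T n p \<Longrightarrow> T m p \<Longrightarrow> n = m"
    and AE_T: "AE \<omega> in M. \<exists>n. T n (\<lambda>i. Z i \<omega>)"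
    and E: "\<And>n. ev (E n) \<in> events" "\<And>n p. E n p \<Longrightarrow> T n p"
    and lower: "\<And>n. c * prob (ev (T n)) \<le> prob (ev (E n))"
  shows "c \<le> prob (ev (\<lambda>p. \<exists>n. E n p))"
proof -
  have mT: "ev (\<lambda>p. \<exists>n. T n p) \<in> events"
  proof -
    have *: "ev (\<lambda>p. \<exists>n. T n p) = (\<Union>n. ev (T n))" by (auto simp: ev_def)
    show ?thesis unfolding * using T(1) by (intro sets.countable_UN) auto
  qed
  have "prob (ev (\<lambda>p. \<exists>n. T n p)) = 1"
    using mT AE_T by (subst prob_eq_1) (auto simp: ev_def)
  moreover have "(\<lambda>n. prob (ev (T n))) sums prob (ev (\<lambda>p. \<exists>n. T n p))"
    by (rule prob_union_sums) (use T in blast)+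
  ultimately have "(\<lambda>n. prob (ev (T n))) sums 1" by simp
  hence "(\<lambda>n. c * prob (ev (T n))) sums (c * 1)" by (rule sums_mult)
  moreover have "(\<lambda>n. prob (ev (E n))) sums prob (ev (\<lambda>p. \<exists>n. E n p))"
    by (rule prob_union_sums) (use E T(2) in blast)+
  ultimately show ?thesis using sums_le[OF lower] by simp
qed

end

section \<open>Cutpoints\<close>

lemma kernel_sum_X:
  assumes "x \<ge> 2"
  shows "(\<Sum>y\<le>x+2. trans_kernel True q p1 p2 x y * f y) = q x * f (x + 1) + p1 x * f (x - 1) + p2 x * f (x - 2)"
proof -
  have "(\<Sum>y\<le>x+2. trans_kernel True q p1 p2 x y * f y) = (\<Sum>y\<in>{x+1, x-1, x-2}. trans_kernel True q p1 p2 x y * f y)"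
    by (rule sum.mono_neutral_right) (use assms in \<open>auto simp: trans_kernel_def\<close>)
  also have "\<dots> = q x * f (x + 1) + p1 x * f (x - 1) + p2 x * f (x - 2)"
  proof -
    obtain m where "x = Suc (Suc m)" using assms by (metis add_2_eq_Suc le_Suc_ex)
    thus ?thesis by (simp add: trans_kernel_def)
  qed
  finally show ?thesis .
qed

lemma kernel_sum_Y:
  assumes "x \<ge> 2"
  shows "(\<Sum>y\<le>x+2. trans_kernel False q p1 p2 x y * f y) = q x * f (x - 1) + p1 x * f (x + 1) + p2 x * f (x + 2)"
proof -
  have "(\<Sum>y\<le>x+2. trans_kernel False q p1 p2 x y * f y) = (\<Sum>y\<in>{x-1, x+1, x+2}. trans_kernel False q p1 p2 x y * f y)"
    by (rule sum.mono_neutral_right) (use assms in \<open>auto simp: trans_kernel_def\<close>)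
  also have "\<dots> = q x * f (x - 1) + p1 x * f (x + 1) + p2 x * f (x + 2)"
  proof -
    obtain m where "x = Suc (Suc m)" using assms by (metis add_2_eq_Suc le_Suc_ex)
    thus ?thesis by (simp add: trans_kernel_def)
  qed
  finally show ?thesis .
qed

lemma kernel_sum_boundary:
  "(\<Sum>y\<le>0+2. trans_kernel isX q p1 p2 0 y * f y) = (if isX then f 1 else f 2)"
  "(\<Sum>y\<le>1+2. trans_kernel isX q p1 p2 1 y * f y) = (if isX then f 2 else f 0)"
  by (auto simp: trans_kernel_def numeral_2_eq_2)

lemma kernel_nonneg:
  assumes "\<And>k. k \<ge> 2 \<Longrightarrow> q k > 0 \<and> p1 k \<ge> 0 \<and> p2 k > 0 \<and> q k + p1 k + p2 k = 1"
  shows "trans_kernel isX q p1 p2 x y \<ge> 0"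
proof (cases "x \<ge> 2")
  case True
  hence "q x \<ge> 0" "p1 x \<ge> 0" "p2 x \<ge> 0" using assms[OF True] by linarith+
  thus ?thesis
    by (simp only: trans_kernel_def zero_le_one order_refl split: if_split) blast?
next
  case False
  hence "x = 0 \<or> x = 1" by linarith
  thus ?thesis by (elim disjE) (simp_all add: trans_kernel_def)
qed

lemma kernel_beyond: "x + 2 < y \<Longrightarrow> trans_kernel isX q p1 p2 x y = 0"
  by (auto simp: trans_kernel_def)

lemma nat_chain_trans_kernel:
  assumes probs: "\<And>k. k \<ge> 2 \<Longrightarrow> q k > 0 \<and> p1 k \<ge> 0 \<and> p2 k > 0 \<and> q k + p1 k + p2 k = 1"
    and chain: "is_markov_chain M Z 2 (trans_kernel isX q p1 p2)"
  shows "nat_chain M Z 2 (trans_kernel isX q p1 p2)"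
proof -
  from chain interpret prob_space M by (simp add: is_markov_chain_def)
  show ?thesis
  proof unfold_locales
    show "Z n \<in> M \<rightarrow>\<^sub>M count_space UNIV" for n using chain by (simp add: is_markov_chain_def)
    show "prob {\<omega> \<in> space M. \<forall>i\<le>n. Z i \<omega> = x i} =
        (if x 0 = 2 then 1 else 0) * (\<Prod>i<n. trans_kernel isX q p1 p2 (x i) (x (i + 1)))" for n x
      using chain by (simp add: is_markov_chain_def)
    show "trans_kernel isX q p1 p2 x y \<ge> 0" for x y
      by (rule kernel_nonneg[OF probs])
    show "(\<Sum>y\<le>x+2. trans_kernel isX q p1 p2 x y) = 1" for x
    proof -
      consider "x = 0" | "x = 1" | "x \<ge> 2" by linarith
      thus ?thesis
      proof cases
        case 3
        thus ?thesis using probs[OF 3] kernel_sum_X[OF 3, of q p1 p2 "\<lambda>_. 1"] kernel_sum_Y[OF 3, of q p1 p2 "\<lambda>_. 1"]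
          by (cases isX) auto
      qed (use kernel_sum_boundary[of isX q p1 p2 "\<lambda>_. 1"] in simp_all)
    qed
    show "trans_kernel isX q p1 p2 x y = 0" if "x + 2 < y" for x y
      using that by (rule kernel_beyond)
  qed
qed

section \<open>Cutpoints as properties of single paths\<close>

lemma discrete_ivt_up:
  fixes p :: "nat \<Rightarrow> nat"
  assumes "\<And>i. p (Suc i) \<le> p i + 1" "i \<le> j" "p i \<le> k" "k \<le> p j"
  shows "\<exists>m. i \<le> m \<and> m \<le> j \<and> p m = k"
  using assms(2-4)
proof (induction j rule: dec_induct)
  case base thus ?case by (intro exI[of _ i]) auto
next
  case (step j)
  show ?case
  proof (cases "k \<le> p j")
    case True
    thus ?thesis using step by (metis le_SucI)
  next
    case False
    hence "p (Suc j) = k" using assms(1)[of j] step by simp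
    thus ?thesis using step by (intro exI[of _ "Suc j"]) auto
  qed
qed

lemma discrete_ivt_down:
  fixes p :: "nat \<Rightarrow> nat"
  assumes "\<And>i. p i \<le> p (Suc i) + 1" "i \<le> j" "k \<le> p i" "p j \<le> k"
  shows "\<exists>m. i \<le> m \<and> m \<le> j \<and> p m = k"
  using assms(2-4)
proof (induction j rule: dec_induct)
  case base thus ?case by (intro exI[of _ i]) auto
next
  case (step j)
  show ?case
  proof (cases "p j \<le> k")
    case True
    thus ?thesis using step by (metis le_SucI)
  next
    case False
    hence "p (Suc j) = k" using assms(1)[of j] step by simp
    thus ?thesis using step by (intro exI[of _ "Suc j"]) auto
  qed
qed

lemma first_exceed:
  fixes p :: "nat \<Rightarrow> nat"
  assumes "filterlim p at_top sequentially"
  shows "\<exists>n. p n \<ge> k \<and> (\<forall>i<n. p i < k)"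
proof -
  have "\<exists>n. p n \<ge> k" using assms by (auto simp: filterlim_at_top eventually_sequentially)
  thus ?thesis by (intro exI[of _ "LEAST n. p n \<ge> k"]) (metis (mono_tags) LeastI not_less_Least not_le)
qed

text \<open>The only step after which the path can remain above \<open>k\<close> with
  \<open>k\<close> a cutpoint: for \<open>X\<close> up from the first visit to \<open>k\<close>, for
  \<open>Y\<close> the leap over \<open>k\<close>. The index is the time before the step, so the
  event is decided at time \<open>Suc n\<close>.\<close>

definition cut_step :: "bool \<Rightarrow> nat \<Rightarrow> nat \<Rightarrow> (nat \<Rightarrow> nat) \<Rightarrow> bool" where
  "cut_step isX k n p \<longleftrightarrow> p n = (if isX then k else k - 1) \<and> (\<forall>j<n. p j < k) \<and> p (Suc n) = k + 1"

lemma cut_step_unique: "cut_step isX k n p \<Longrightarrow> cut_step isX k m p \<Longrightarrow> n = m"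
proof (induction n m rule: linorder_wlog)
  case (le n m)
  show ?case
  proof (rule ccontr)
    assume "n \<noteq> m"
    \<comment> \<open>At time \<open>Suc n\<close> the path is at \<open>k + 1\<close>: this breaks
      \<open>p j < k\<close> if \<open>Suc n < m\<close>, and is the wrong position if
      \<open>Suc n = m\<close>.\<close>
    hence "Suc n < m \<or> Suc n = m" using le by auto
    thus False using le by (auto simp: cut_step_def split: if_splits)
  qed
qed auto

text \<open>\<open>X\<close> cannot skip \<open>k\<close> on its way up. Being at or above
  \<open>k\<close> before the single visit would mean an earlier visit, and being at or below
  \<open>k\<close> afterwards would mean another one, since the path tends to infinity.\<close>

lemma is_cutpoint_X_iff:
  assumes "p 0 = 2" and up: "\<And>i. p (Suc i) \<le> p i + 1"
    and lim: "filterlim p at_top sequentially" and "k \<ge> 2"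
  shows "is_cutpoint True p k \<longleftrightarrow> (\<exists>n. cut_step True k n p \<and> (\<forall>j\<ge>Suc n. p j > k))"
proof
  assume "is_cutpoint True p k"
  then obtain n where n: "{n. p n = k} = {n}"
    by (auto simp: is_cutpoint_def card_1_singleton_iff)
  hence n1: "p n = k" "\<And>m. p m = k \<Longrightarrow> m = n" by auto
  have below: "p j < k" if "j < n" for j
  proof (rule ccontr)
    assume "\<not> p j < k"
    with discrete_ivt_up[of p 0 j k, OF up] assms obtain m where "m \<le> j" "p m = k" by auto
    with n1(2)[of m] that show False by simp
  qed
  have above: "p j > k" if "j \<ge> Suc n" for j
  proof (rule ccontr)
    assume *: "\<not> p j > k"
    have "eventually (\<lambda>l. k \<le> p l) sequentially" using lim by (simp add: filterlim_at_top)
    from eventually_conj[OF this eventually_ge_at_top[of j]]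
    obtain l where "k \<le> p l" "j \<le> l" by (auto dest: eventually_happens)
    with discrete_ivt_up[of p j l k, OF up] * obtain m where "j \<le> m" "p m = k" by auto
    with n1(2)[of m] that show False by simp
  qed
  have "p (Suc n) = k + 1" using above[of "Suc n"] up[of n] n1(1) by simp
  thus "\<exists>n. cut_step True k n p \<and> (\<forall>j\<ge>Suc n. p j > k)"
    using n1(1) below above by (auto simp: cut_step_def intro!: exI[of _ n])
next
  assume "\<exists>n. cut_step True k n p \<and> (\<forall>j\<ge>Suc n. p j > k)"
  then obtain n where n: "p n = k" "\<And>j. j < n \<Longrightarrow> p j < k" "\<And>j. j \<ge> Suc n \<Longrightarrow> p j > k"
    by (auto simp: cut_step_def)
  have "m = n" if "p m = k" for m
    using n(2)[of m] n(3)[of m] that by (cases m n rule: linorder_cases) auto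
  hence "{m. p m = k} = {n}" using n(1) by blast
  thus "is_cutpoint True p k" by (simp add: is_cutpoint_def)
qed

text \<open>\<open>Y\<close> cannot skip \<open>k\<close> on its way down, so a path that has passed
  an unvisited \<open>k\<close> stays above it. Passing \<open>k\<close> upwards without touching it
  is possible only by the jump from \<open>k - 1\<close> to \<open>k + 1\<close>. With
  \<open>k \<ge> 3\<close> the start 2 lies below \<open>k\<close>.\<close>

lemma is_cutpoint_Y_iff:
  assumes "p 0 = 2" and down: "\<And>i. p i \<le> p (Suc i) + 1" and up: "\<And>i. p (Suc i) \<le> p i + 2"
    and lim: "filterlim p at_top sequentially" and "k \<ge> 3"
  shows "is_cutpoint False p k \<longleftrightarrow> (\<exists>n. cut_step False k n p \<and> (\<forall>j\<ge>Suc n. p j > k))"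
proof
  assume "is_cutpoint False p k"
  hence nk: "p n \<noteq> k" for n by (simp add: is_cutpoint_def)
  obtain i where i: "p i \<ge> k" "\<And>j. j < i \<Longrightarrow> p j < k" using first_exceed[OF lim, of k] by blast
  have "i \<noteq> 0" using i(1) assms by (cases i) auto
  then obtain n where n: "i = Suc n" by (cases i) auto
  have "p n < k" using i(2)[of n] n by simp
  hence pn: "p n = k - 1" "p (Suc n) = k + 1" using up[of n] i(1) nk[of i] n by auto
  have above: "p j > k" if "j \<ge> Suc n" for j
  proof (rule ccontr)
    assume "\<not> p j > k"
    with discrete_ivt_down[of p "Suc n" j k, OF down] pn that nk show False by auto
  qed
  show "\<exists>n. cut_step False k n p \<and> (\<forall>j\<ge>Suc n. p j > k)"
    using pn i(2) n above by (auto simp: cut_step_def intro!: exI[of _ n])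
next
  assume "\<exists>n. cut_step False k n p \<and> (\<forall>j\<ge>Suc n. p j > k)"
  then obtain n where n: "p n = k - 1" "\<And>j. j < n \<Longrightarrow> p j < k" "\<And>j. j \<ge> Suc n \<Longrightarrow> p j > k"
    by (auto simp: cut_step_def)
  have "p m \<noteq> k" for m
    using n(1) n(2)[of m] n(3)[of m] \<open>k \<ge> 3\<close> by (cases m n rule: linorder_cases) auto
  thus "is_cutpoint False p k" by (simp add: is_cutpoint_def)
qed

section \<open>Cut steps followed by escape\<close>

context nat_chain
begin

text \<open>The escape bounds are summed over the time of the cut step; disjointness in
  \<open>n\<close> stands in for the strong Markov property. The number \<open>c\<close> is left
  open because the lower bound for the occurrence of a cut step depends on the walk.\<close>

lemma cut_prob_bounds:
  assumes ad: "\<And>n. adapted (Suc n) (A n)" and A: "\<And>n p. A n p \<Longrightarrow> p (Suc n) = k + 1"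
    and disj: "\<And>n m p. A n p \<Longrightarrow> A m p \<Longrightarrow> n = m"
    and h: "\<And>x. h x \<ge> 0" "h k \<le> h (k - 1)" "h (k + 1) \<le> h k"
    and harmonic: "\<And>x. x > k \<Longrightarrow> PP h x = h x"
    and jump: "\<And>x y. x > k \<Longrightarrow> P x y \<noteq> 0 \<Longrightarrow> k - 1 \<le> y"
    and lim: "(\<lambda>j. Ex h j (\<lambda>_. True)) \<longlonglongrightarrow> 0"
    and C: "C \<in> events" "AE \<omega> in M. \<omega> \<in> C \<longleftrightarrow> (\<exists>n. A n (\<lambda>i. Z i \<omega>) \<and> (\<forall>j\<ge>Suc n. Z j \<omega> > k))"
  shows "c \<le> prob (ev (\<lambda>p. \<exists>n. A n p)) \<Longrightarrow> (h k - h (k + 1)) * c \<le> h k * prob C"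
    and "h (k - 1) * prob C \<le> h (k - 1) - h (k + 1)"
proof -
  define B where "B n p \<longleftrightarrow> A n p \<and> (\<forall>j\<ge>Suc n. p j > k)" for n p
  have esc: "ev (B n) \<in> events"
    "(h k - h (k + 1)) * prob (ev (A n)) \<le> h k * prob (ev (B n))"
    "h (k - 1) * prob (ev (B n)) \<le> (h (k - 1) - h (k + 1)) * prob (ev (A n))" for n
  proof -
    show "ev (B n) \<in> events" unfolding B_def[abs_def] 
      by (rule escape_bounds(1)[of "Suc n" "A n" k h])
        (rule ad lim h(1,2) | erule A harmonic | erule (1) jump)+
    show "(h k - h (k + 1)) * prob (ev (A n)) \<le> h k * prob (ev (B n))"
      unfolding B_def[abs_def] 
      by (rule escape_bounds(2)[of "Suc n" "A n" k h])
        (rule ad lim h(1,2) | erule A harmonic | erule (1) jump)+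
    show "h (k - 1) * prob (ev (B n)) \<le> (h (k - 1) - h (k + 1)) * prob (ev (A n))"
      unfolding B_def[abs_def] 
      by (rule escape_bounds(3)[of "Suc n" "A n" k h])
        (rule ad lim h(1,2) | erule A harmonic | erule (1) jump)+
  qed
  note mB = esc(1)
  have mA: "ev (A n) \<in> events" for n using ad by (rule ev_adapted_sets)
  have sA: "(\<lambda>n. prob (ev (A n))) sums prob (ev (\<lambda>p. \<exists>n. A n p))"
    by (rule prob_union_sums) (use mA disj in auto)
  have sB: "(\<lambda>n. prob (ev (B n))) sums prob (ev (\<lambda>p. \<exists>n. B n p))"
    by (rule prob_union_sums) (use mB disj in \<open>auto simp: B_def\<close>)
  have CB: "prob C = prob (ev (\<lambda>p. \<exists>n. B n p))"
  proof (rule finite_measure_eq_AE)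
    show "AE \<omega> in M. (\<omega> \<in> C) = (\<omega> \<in> ev (\<lambda>p. \<exists>n. B n p))"
      using C(2) AE_space by eventually_elim (auto simp: ev_def B_def)
    have *: "ev (\<lambda>p. \<exists>n. B n p) = (\<Union>n. ev (B n))" by (auto simp: ev_def)
    show "ev (\<lambda>p. \<exists>n. B n p) \<in> events" unfolding * using mB by (intro sets.countable_UN) auto
  qed (use C in auto)
  show "(h k - h (k + 1)) * c \<le> h k * prob C" if "c \<le> prob (ev (\<lambda>p. \<exists>n. A n p))"
  proof -
    have "(h k - h (k + 1)) * c \<le> (h k - h (k + 1)) * prob (ev (\<lambda>p. \<exists>n. A n p))"
      using h that by (intro mult_left_mono) auto
    also have "\<dots> \<le> h k * prob C"
      unfolding CB using esc(2) by (rule sums_le[OF _ sums_mult[OF sA] sums_mult[OF sB]])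
    finally show ?thesis .
  qed
  have "h (k - 1) * prob C \<le> (h (k - 1) - h (k + 1)) * prob (ev (\<lambda>p. \<exists>n. A n p))"
    unfolding CB using esc(3) by (rule sums_le[OF _ sums_mult[OF sB] sums_mult[OF sA]])
  also have "\<dots> \<le> (h (k - 1) - h (k + 1)) * 1"
    using h by (intro mult_left_mono) auto
  finally show "h (k - 1) * prob C \<le> h (k - 1) - h (k + 1)" by simp
qed

text \<open>Transience makes passage to level \<open>k\<close> certain, and a walk rising by at most
  1 first reaches that level exactly at \<open>k\<close>; it then steps up with probability
  \<open>P k (k + 1)\<close>.\<close>

lemma first_hit_step_lower:
  assumes up: "\<And>x y. P x y \<noteq> 0 \<Longrightarrow> y \<le> x + 1" and "x0 \<le> k"
    and trans: "AE \<omega> in M. filterlim (\<lambda>n. Z n \<omega>) at_top sequentially"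
  shows "P k (k + 1) \<le> prob (ev (\<lambda>p. \<exists>n. cut_step True k n p))"
proof -
  define T where "T n p \<longleftrightarrow> p n = k \<and> (\<forall>j<n. p j < k)" for n and p :: "nat \<Rightarrow> nat"
  have ad: "adapted n (T n)" for n by (auto simp: adapted_def T_def)
  have E: "cut_step True k n = (\<lambda>p. T n p \<and> p (Suc n) = k + 1)" for n
    by (auto simp: cut_step_def T_def)
  show ?thesis
  proof (rule prob_stopping_lower[of T])
    show "ev (T n) \<in> events" for n using ad by (rule ev_adapted_sets)
    show "n = m" if "T n p" "T m p" for n m p
      using that by (cases n m rule: linorder_cases) (auto simp: T_def)
    show "AE \<omega> in M. \<exists>n. T n (\<lambda>i. Z i \<omega>)"
      using trans AE_start AE_steps
    proof eventually_elim
      case (elim \<omega>)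
      obtain n where n: "Z n \<omega> \<ge> k" "\<And>i. i < n \<Longrightarrow> Z i \<omega> < k" using first_exceed[OF elim(1), of k] by blast
      have "Z n \<omega> = k"
      proof (cases n)
        case 0 thus ?thesis using n elim \<open>x0 \<le> k\<close> by simp
      next
        case (Suc m)
        hence "Z m \<omega> < k" using n by simp
        moreover have "Z n \<omega> \<le> Z m \<omega> + 1" using up elim(3) Suc by simp
        ultimately show ?thesis using n by simp
      qed
      thus ?case using n unfolding T_def by blast
    qed
    show "ev (cut_step True k n) \<in> events" for n
      by (rule ev_adapted_sets[of "Suc n"]) (auto simp: adapted_def cut_step_def)
    show "T n p" if "cut_step True k n p" for n p using that unfolding E by blast
    show "P k (k + 1) * prob (ev (T n)) \<le> prob (ev (cut_step True k n))" for n
      unfolding E by (subst markov_step[OF ad, of n k]) (auto simp: T_def)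
  qed
qed

text \<open>The first passage above \<open>k - 3\<close> lands on \<open>k - 1\<close> or \<open>k - 2\<close>; in the second case the
  detour \<open>k - 2, k - 3, k - 1\<close> avoids \<open>k\<close>. From \<open>k - 1\<close> the walk then jumps over \<open>k\<close>.\<close>

lemma first_overshoot_step_lower:
  assumes k: "k \<ge> 3" and "x0 \<le> k - 2"
    and trans: "AE \<omega> in M. filterlim (\<lambda>n. Z n \<omega>) at_top sequentially"
  shows "P (k - 2) (k - 3) * P (k - 3) (k - 1) * P (k - 1) (k + 1) \<le> prob (ev (\<lambda>p. \<exists>n. cut_step False k n p))"
proof -
  define T where "T n p \<longleftrightarrow> p n \<ge> k - 2 \<and> (\<forall>j<n. p j < k - 2)" for n and p :: "nat \<Rightarrow> nat"
  define S1 where "S1 n p \<longleftrightarrow> T n p \<and> p n = k - 1" for n p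
  define R0 where "R0 n p \<longleftrightarrow> T n p \<and> p n = k - 2" for n p
  define R1 where "R1 n p \<longleftrightarrow> R0 n p \<and> p (Suc n) = k - 3" for n p
  define R2 where "R2 n p \<longleftrightarrow> R1 n p \<and> p (Suc (Suc n)) = k - 1" for n p
  define E1 where "E1 n p \<longleftrightarrow> S1 n p \<and> p (Suc n) = k + 1" for n p
  define E2 where "E2 n p \<longleftrightarrow> R2 n p \<and> p (Suc (Suc (Suc n))) = k + 1" for n p
  note defs = T_def S1_def R0_def R1_def R2_def E1_def E2_def
  have ad: "adapted n (T n)" "adapted n (S1 n)" "adapted n (R0 n)" "adapted (Suc n) (R1 n)"
    "adapted (Suc (Suc n)) (R2 n)" "adapted (Suc n) (E1 n)" "adapted (Suc (Suc (Suc n))) (E2 n)" for n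
    by (auto simp: adapted_def defs)
  note m = ad[THEN ev_adapted_sets]
  let ?c = "P (k - 2) (k - 3) * P (k - 3) (k - 1) * P (k - 1) (k + 1)"
  have P1: "P x y \<le> 1" for x y
  proof (cases "y \<le> x + 2")
    case True
    hence "P x y \<le> (\<Sum>y\<le>x+2. P x y)" by (intro member_le_sum) (auto simp: P_nonneg)
    thus ?thesis by (simp only: P_sum)
  qed (simp add: P_zero)
  have pE1: "prob (ev (E1 n)) = prob (ev (S1 n)) * P (k - 1) (k + 1)" for n
    unfolding E1_def[abs_def] by (rule markov_step[OF ad(2)]) (simp add: S1_def)
  have pE2: "prob (ev (E2 n)) = prob (ev (R0 n)) * ?c" for n
  proof -
    have "prob (ev (E2 n)) = prob (ev (R2 n)) * P (k - 1) (k + 1)"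
      unfolding E2_def[abs_def] by (rule markov_step[OF ad(5)]) (simp add: R2_def)
    also have "prob (ev (R2 n)) = prob (ev (R1 n)) * P (k - 3) (k - 1)"
      unfolding R2_def[abs_def] by (rule markov_step[OF ad(4)]) (simp add: R1_def)
    also have "prob (ev (R1 n)) = prob (ev (R0 n)) * P (k - 2) (k - 3)"
      unfolding R1_def[abs_def] by (rule markov_step[OF ad(3)]) (simp add: R0_def)
    finally show ?thesis by simp
  qed
  have pT: "prob (ev (T n)) \<le> prob (ev (S1 n)) + prob (ev (R0 n))" for n
  proof -
    have "prob (ev (T n)) \<le> prob (ev (S1 n) \<union> ev (R0 n))"
    proof (rule finite_measure_mono_AE)
      show "AE \<omega> in M. \<omega> \<in> ev (T n) \<longrightarrow> \<omega> \<in> ev (S1 n) \<union> ev (R0 n)"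
        using AE_start AE_steps
      proof eventually_elim
        case (elim \<omega>)
        show ?case
        proof
          assume "\<omega> \<in> ev (T n)"
          hence T: "\<omega> \<in> space M" "Z n \<omega> \<ge> k - 2" "\<And>j. j < n \<Longrightarrow> Z j \<omega> < k - 2" by (auto simp: ev_def T_def)
          have "Z n \<omega> \<le> k - 1"
          proof (cases n)
            case 0 thus ?thesis using elim \<open>x0 \<le> k - 2\<close> by simp
          next
            case (Suc m)
            have "Z n \<omega> \<le> Z m \<omega> + 2" using elim(2) P_zero Suc by (meson not_le)
            thus ?thesis using T(3)[of m] Suc by simp
          qed
          hence "Z n \<omega> = k - 1 \<or> Z n \<omega> = k - 2" using T(2) by auto
          thus "\<omega> \<in> ev (S1 n) \<union> ev (R0 n)" using \<open>\<omega> \<in> ev (T n)\<close> by (auto simp: ev_def S1_def R0_def)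
        qed
      qed
    qed (use m in auto)
    also have "\<dots> \<le> prob (ev (S1 n)) + prob (ev (R0 n))" using m by (intro measure_Un_le) auto
    finally show ?thesis .
  qed
  have "?c \<le> prob (ev (\<lambda>p. \<exists>n. E1 n p \<or> E2 n p))"
  proof (rule prob_stopping_lower[of T])
    show "ev (T n) \<in> events" for n by (rule m)
    show "n = m" if "T n p" "T m p" for n m p
      using that by (cases n m rule: linorder_cases) (auto simp: T_def)
    show "AE \<omega> in M. \<exists>n. T n (\<lambda>i. Z i \<omega>)"
      using trans by eventually_elim (auto simp: T_def dest: first_exceed[of _ "k - 2"])
    have EU: "ev (\<lambda>p. E1 n p \<or> E2 n p) = ev (E1 n) \<union> ev (E2 n)" for n by (auto simp: ev_def)
    show "ev (\<lambda>p. E1 n p \<or> E2 n p) \<in> events" for n unfolding EU using m by auto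
    show "T n p" if "E1 n p \<or> E2 n p" for n p using that by (auto simp: E1_def E2_def S1_def R2_def R1_def R0_def)
    show "?c * prob (ev (T n)) \<le> prob (ev (\<lambda>p. E1 n p \<or> E2 n p))" for n
    proof -
      have "?c * prob (ev (T n)) \<le> ?c * (prob (ev (S1 n)) + prob (ev (R0 n)))"
        by (intro mult_left_mono pT mult_nonneg_nonneg P_nonneg)
      \<comment> \<open>Landing on \<open>k - 1\<close> needs no detour; the two extra factors of
        \<open>?c\<close> are at most 1, so one constant serves both cases.\<close>
      also have "\<dots> \<le> P (k - 1) (k + 1) * prob (ev (S1 n)) + ?c * prob (ev (R0 n))"
      proof -
        have "P (k - 2) (k - 3) * P (k - 3) (k - 1) \<le> 1" by (intro mult_le_one P_nonneg P1)
        hence "?c \<le> 1 * P (k - 1) (k + 1)" by (intro mult_right_mono P_nonneg)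
        hence "?c * prob (ev (S1 n)) \<le> P (k - 1) (k + 1) * prob (ev (S1 n))"
          by (intro mult_right_mono) auto
        thus ?thesis by (simp add: ring_distribs)
      qed
      also have "\<dots> = prob (ev (E1 n)) + prob (ev (E2 n))" by (simp add: pE1 pE2 mult.commute)
      also have "\<dots> = prob (ev (E1 n) \<union> ev (E2 n))"
        by (rule finite_measure_Union[symmetric]) (use m k in \<open>auto simp: ev_def E1_def E2_def S1_def R2_def R1_def R0_def\<close>)
      finally show ?thesis unfolding EU .
    qed
  qed
  also have "\<dots> \<le> prob (ev (\<lambda>p. \<exists>n. cut_step False k n p))"
  proof (rule finite_measure_mono)
    have E1: "cut_step False k n p" if "E1 n p" for n p
      using that k by (auto simp: cut_step_def E1_def S1_def T_def intro: less_le_trans)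
    have E2: "cut_step False k (Suc (Suc n)) p" if "E2 n p" for n p
    proof -
      have *: "\<And>j. j < n \<Longrightarrow> p j < k - 2" "p n = k - 2" "p (Suc n) = k - 3" "p (Suc (Suc n)) = k - 1" "p (Suc (Suc (Suc n))) = k + 1"
        using that by (auto simp: defs)
      have "p j < k" if j: "j < Suc (Suc n)" for j
      proof -
        consider "j < n" | "j = n" | "j = Suc n" using j by linarith
        thus ?thesis using *(1)[of j] *(2,3) k by cases auto
      qed
      thus ?thesis using * by (auto simp: cut_step_def)
    qed
    show "ev (\<lambda>p. \<exists>n. E1 n p \<or> E2 n p) \<subseteq> ev (\<lambda>p. \<exists>n. cut_step False k n p)"
      unfolding ev_def using E1 E2 by blast
    have *: "ev (\<lambda>p. \<exists>n. cut_step False k n p) = (\<Union>n. ev (cut_step False k n))" by (auto simp: ev_def)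
    have "ev (cut_step False k n) \<in> events" for n
      by (rule ev_adapted_sets[of "Suc n"]) (auto simp: adapted_def cut_step_def)
    thus "ev (\<lambda>p. \<exists>n. cut_step False k n p) \<in> events" unfolding * by (intro sets.countable_UN) auto
  qed
  finally show ?thesis .
qed

end

section \<open>Bounding cutpoint probabilities by increments\<close>

lemma suminf_tail_tendsto_0:
  fixes u :: "nat \<Rightarrow> real"
  assumes "summable u"
  shows "(\<lambda>k. \<Sum>j. u (j + k)) \<longlonglongrightarrow> 0"
proof -
  have "(\<lambda>k. suminf u - sum u {..<k}) \<longlonglongrightarrow> suminf u - suminf u"
    by (intro tendsto_intros summable_LIMSEQ assms)
  thus ?thesis by (simp add: suminf_minus_initial_segment[OF assms])
qed

text \<open>Written through \<open>H = h (x + 1)\<close> and the increments, total mass 1 cancels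
  \<open>H\<close> and what is left is the recursion for \<open>u\<close>. For \<open>Y\<close>
  below, the reference value is \<open>h (x + 2)\<close>.\<close>

lemma kernel_harmonic_X:
  fixes q p1 p2 u h :: "nat \<Rightarrow> real"
  assumes "x \<ge> 2" and sum1: "q x + p1 x + p2 x = 1"
    and u: "q x * u x = (p1 x + p2 x) * u (x - 1) + p2 x * u (x - 2)"
    and h: "\<And>k. h k = u k + h (Suc k)"
  shows "q x * h (x + 1) + p1 x * h (x - 1) + p2 x * h (x - 2) = h x"
proof -
  obtain m where m: "x = Suc (Suc m)" using assms(1) by (metis add_2_eq_Suc le_Suc_ex)
  define H where "H = h (Suc (Suc (Suc m)))"
  have "h x = u x + H" "h (x - 1) = u (Suc m) + u x + H" "h (x - 2) = u m + u (Suc m) + u x + H"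
    using h[of m] h[of "Suc m"] h[of "Suc (Suc m)"] by (simp_all add: m H_def)
  moreover have "h (x + 1) = H" by (simp add: m H_def)
  moreover have "Q * H + A * (v + w + H) + B * (z + v + w + H) = w + H"
    if "Q + A + B = 1" "Q * w = (A + B) * v + B * z" for Q A B v w z H :: real
    using that by algebra
  ultimately show ?thesis using u sum1 by (simp add: m)
qed

lemma kernel_harmonic_Y:
  fixes q p1 p2 u h :: "nat \<Rightarrow> real"
  assumes "x \<ge> 2" and sum1: "q x + p1 x + p2 x = 1"
    and u: "q x * u (x - 1) = (p1 x + p2 x) * u x + p2 x * u (x + 1)"
    and h: "\<And>k. h k = u k + h (Suc k)"
  shows "q x * h (x - 1) + p1 x * h (x + 1) + p2 x * h (x + 2) = h x"
proof -
  obtain m where m: "x = Suc (Suc m)" using assms(1) by (metis add_2_eq_Suc le_Suc_ex)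
  define H where "H = h (Suc (Suc (Suc (Suc m))))"
  have "h x = u x + u (x + 1) + H" "h (x - 1) = u (x - 1) + u x + u (x + 1) + H" "h (x + 1) = u (x + 1) + H"
    using h[of "Suc m"] h[of "Suc (Suc m)"] h[of "Suc (Suc (Suc m))"] by (simp_all add: m H_def)
  moreover have "h (x + 2) = H" by (simp add: m H_def)
  moreover have "Q * (z + v + w + H) + A * (w + H) + B * H = v + w + H"
    if "Q + A + B = 1" "Q * z = (A + B) * v + B * w" for Q A B v w z H :: real
    using that by algebra
  ultimately show ?thesis using u sum1 by (simp add: m)
qed

lemma kernel_X_nonzero:
  assumes "trans_kernel True q p1 p2 x y \<noteq> 0"
  shows "y \<le> x + 1" "x \<le> y + 2"
  using assms by (auto simp: trans_kernel_def split: if_splits)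

lemma kernel_Y_nonzero:
  assumes "trans_kernel False q p1 p2 x y \<noteq> 0"
  shows "y \<le> x + 2" "x \<le> y + 1"
  using assms by (auto simp: trans_kernel_def split: if_splits)

text \<open>Cardinality 1 means exactly one visiting time, a condition with countable quantifiers;
  an infinite set of visits has \<open>card\<close> 0 and is rightly excluded.\<close>

lemma is_cutpoint_sets:
  assumes [measurable]: "\<And>n. Z n \<in> M \<rightarrow>\<^sub>M count_space (UNIV :: nat set)"
  shows "{\<omega> \<in> space M. is_cutpoint isX (\<lambda>i. Z i \<omega>) k} \<in> sets M"
proof (cases isX)
  case True
  have "is_cutpoint isX p k \<longleftrightarrow> (\<exists>n. p n = k \<and> (\<forall>m. p m = k \<longrightarrow> m = n))" for p
    using True by (auto simp: is_cutpoint_def card_1_singleton_iff)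
  thus ?thesis by simp
next
  case False
  thus ?thesis by (simp add: is_cutpoint_def)
qed

text \<open>For the tail sums \<open>h\<close> one has \<open>h k - h (k + 1) = u k\<close> and
  \<open>h (k - 1) - h (k + 1) = u (k - 1) + u k\<close>, which turns the escape bounds into these
  inequalities. With \<open>k \<ge> 5\<close> the detour for \<open>Y\<close> uses only states
  \<open>\<ge> 2\<close>, where the kernel is given by \<open>q\<close> and
  \<open>p2\<close>.\<close>

lemma cutpoint_prob_bounds:
  fixes q p1 p2 u :: "nat \<Rightarrow> real"
  assumes probs: "\<And>k. k \<ge> 2 \<Longrightarrow> q k > 0 \<and> p1 k \<ge> 0 \<and> p2 k > 0 \<and> q k + p1 k + p2 k = 1"
    and chain: "is_markov_chain M Z 2 (trans_kernel isX q p1 p2)"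
    and u: "\<And>n. u n > 0" "summable u"
    and uX: "\<And>n. isX \<Longrightarrow> n \<ge> 2 \<Longrightarrow> q n * u n = (p1 n + p2 n) * u (n - 1) + p2 n * u (n - 2)"
    and uY: "\<And>n. \<not> isX \<Longrightarrow> n \<ge> 2 \<Longrightarrow> q n * u (n - 1) = (p1 n + p2 n) * u n + p2 n * u (n + 1)"
    and k: "k \<ge> 5"
  defines "h \<equiv> \<lambda>k. \<Sum>j. u (j + k)"
    and "cp \<equiv> measure M {\<omega> \<in> space M. is_cutpoint isX (\<lambda>i. Z i \<omega>) k}"
  shows "(if isX then q k else q (k - 2) * p2 (k - 3) * p2 (k - 1)) * u k \<le> h k * cp"
    and "h (k - 1) * cp \<le> u (k - 1) + u k"
proof -
  interpret nat_chain M Z 2 "trans_kernel isX q p1 p2"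
    using probs chain by (rule nat_chain_trans_kernel)
  have h_step: "h k = u k + h (Suc k)" for k
    using suminf_split_head[OF summable_ignore_initial_segment[OF u(2), of k]] by (simp add: h_def)
  have h_pos: "h k > 0" for k
    unfolding h_def using u by (intro suminf_pos summable_ignore_initial_segment)
  have h_lim: "h \<longlonglongrightarrow> 0" unfolding h_def by (rule suminf_tail_tendsto_0[OF u(2)])
  \<comment> \<open>\<open>Y\<close> moves from \<open>1\<close> to \<open>0\<close> and from \<open>0\<close> to \<open>2\<close>, so \<open>h\<close> is superharmonic only
    once its value at \<open>0\<close> is moved between those at \<open>2\<close> and \<open>1\<close>.\<close>
  define g where "g = (if isX then h else h(0 := (h 1 + h 2) / 2))"
  have gh: "g k = h k" if "k \<ge> 1" for k using that by (auto simp: g_def)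
  have h_less: "h (Suc k) < h k" for k using h_step[of k] u(1)[of k] by simp
  have g_pos: "g k > 0" for k using h_pos by (auto simp: g_def add_pos_pos)
  have g_lim: "g \<longlonglongrightarrow> 0"
    by (rule Lim_transform_eventually[OF h_lim])
      (use gh in \<open>auto intro!: eventually_mono[OF eventually_ge_at_top[of 1]]\<close>)
  have harmonic: "PP g x = g x" if x: "x \<ge> 2" for x
  proof (cases isX)
    case True
    have s1: "q x + p1 x + p2 x = 1" using probs[OF x] by simp
    have "PP g x = q x * h (x + 1) + p1 x * h (x - 1) + p2 x * h (x - 2)"
      unfolding PP_def using True kernel_sum_X[OF x, of q p1 p2 g] by (simp add: g_def)
    also have "\<dots> = h x" by (rule kernel_harmonic_X[of x q p1 p2 u h, OF x s1 uX[OF True x] h_step])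
    finally show ?thesis using True by (simp add: g_def)
  next
    case False
    have s1: "q x + p1 x + p2 x = 1" using probs[OF x] by simp
    have "PP g x = q x * g (x - 1) + p1 x * g (x + 1) + p2 x * g (x + 2)"
      unfolding PP_def using False kernel_sum_Y[OF x, of q p1 p2 g] by simp
    also have "\<dots> = q x * h (x - 1) + p1 x * h (x + 1) + p2 x * h (x + 2)"
      using x by (simp add: gh)
    also have "\<dots> = h x" by (rule kernel_harmonic_Y[of x q p1 p2 u h, OF x s1 uY[OF False x] h_step])
    finally show ?thesis using x by (simp add: gh)
  qed
  have PP01: "PP g 0 = (if isX then g 1 else g 2)" "PP g 1 = (if isX then g 2 else g 0)"
    unfolding PP_def by (rule kernel_sum_boundary)+
  have h012: "h 1 < h 0" "h 2 < h 1" using h_less[of 0] h_less[of 1] by (simp_all add: numeral_2_eq_2)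
  have super: "PP g x \<le> g x" for x
  proof -
    consider "x = 0" | "x = 1" | "x \<ge> 2" by linarith
    thus ?thesis
    proof cases
      case 1 thus ?thesis using PP01(1) h012 by (auto simp: g_def)
    next
      case 2 thus ?thesis using PP01(2) h012 by (auto simp: g_def)
    qed (simp add: harmonic)
  qed
  \<comment> \<open>From every state some possible step changes \<open>g\<close>, as strict
    superharmonicity of \<open>sqrt g\<close> demands.\<close>
  have strict: "\<exists>y. trans_kernel isX q p1 p2 x y > 0 \<and> g y \<noteq> g x" for x
  proof (cases isX)
    case True
    have "trans_kernel isX q p1 p2 x (Suc x) > 0"
      using True probs[of x] by (auto simp: trans_kernel_def)
    moreover have "g (Suc x) \<noteq> g x" using True h_less[of x] by (simp add: g_def)
    ultimately show ?thesis by blast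
  next
    case False
    consider "x = 0" | "x = 1" | "x \<ge> 2" by linarith
    thus ?thesis
    proof cases
      case 1 thus ?thesis using False h012 by (intro exI[of _ 2]) (auto simp: trans_kernel_def g_def)
    next
      case 2 thus ?thesis using False h012 by (intro exI[of _ 0]) (auto simp: trans_kernel_def g_def)
    next
      case 3
      then obtain m where m: "x = Suc (Suc m)" by (metis add_2_eq_Suc le_Suc_ex)
      show ?thesis using False m probs[OF 3] h_less[of "Suc m"]
        by (intro exI[of _ "Suc m"]) (auto simp: trans_kernel_def gh)
    qed
  qed
  have sm: "summable (\<lambda>n. prob {\<omega> \<in> space M. Z n \<omega> \<le> K})" for K
  proof (rule transient_summable[of "\<lambda>x. sqrt (g x)"])
    show "sqrt (g x) \<ge> 0" for x using g_pos[of x] by simp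
    show "PP (\<lambda>x. sqrt (g x)) x < sqrt (g x)" for x
      using strict[of x] PP_sqrt_less[of g x] g_pos super by blast
  qed
  note trans = AE_transient[OF sm]
  have lim: "(\<lambda>n. Ex g n (\<lambda>_. True)) \<longlonglongrightarrow> 0"
    using sm g_pos g_lim by (intro Ex_tendsto_0) (auto intro: less_imp_le)
  define C where "C = {\<omega> \<in> space M. is_cutpoint isX (\<lambda>i. Z i \<omega>) k}"
  have C: "C \<in> events" unfolding C_def by (rule is_cutpoint_sets) (rule Z_meas)
  have AE_C: "AE \<omega> in M. \<omega> \<in> C \<longleftrightarrow> (\<exists>n. cut_step isX k n (\<lambda>i. Z i \<omega>) \<and> (\<forall>j\<ge>Suc n. Z j \<omega> > k))"
    using trans AE_start AE_steps AE_space
  proof eventually_elim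
    case (elim \<omega>)
    have "is_cutpoint isX (\<lambda>i. Z i \<omega>) k \<longleftrightarrow> (\<exists>n. cut_step isX k n (\<lambda>i. Z i \<omega>) \<and> (\<forall>j\<ge>Suc n. Z j \<omega> > k))"
    proof (cases isX)
      case True
      have "Z (Suc i) \<omega> \<le> Z i \<omega> + 1" for i using elim(3) True kernel_X_nonzero(1) by metis
      thus ?thesis using is_cutpoint_X_iff[of "\<lambda>i. Z i \<omega>" k] elim k True by simp
    next
      case False
      have "Z (Suc i) \<omega> \<le> Z i \<omega> + 2" "Z i \<omega> \<le> Z (Suc i) \<omega> + 1" for i
        using elim(3) False kernel_Y_nonzero by metis+
      thus ?thesis using is_cutpoint_Y_iff[of "\<lambda>i. Z i \<omega>" k] elim k False by simp
    qed
    thus ?case using elim(4) by (simp add: C_def)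
  qed
  have jump: "k - 1 \<le> y" if "x > k" "trans_kernel isX q p1 p2 x y \<noteq> 0" for x y
  proof (cases isX)
    case True
    thus ?thesis using that kernel_X_nonzero(2)[of q p1 p2 x y] by simp
  next
    case False
    thus ?thesis using that kernel_Y_nonzero(2)[of q p1 p2 x y] by simp
  qed
  have *: "adapted (Suc n) (cut_step isX k n)" for n
    by (auto simp: adapted_def cut_step_def)
  have **: "p (Suc n) = k + 1" if "cut_step isX k n p" for n p
    using that by (simp add: cut_step_def)
  have gk: "g k = h k" "g (k - 1) = h (k - 1)" "g (k + 1) = h (k + 1)"
    using k by (auto simp: gh)
  have hk: "h (k - 1) = u (k - 1) + h k" "h k = u k + h (k + 1)"
    using h_step[of "k - 1"] h_step[of k] k by auto
  have up: "u k > 0" "u (k - 1) > 0" by (simp_all add: u)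
  have gmono: "g k \<le> g (k - 1)" "g (k + 1) \<le> g k" unfolding gk using hk up by linarith+
  have harmonic': "PP g x = g x" if "x > k" for x using that k by (intro harmonic) simp
  have bounds: "c \<le> prob (ev (\<lambda>p. \<exists>n. cut_step isX k n p)) \<Longrightarrow> (g k - g (k + 1)) * c \<le> g k * prob C"
    "g (k - 1) * prob C \<le> g (k - 1) - g (k + 1)" for c
    by (rule cut_prob_bounds[where A = "cut_step isX k"];
        (rule * less_imp_le[OF g_pos] gmono lim C AE_C | erule ** harmonic' | erule (1) jump cut_step_unique | assumption))+
  have cpC: "cp = prob C" by (simp add: cp_def C_def)
  show "h (k - 1) * cp \<le> u (k - 1) + u k"
    using bounds(2) unfolding gk cpC using hk by linarith
  have lower: "(if isX then q k else q (k - 2) * p2 (k - 3) * p2 (k - 1)) \<le> prob (ev (\<lambda>p. \<exists>n. cut_step isX k n p))"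
  proof (cases isX)
    case True
    have "trans_kernel isX q p1 p2 k (k + 1) \<le> prob (ev (\<lambda>p. \<exists>n. cut_step True k n p))"
    proof (rule first_hit_step_lower)
      show "y \<le> x + 1" if "trans_kernel isX q p1 p2 x y \<noteq> 0" for x y
        using that True kernel_X_nonzero(1)[of q p1 p2 x y] by simp
    qed (use k trans in auto)
    thus ?thesis using True k by (simp add: trans_kernel_def)
  next
    case False
    have "trans_kernel isX q p1 p2 (k - 2) (k - 3) * trans_kernel isX q p1 p2 (k - 3) (k - 1) *
        trans_kernel isX q p1 p2 (k - 1) (k + 1) \<le> prob (ev (\<lambda>p. \<exists>n. cut_step False k n p))"
      by (rule first_overshoot_step_lower) (use k trans in auto)
    moreover obtain m where "k = m + 5" using k by (metis add.commute le_Suc_ex)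
    ultimately show ?thesis using False by (simp add: trans_kernel_def)
  qed
  have "u k = g k - g (k + 1)" unfolding gk using hk by simp
  thus "(if isX then q k else q (k - 2) * p2 (k - 3) * p2 (k - 1)) * u k \<le> h k * cp"
    using bounds(1)[OF lower] by (simp add: gk cpC mult.commute)
qed

text \<open>Along \<open>t j = 2 ^ 2 ^ j\<close> the logarithm is \<open>2 ^ j * ln 2\<close>, so
  the expected ratios are bounded by a geometric series with factor
  \<open>2 powr - \<epsilon>\<close>. Their sum is then almost surely finite and its terms vanish;
  monotonicity of \<open>S\<close> fills the gaps.\<close>

lemma AE_ratio_tendsto_0:
  fixes S :: "nat \<Rightarrow> 'a \<Rightarrow> real"
  assumes "prob_space M" and \<beta>: "0 \<le> \<beta>" and \<epsilon>: "\<epsilon> > 0"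
    and S: "\<And>n. integrable M (S n)" "\<And>n \<omega>. S n \<omega> \<ge> 0" "\<And>m n \<omega>. m \<le> n \<Longrightarrow> S m \<omega> \<le> S n \<omega>"
    and bound: "\<And>n. n \<ge> N \<Longrightarrow> integral\<^sup>L M (S n) \<le> K * gscale \<beta> n"
  shows "AE \<omega> in M. (\<lambda>n. S n \<omega> / (ln (real n) powr (1 + \<epsilon>) * ln (ln (real n)) powr (- \<beta>))) \<longlonglongrightarrow> 0"
proof -
  interpret prob_space M by fact
  define W where "W n = ln (real n) powr (1 + \<epsilon>) * ln (ln (real n)) powr (- \<beta>)" for n
  define t :: "nat \<Rightarrow> nat" where "t j = 2 ^ (2 ^ j)" for j
  have t_mono: "t i \<le> t j" if "i \<le> j" for i j using that by (simp add: t_def)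
  have t_gt: "j < t j" for j
    unfolding t_def by (meson less_exp less_trans)
  have t_ln: "ln (real (t j)) = 2 ^ j * ln 2" for j by (simp add: t_def ln_realpow)
  define J where "J = max 2 N"
  have tJ: "t j \<ge> 4" "t j \<ge> N" if "j \<ge> J" for j
  proof -
    have "t j \<ge> t 2" using that by (intro t_mono) (simp add: J_def)
    thus "t j \<ge> 4" by (simp add: t_def)
    show "t j \<ge> N" using t_gt[of j] that by (simp add: J_def)
  qed
  define f where "f j \<omega> = S (t (j + J)) \<omega> / W (t (j + J))" for j \<omega>
  have W_pos: "W n > 0" if "n \<ge> 4" for n using ln_ln_pos[OF that] that by (simp add: W_def)
  have f_nn: "f j \<omega> \<ge> 0" for j \<omega>
    unfolding f_def using S(2) W_pos[OF tJ(1)] by (intro divide_nonneg_pos) auto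
  have f_int: "integrable M (f j)" for j unfolding f_def using S(1) by simp
  have f_exp: "expectation (f j) \<le> K / (2 ^ (j + J) * ln 2) powr \<epsilon>" for j
  proof -
    let ?n = "t (j + J)"
    have n: "?n \<ge> 4" "?n \<ge> N" by (auto intro: tJ)
    have l: "ln (real ?n) > 0" using n by simp
    have "expectation (f j) = expectation (S ?n) / W ?n" unfolding f_def by simp
    also have "\<dots> \<le> K * gscale \<beta> ?n / W ?n"
      using bound[OF n(2)] W_pos[OF n(1)] by (intro divide_right_mono) auto
    also have "\<dots> = K / ln (real ?n) powr \<epsilon>"
      using ln_ln_pos[OF n(1)] l by (simp add: gscale_def W_def powr_add)
    finally show ?thesis by (simp add: t_ln)
  qed
  have summ: "summable (\<lambda>j. K / (2 ^ (j + J) * ln 2) powr \<epsilon>)"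
  proof -
    have "K / (2 ^ (j + J) * ln 2) powr \<epsilon> = K / (2 ^ J * ln 2) powr \<epsilon> * (2 powr - \<epsilon>) ^ j" for j
    proof -
      have "(2 ^ (j + J) * ln 2) powr \<epsilon> = (2 ^ J * ln (2::real)) powr \<epsilon> * (2 ^ j) powr \<epsilon>"
        by (simp add: powr_mult power_add mult_ac)
      moreover have "((2::real) ^ j) powr \<epsilon> = 1 / (2 powr - \<epsilon>) ^ j"
        by (simp add: powr_minus powr_power powr_powr mult.commute divide_simps flip: powr_realpow)
      ultimately show ?thesis by simp
    qed
    moreover have "summable (\<lambda>j. K / (2 ^ J * ln 2) powr \<epsilon> * (2 powr - \<epsilon>) ^ j)"
      using \<epsilon> by (intro summable_mult summable_geometric) (simp add: powr_minus field_simps)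
    ultimately show ?thesis by simp
  qed
  have "summable (\<lambda>j. expectation (f j))"
    by (rule summable_comparison_test'[OF summ, of 0]) (use f_exp f_nn in \<open>auto intro: integral_nonneg\<close>)
  moreover have "expectation (f j) \<ge> 0" for j using f_nn by simp
  ultimately have "(\<Sum>j. ennreal (expectation (f j))) \<noteq> top"
    by (simp add: suminf_ennreal_eq[OF _ summable_sums])
  also have "(\<Sum>j. ennreal (expectation (f j))) = (\<Sum>j. \<integral>\<^sup>+\<omega>. ennreal (f j \<omega>) \<partial>M)"
    using f_int f_nn by (intro suminf_cong nn_integral_eq_integral[symmetric]) auto
  also have "\<dots> = (\<integral>\<^sup>+\<omega>. (\<Sum>j. ennreal (f j \<omega>)) \<partial>M)"
    using f_int by (intro nn_integral_suminf[symmetric]) auto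
  finally have "AE \<omega> in M. (\<Sum>j. ennreal (f j \<omega>)) \<noteq> \<infinity>"
    using f_int by (intro nn_integral_PInf_AE) (auto simp: infinity_ennreal_def)
  thus ?thesis
  proof eventually_elim
    case (elim \<omega>)
    hence "summable (\<lambda>j. f j \<omega>)"
      using f_nn by (intro summable_suminf_not_top) (auto simp: infinity_ennreal_def)
    hence f0: "(\<lambda>j. f j \<omega>) \<longlonglongrightarrow> 0" by (rule summable_LIMSEQ_zero)
    have "(\<lambda>n. S n \<omega> / W n) \<longlonglongrightarrow> 0"
    proof (rule LIMSEQ_I)
      fix e :: real assume e: "e > 0"
      define c where "c = 2 powr (1 + \<epsilon>)"
      have c: "c > 0" by (simp add: c_def)
      have "eventually (\<lambda>j. f j \<omega> < e / c) sequentially"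
        using f0 e c by (intro order_tendstoD(2)[OF f0]) simp
      then obtain j0 where j0: "\<And>j. j \<ge> j0 \<Longrightarrow> f j \<omega> < e / c"
        unfolding eventually_sequentially by auto
      show "\<exists>n0. \<forall>n\<ge>n0. norm (S n \<omega> / W n - 0) < e"
      proof (intro exI[of _ "t (j0 + J)"] allI impI)
        fix n assume n: "n \<ge> t (j0 + J)"
        define i where "i = (LEAST i. n < t i)"
        have i: "n < t i" unfolding i_def by (rule LeastI[of _ n]) (rule t_gt)
        have "i > j0 + J"
        proof (rule ccontr)
          assume "\<not> i > j0 + J"
          hence "t i \<le> t (j0 + J)" by (intro t_mono) simp
          with i n show False by simp
        qed
        then obtain l where l: "i = Suc l" "l \<ge> j0 + J" by (cases i) auto
        have "\<not> n < t l" using not_less_Least[of l "\<lambda>i. n < t i"] l by (simp add: i_def)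
        hence tl: "t l \<le> n" by simp
        have n4: "n \<ge> 4" "t i \<ge> 4" using tJ(1)[of l] tJ(1)[of i] tl l by auto
        \<comment> \<open>From \<open>t l\<close> to \<open>t i\<close> with
          \<open>i = Suc l\<close> the logarithm doubles, which gives
          \<open>c = 2 powr (1 + \<epsilon>)\<close>; the iterated logarithm has exponent
          \<open>- \<beta> \<le> 0\<close> and only decreases.\<close>
        have W: "W (t i) \<le> c * W n"
        proof -
          have "ln (real (t i)) = 2 * ln (real (t l))" by (simp add: t_ln l)
          also have "\<dots> \<le> 2 * ln (real n)" using tl tJ(1)[of l] l by simp
          finally have "ln (real (t i)) powr (1 + \<epsilon>) \<le> (2 * ln (real n)) powr (1 + \<epsilon>)"
            using n4 \<epsilon> by (intro powr_mono2) auto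
          also have "\<dots> = c * ln (real n) powr (1 + \<epsilon>)" using n4 by (simp add: powr_mult c_def)
          finally have 1: "ln (real (t i)) powr (1 + \<epsilon>) \<le> c * ln (real n) powr (1 + \<epsilon>)" .
          have "ln (ln (real n)) \<le> ln (ln (real (t i)))" using i n4 by simp
          hence 2: "ln (ln (real (t i))) powr (- \<beta>) \<le> ln (ln (real n)) powr (- \<beta>)"
            using ln_ln_pos[OF n4(1)] \<beta> by (intro powr_mono2') auto
          show ?thesis unfolding W_def mult.assoc[symmetric] using 1 2 c
            by (intro mult_mono) auto
        qed
        have "S n \<omega> / W n \<le> S (t i) \<omega> / W n"
          using S(3)[of n "t i" \<omega>] i W_pos[OF n4(1)] by (intro divide_right_mono) auto
        also have "\<dots> \<le> c * (S (t i) \<omega> / W (t i))"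
        proof -
          have "1 / W n \<le> c / W (t i)" using W W_pos[OF n4(1)] W_pos[OF n4(2)] by (simp add: field_simps)
          from mult_left_mono[OF this S(2)[of "t i" \<omega>]] show ?thesis by (simp add: mult_ac)
        qed
        also have "\<dots> = c * f (i - J) \<omega>" using l by (simp add: f_def)
        also have "\<dots> < e" using j0[of "i - J"] l c by (simp add: field_simps)
        finally have "S n \<omega> / W n < e" .
        moreover have "S n \<omega> / W n \<ge> 0" using S(2) W_pos[OF n4(1)] by (intro divide_nonneg_pos) auto
        ultimately show "norm (S n \<omega> / W n - 0) < e" by simp
      qed
    qed
    thus ?case by (simp add: W_def)
  qed
qed

section \<open>Order of the cutpoint probabilities and of the expected count\<close>

lemma transition_prob_limits:
  fixes q p1 p2 :: "nat \<Rightarrow> real"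
  assumes probs: "\<And>k. k \<ge> 2 \<Longrightarrow> q k > 0 \<and> p1 k \<ge> 0 \<and> p2 k > 0 \<and> q k + p1 k + p2 k = 1"
    and a_lim: "\<exists>a>0. (\<lambda>k. (p1 k + p2 k) / q k) \<longlonglongrightarrow> a"
    and b_lim: "\<exists>b>0. (\<lambda>k. p2 k / q k) \<longlonglongrightarrow> b"
  obtains Q R where "Q > 0" "R > 0" "q \<longlonglongrightarrow> Q" "p2 \<longlonglongrightarrow> R"
proof -
  obtain a where a: "a > 0" "(\<lambda>k. (p1 k + p2 k) / q k) \<longlonglongrightarrow> a" using a_lim by blast
  obtain b where b: "b > 0" "(\<lambda>k. p2 k / q k) \<longlonglongrightarrow> b" using b_lim by blast
  \<comment> \<open>Total mass 1 gives \<open>(p1 k + p2 k) / q k = 1 / q k - 1\<close>, so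
    \<open>q\<close> is recovered from this ratio.\<close>
  have "(\<lambda>k. 1 / (1 + (p1 k + p2 k) / q k)) \<longlonglongrightarrow> 1 / (1 + a)"
    using a by (intro tendsto_intros) auto
  moreover have "eventually (\<lambda>k. 1 / (1 + (p1 k + p2 k) / q k) = q k) sequentially"
    using eventually_ge_at_top[of 2]
  proof eventually_elim
    case (elim k)
    have "q k > 0" "p1 k + p2 k = 1 - q k" using probs[OF elim] by auto
    thus ?case by (simp add: field_simps)
  qed
  ultimately have q: "q \<longlonglongrightarrow> 1 / (1 + a)" by (rule Lim_transform_eventually)
  have "(\<lambda>k. p2 k / q k * q k) \<longlonglongrightarrow> b * (1 / (1 + a))" by (intro tendsto_mult b q)
  moreover have "eventually (\<lambda>k. p2 k / q k * q k = p2 k) sequentially"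
    using eventually_ge_at_top[of 2]
  proof eventually_elim
    case (elim k)
    have "q k > 0" using probs[OF elim] by simp
    thus ?case by simp
  qed
  ultimately have "p2 \<longlonglongrightarrow> b * (1 / (1 + a))" by (rule Lim_transform_eventually)
  with that[of "1 / (1 + a)" "b * (1 / (1 + a))"] q a b show ?thesis by auto
qed

lemma ratio_tendsto_1:
  fixes u :: "nat \<Rightarrow> real"
  assumes "0 \<le> \<beta>" "\<beta> < 1"
    and "(\<lambda>n. u (Suc n) / u n - (1 - 3 * r_seq \<beta> (Suc n))) \<in> O(\<lambda>n. 1 / real n ^ 2)"
  shows "(\<lambda>n. u (Suc n) / u n) \<longlonglongrightarrow> 1"
proof -
  have "(\<lambda>n. u (Suc n) / u n - (1 - 3 * r_seq \<beta> (Suc n))) \<longlonglongrightarrow> 0"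
    by (rule bigo_inverse_square_tendsto_0) fact
  moreover have "(\<lambda>n. r_seq \<beta> (Suc n)) \<longlonglongrightarrow> 0"
    using r_seq_tendsto_0[OF assms(1,2)] by (simp add: filterlim_sequentially_Suc)
  hence "(\<lambda>n. 1 - 3 * r_seq \<beta> (Suc n)) \<longlonglongrightarrow> 1 - 3 * 0"
    by (intro tendsto_intros)
  ultimately have "(\<lambda>n. (u (Suc n) / u n - (1 - 3 * r_seq \<beta> (Suc n))) + (1 - 3 * r_seq \<beta> (Suc n))) \<longlonglongrightarrow> 0 + (1 - 3 * 0)"
    by (rule tendsto_add)
  thus ?thesis by simp
qed

text \<open>The cutpoint probability is squeezed between constants times \<open>u k / h k\<close>,
  and \<open>u k * vscale \<beta> k / h k\<close> tends to 1. The lower constant stays positive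
  because \<open>q\<close> and \<open>p2\<close> have positive limits.\<close>

lemma cutpoint_prob_asymptotics:
  fixes q p1 p2 :: "nat \<Rightarrow> real"
  assumes probs: "\<And>k. k \<ge> 2 \<Longrightarrow> q k > 0 \<and> p1 k \<ge> 0 \<and> p2 k > 0 \<and> q k + p1 k + p2 k = 1"
    and chain: "is_markov_chain M Z 2 (trans_kernel isX q p1 p2)"
    and a_lim: "\<exists>a>0. (\<lambda>k. (p1 k + p2 k) / q k) \<longlonglongrightarrow> a"
    and b_lim: "\<exists>b>0. (\<lambda>k. p2 k / q k) \<longlonglongrightarrow> b"
    and \<beta>: "0 \<le> \<beta>" "\<beta> < 1"
    and rho: "(\<lambda>k. rho_walk q p1 p2 k - (if isX then 1 - 3 * r_seq \<beta> k else 1 + 3 * r_seq \<beta> k))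
               \<in> O(\<lambda>k. (r_seq \<beta> k)\<^sup>2)"
  obtains c where "c > 0"
    and "eventually (\<lambda>k. c / vscale \<beta> k \<le> measure M {\<omega> \<in> space M. is_cutpoint isX (\<lambda>i. Z i \<omega>) k}
        \<and> measure M {\<omega> \<in> space M. is_cutpoint isX (\<lambda>i. Z i \<omega>) k} \<le> 3 / vscale \<beta> k) sequentially"
proof -
  define cp where "cp k = measure M {\<omega> \<in> space M. is_cutpoint isX (\<lambda>i. Z i \<omega>) k}" for k
  define \<sigma> :: real where "\<sigma> = (if isX then -1 else 1)"
  have rho': "(\<lambda>k. rho_walk q p1 p2 k - (1 + \<sigma> * (3 * r_seq \<beta> k))) \<in> O(\<lambda>k. (r_seq \<beta> k)\<^sup>2)"
    using rho by (cases isX) (simp_all add: \<sigma>_def)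
  obtain u where u: "\<And>n. u n > 0"
    and uX: "\<And>n. isX \<Longrightarrow> n \<ge> 2 \<Longrightarrow> q n * u n = (p1 n + p2 n) * u (n - 1) + p2 n * u (n - 2)"
    and uY: "\<And>n. \<not> isX \<Longrightarrow> n \<ge> 2 \<Longrightarrow> q n * u (n - 1) = (p1 n + p2 n) * u n + p2 n * u (n + 1)"
    and ratio: "(\<lambda>n. u (Suc n) / u n - (1 - 3 * r_seq \<beta> (Suc n))) \<in> O(\<lambda>n. 1 / real n ^ 2)"
  proof (cases isX)
    case True
    hence \<sigma>: "\<sigma> = -1" by (simp add: \<sigma>_def)
    obtain v where v: "\<And>n. v n > 0" "\<And>n. n \<ge> 2 \<Longrightarrow> q n * v n = (p1 n + p2 n) * v (n - 1) + p2 n * v (n - 2)"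
      "(\<lambda>n. v (Suc n) / v n - (1 - 3 * r_seq \<beta> (Suc n))) \<in> O(\<lambda>n. 1 / real n ^ 2)"
      by (rule harmonic_increments_X[OF probs a_lim b_lim \<beta> rho' \<sigma>]) (assumption, rule that, assumption+)
    show ?thesis
    proof (rule that[OF v(1)])
      fix n :: nat assume "n \<ge> 2"
      show "q n * v n = (p1 n + p2 n) * v (n - 1) + p2 n * v (n - 2)" by (rule v(2)) fact
    qed (use True v(3) in auto)
  next
    case False
    hence \<sigma>: "\<sigma> = 1" by (simp add: \<sigma>_def)
    obtain v where v: "\<And>n. v n > 0" "\<And>n. n \<ge> 2 \<Longrightarrow> q n * v (n - 1) = (p1 n + p2 n) * v n + p2 n * v (n + 1)"
      "(\<lambda>n. v (Suc n) / v n - (1 - 3 * r_seq \<beta> (Suc n))) \<in> O(\<lambda>n. 1 / real n ^ 2)"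
      by (rule harmonic_increments_Y[OF probs a_lim b_lim \<beta> rho' \<sigma>]) (assumption, rule that, assumption+)
    show ?thesis
    proof (rule that[OF v(1)])
      fix n :: nat assume "n \<ge> 2"
      show "q n * v (n - 1) = (p1 n + p2 n) * v n + p2 n * v (n + 1)" by (rule v(2)) fact
    qed (use False v(3) in auto)
  qed
  note tail = tail_asymptotic[OF \<beta> u ratio]
  define h where "h k = (\<Sum>j. u (j + k))" for k
  have h_pos: "h k > 0" for k
    unfolding h_def using u tail(1) by (intro suminf_pos summable_ignore_initial_segment)
  define w where "w k = u k * vscale \<beta> k / h k" for k
  have w_lim: "w \<longlonglongrightarrow> 1" using tail(2) by (simp add: w_def[abs_def] h_def)
  define cc where "cc k = (if isX then q k else q (k - 2) * p2 (k - 3) * p2 (k - 1))" for k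
  have bounds: "cc k * u k \<le> h k * cp k" "h (k - 1) * cp k \<le> u (k - 1) + u k" if "k \<ge> 5" for k
    using cutpoint_prob_bounds[OF probs chain u tail(1) uX uY that] unfolding cc_def h_def cp_def by simp_all
  obtain Q R where QR: "Q > 0" "R > 0" "q \<longlonglongrightarrow> Q" "p2 \<longlonglongrightarrow> R"
    using transition_prob_limits[OF probs a_lim b_lim] by blast
  define c0 where "c0 = (if isX then Q else Q * R * R)"
  have c0: "c0 > 0" using QR by (simp add: c0_def)
  have "cc \<longlonglongrightarrow> c0"
  proof (cases isX)
    case False
    have sh: "(\<lambda>k. f (k - m)) \<longlonglongrightarrow> L" if "f \<longlonglongrightarrow> L" for f :: "nat \<Rightarrow> real" and m L
      by (rule filterlim_compose[OF that filterlim_minus_const_nat_at_top])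
    show ?thesis using False unfolding cc_def[abs_def] c0_def
      by (auto intro!: tendsto_mult sh QR)
  qed (use QR in \<open>simp add: cc_def[abs_def] c0_def\<close>)
  hence "(\<lambda>k. cc k * w k) \<longlonglongrightarrow> c0 * 1" by (intro tendsto_mult w_lim)
  hence "eventually (\<lambda>k. cc k * w k > c0 / 2) sequentially"
    using c0 by (intro order_tendstoD(1)[of _ "c0 * 1"]) auto
  hence lower: "eventually (\<lambda>k. c0 / 2 / vscale \<beta> k \<le> cp k) sequentially"
    using eventually_ge_at_top[of 5]
  proof eventually_elim
    case (elim k)
    have V: "vscale \<beta> k > 0" using elim by (intro vscale_pos) simp
    have "c0 / 2 / vscale \<beta> k \<le> cc k * w k / vscale \<beta> k"
      using elim V by (intro divide_right_mono) auto
    also have "\<dots> = cc k * u k / h k" using V by (simp add: w_def)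
    also have "\<dots> \<le> cp k" using bounds(1)[OF elim(2)] h_pos[of k] by (simp add: field_simps)
    finally show ?case .
  qed
  \<comment> \<open>The upper bound for the site \<open>Suc k\<close> has numerator
    \<open>u k + u (Suc k)\<close> and denominator \<open>h k\<close>; times
    \<open>vscale \<beta> (Suc k)\<close> it tends to 2, whence the constant 3.\<close>
  have "(\<lambda>k. w k * (1 + u (Suc k) / u k) * (vscale \<beta> (Suc k) / vscale \<beta> k)) \<longlonglongrightarrow> 1 * (1 + 1) * 1"
    by (intro tendsto_mult tendsto_add tendsto_const w_lim ratio_tendsto_1[OF \<beta> ratio] vscale_ratio[OF \<beta>])
  hence "eventually (\<lambda>k. w k * (1 + u (Suc k) / u k) * (vscale \<beta> (Suc k) / vscale \<beta> k) < 3) sequentially"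
    by (rule order_tendstoD) simp
  hence "eventually (\<lambda>k. cp (Suc k) \<le> 3 / vscale \<beta> (Suc k)) sequentially"
    using eventually_ge_at_top[of 5]
  proof eventually_elim
    case (elim k)
    have V: "vscale \<beta> k > 0" "vscale \<beta> (Suc k) > 0" using elim by (auto intro!: vscale_pos)
    have "h k * cp (Suc k) \<le> u k + u (Suc k)" using bounds(2)[of "Suc k"] elim by simp
    hence "cp (Suc k) \<le> (u k + u (Suc k)) / h k" using h_pos[of k] by (simp add: field_simps)
    also have "\<dots> = w k * (1 + u (Suc k) / u k) / vscale \<beta> k"
      using V u[of k] h_pos[of k] by (simp add: w_def field_simps)
    finally have "cp (Suc k) * vscale \<beta> (Suc k) \<le> w k * (1 + u (Suc k) / u k) / vscale \<beta> k * vscale \<beta> (Suc k)"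
      using V by (intro mult_right_mono) auto
    also have "\<dots> \<le> 3" using elim by simp
    finally show ?case using V by (simp add: field_simps)
  qed
  hence "eventually (\<lambda>k. cp k \<le> 3 / vscale \<beta> k) sequentially"
    by (subst (asm) eventually_sequentially_Suc[of "\<lambda>k. cp k \<le> 3 / vscale \<beta> k"])
  with lower have "eventually (\<lambda>k. c0 / 2 / vscale \<beta> k \<le> cp k \<and> cp k \<le> 3 / vscale \<beta> k) sequentially"
    by (rule eventually_conj)
  with that[of "c0 / 2"] c0 show ?thesis by (simp add: cp_def)
qed

text \<open>Increments of \<open>gscale \<beta>\<close> are within a factor 2 of
  \<open>1 / vscale \<beta>\<close>. One half in \<open>c / 4\<close> pays for this comparison, the
  other for absorbing the fixed value \<open>gscale \<beta> N\<close> once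
  \<open>gscale \<beta> n\<close> is twice as large.\<close>

lemma partial_sums_gscale:
  fixes x :: "nat \<Rightarrow> real"
  assumes \<beta>: "0 \<le> \<beta>" "\<beta> < 1" and nn: "\<And>k. x k \<ge> 0" and c: "0 < c" "0 < C"
    and x: "eventually (\<lambda>k. c / vscale \<beta> k \<le> x k \<and> x k \<le> C / vscale \<beta> k) sequentially"
  obtains D where "D > 0"
    "eventually (\<lambda>n. c / 4 * gscale \<beta> n \<le> (\<Sum>k=2..n. x k) \<and> (\<Sum>k=2..n. x k) \<le> D * gscale \<beta> n) sequentially"
proof -
  have g1: "eventually (\<lambda>n. (gscale \<beta> (Suc n) - gscale \<beta> n) * vscale \<beta> (Suc n) > 1 / 2) sequentially"
    and g2: "eventually (\<lambda>n. (gscale \<beta> (Suc n) - gscale \<beta> n) * vscale \<beta> (Suc n) < 2) sequentially"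
    by (rule order_tendstoD[OF gscale_step[OF \<beta>]]; simp)+
  have "eventually (\<lambda>k. c / vscale \<beta> (Suc k) \<le> x (Suc k) \<and> x (Suc k) \<le> C / vscale \<beta> (Suc k)) sequentially"
    using x by (subst eventually_sequentially_Suc[of "\<lambda>k. c / vscale \<beta> k \<le> x k \<and> x k \<le> C / vscale \<beta> k"])
  with g1 g2 have "eventually (\<lambda>k. c / 2 * (gscale \<beta> (Suc k) - gscale \<beta> k) \<le> x (Suc k) \<and>
      x (Suc k) \<le> 2 * C * (gscale \<beta> (Suc k) - gscale \<beta> k)) sequentially"
    using eventually_ge_at_top[of 4]
  proof eventually_elim
    case (elim k)
    have V: "vscale \<beta> (Suc k) > 0" using elim by (intro vscale_pos) simp
    define d where "d = gscale \<beta> (Suc k) - gscale \<beta> k"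
    have d: "d \<le> 2 / vscale \<beta> (Suc k)" "1 / 2 / vscale \<beta> (Suc k) \<le> d"
      using elim V by (simp_all add: d_def field_simps)
    have "c / 2 * d \<le> c / 2 * (2 / vscale \<beta> (Suc k))" using d c by (intro mult_left_mono) auto
    moreover have "2 * C * (1 / 2 / vscale \<beta> (Suc k)) \<le> 2 * C * d" using d c by (intro mult_left_mono) auto
    moreover have "c / 2 * (2 / vscale \<beta> (Suc k)) = c / vscale \<beta> (Suc k)"
      "2 * C * (1 / 2 / vscale \<beta> (Suc k)) = C / vscale \<beta> (Suc k)" by simp_all
    ultimately show ?case using elim(3) unfolding d_def[symmetric] by linarith
  qed
  then obtain N0 where N0: "\<And>k. k \<ge> N0 \<Longrightarrow> c / 2 * (gscale \<beta> (Suc k) - gscale \<beta> k) \<le> x (Suc k) \<and>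
      x (Suc k) \<le> 2 * C * (gscale \<beta> (Suc k) - gscale \<beta> k)"
    unfolding eventually_sequentially by blast
  define N where "N = max N0 2"
  define E where "E n = (\<Sum>k=2..n. x k)" for n
  have E0: "E n \<ge> 0" for n unfolding E_def by (intro sum_nonneg nn)
  have E: "c / 2 * (gscale \<beta> n - gscale \<beta> N) \<le> E n \<and> E n \<le> E N + 2 * C * (gscale \<beta> n - gscale \<beta> N)"
    if "n \<ge> N" for n
    using that
  proof (induction rule: dec_induct)
    case base thus ?case using E0 by simp
  next
    case (step n)
    have "E (Suc n) = E n + x (Suc n)" using step by (simp add: E_def N_def)
    moreover have "n \<ge> N0" using step by (simp add: N_def)
    note N0[OF this]
    ultimately show ?case using step by (simp add: algebra_simps)
  qed
  \<comment> \<open>Both the initial sum \<open>E N\<close> and the constant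
    \<open>gscale \<beta> N\<close> are absorbed into a multiple of \<open>gscale \<beta> n\<close>
    by \<open>gscale \<beta> n \<ge> 1\<close>.\<close>
  define D where "D = E N + 2 * C * (1 + \<bar>gscale \<beta> N\<bar>)"
  have "2 * C * (1 + \<bar>gscale \<beta> N\<bar>) > 0" using c by (intro mult_pos_pos) auto
  hence D: "D > 0" using E0[of N] unfolding D_def by linarith
  have "eventually (\<lambda>n. gscale \<beta> n \<ge> max 1 (2 * \<bar>gscale \<beta> N\<bar>)) sequentially"
    using gscale_at_top[OF \<beta>] by (simp only: filterlim_at_top)
  hence "eventually (\<lambda>n. c / 4 * gscale \<beta> n \<le> E n \<and> E n \<le> D * gscale \<beta> n) sequentially"
    using eventually_ge_at_top[of N]
  proof eventually_elim
    case (elim n)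
    define G where "G = gscale \<beta> n"
    have G: "G \<ge> 1" "G \<ge> 2 * \<bar>gscale \<beta> N\<bar>" using elim by (auto simp: G_def)
    have "c / 4 * G \<le> c / 2 * (G - gscale \<beta> N)"
    proof -
      have "c / 2 * (G / 2) \<le> c / 2 * (G - gscale \<beta> N)" using c G by (intro mult_left_mono) auto
      thus ?thesis by simp
    qed
    moreover have "E N + 2 * C * (G - gscale \<beta> N) \<le> D * G"
    proof -
      have 1: "E N \<le> E N * G" using E0[of N] G mult_left_mono[of 1 G "E N"] by simp
      have "\<bar>gscale \<beta> N\<bar> \<le> \<bar>gscale \<beta> N\<bar> * G" using G mult_left_mono[of 1 G "\<bar>gscale \<beta> N\<bar>"] by simp
      hence "G - gscale \<beta> N \<le> (1 + \<bar>gscale \<beta> N\<bar>) * G" by (simp add: ring_distribs)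
      hence "2 * C * (G - gscale \<beta> N) \<le> 2 * C * ((1 + \<bar>gscale \<beta> N\<bar>) * G)"
        using c by (intro mult_left_mono) auto
      moreover have "D * G = E N * G + 2 * C * ((1 + \<bar>gscale \<beta> N\<bar>) * G)"
        by (simp add: D_def algebra_simps)
      ultimately show ?thesis using 1 by linarith
    qed
    ultimately show ?case using E[OF elim(2)] unfolding G_def by linarith
  qed
  with that[OF D] show ?thesis by (simp add: E_def)
qed

theorem theorem2:
  fixes q p1 p2 :: "nat \<Rightarrow> real" and isX :: bool
    and M :: "'a measure" and Z :: "nat \<Rightarrow> 'a \<Rightarrow> nat" and \<beta> :: real
  assumes probs: "\<And>k. k \<ge> 2 \<Longrightarrow> q k > 0 \<and> p1 k \<ge> 0 \<and> p2 k > 0 \<and> q k + p1 k + p2 k = 1"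
    and chain: "is_markov_chain M Z 2 (trans_kernel isX q p1 p2)"
    and a_lim: "\<exists>a>0. (\<lambda>k. (p1 k + p2 k) / q k) \<longlonglongrightarrow> a"
    and b_lim: "\<exists>b>0. (\<lambda>k. p2 k / q k) \<longlonglongrightarrow> b"
    and beta: "0 \<le> \<beta>" "\<beta> < 1"
    and rho: "(\<lambda>k. rho_walk q p1 p2 k - (if isX then 1 - 3 * r_seq \<beta> k else 1 + 3 * r_seq \<beta> k))
               \<in> O(\<lambda>k. (r_seq \<beta> k)\<^sup>2)"
  shows "(\<exists>c3 c4. 0 < c3 \<and> c3 < c4 \<and>
           ereal c3 \<le> liminf (\<lambda>n. ereal (prob_space.expectation M (\<lambda>\<omega>. real (num_cutpoints isX (\<lambda>i. Z i \<omega>) n))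
                          / (ln (real n) * (ln (ln (real n))) powr (- \<beta>)))) \<and>
           liminf (\<lambda>n. ereal (prob_space.expectation M (\<lambda>\<omega>. real (num_cutpoints isX (\<lambda>i. Z i \<omega>) n))
                          / (ln (real n) * (ln (ln (real n))) powr (- \<beta>))))
           \<le> limsup (\<lambda>n. ereal (prob_space.expectation M (\<lambda>\<omega>. real (num_cutpoints isX (\<lambda>i. Z i \<omega>) n))
                          / (ln (real n) * (ln (ln (real n))) powr (- \<beta>)))) \<and>
           limsup (\<lambda>n. ereal (prob_space.expectation M (\<lambda>\<omega>. real (num_cutpoints isX (\<lambda>i. Z i \<omega>) n))
                          / (ln (real n) * (ln (ln (real n))) powr (- \<beta>)))) \<le> ereal c4)
         \<and> (\<forall>\<epsilon>>0. AE \<omega> in M.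
              (\<lambda>n. real (num_cutpoints isX (\<lambda>i. Z i \<omega>) n)
                     / ((ln (real n)) powr (1 + \<epsilon>) * (ln (ln (real n))) powr (- \<beta>))) \<longlonglongrightarrow> 0)"
proof -
  have M: "prob_space M" and meas: "\<And>n. Z n \<in> M \<rightarrow>\<^sub>M count_space UNIV"
    using chain by (auto simp: is_markov_chain_def)
  interpret prob_space M by (rule M)
  define C where "C k = {\<omega> \<in> space M. is_cutpoint isX (\<lambda>i. Z i \<omega>) k}" for k
  have C: "C k \<in> events" for k unfolding C_def by (rule is_cutpoint_sets[OF meas])
  \<comment> \<open>As a sum of indicators the count is nonnegative and monotone in \<open>n\<close>
    for every \<open>\<omega>\<close>; it agrees with \<open>num_cutpoints\<close> on
    \<open>space M\<close>.\<close>
  define S where "S n \<omega> = (\<Sum>k=2..n. indicator (C k) \<omega> :: real)" for n \<omega>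
  have S_eq: "real (num_cutpoints isX (\<lambda>i. Z i \<omega>) n) = S n \<omega>" if "\<omega> \<in> space M" for n \<omega>
  proof -
    have "S n \<omega> = (\<Sum>k=2..n. if is_cutpoint isX (\<lambda>i. Z i \<omega>) k then 1 else 0)"
      unfolding S_def using that by (intro sum.cong) (auto simp: C_def indicator_def)
    also have "\<dots> = real (card {k \<in> {2..n}. is_cutpoint isX (\<lambda>i. Z i \<omega>) k})"
      by (simp flip: sum.inter_filter)
    finally show ?thesis by (simp add: num_cutpoints_def)
  qed
  have S_int: "integrable M (S n)" for n
    unfolding S_def using C by (intro Bochner_Integration.integrable_sum integrable_real_indicator) (auto simp: emeasure_eq_measure)
  have S_exp: "expectation (S n) = (\<Sum>k=2..n. prob (C k))" for n
    unfolding S_def using C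
    by (subst Bochner_Integration.integral_sum) (auto intro!: integrable_real_indicator simp: emeasure_eq_measure)
  have ES: "expectation (\<lambda>\<omega>. real (num_cutpoints isX (\<lambda>i. Z i \<omega>) n)) = (\<Sum>k=2..n. prob (C k))" for n
    unfolding S_exp[symmetric] by (rule Bochner_Integration.integral_cong) (auto simp: S_eq)
  obtain c where c: "c > 0"
    "eventually (\<lambda>k. c / vscale \<beta> k \<le> prob (C k) \<and> prob (C k) \<le> 3 / vscale \<beta> k) sequentially"
    using cutpoint_prob_asymptotics[OF probs chain a_lim b_lim beta rho] unfolding C_def by blast
  obtain D where D: "D > 0" "eventually (\<lambda>n. c / 4 * gscale \<beta> n \<le> (\<Sum>k=2..n. prob (C k)) \<and>
      (\<Sum>k=2..n. prob (C k)) \<le> D * gscale \<beta> n) sequentially"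
    by (rule partial_sums_gscale[OF beta _ c(1) _ c(2)]) auto
  define F where "F n = ereal (expectation (\<lambda>\<omega>. real (num_cutpoints isX (\<lambda>i. Z i \<omega>) n))
      / (ln (real n) * (ln (ln (real n))) powr (- \<beta>)))" for n
  have F: "eventually (\<lambda>n. ereal (c / 4) \<le> F n \<and> F n \<le> ereal D) sequentially"
    using D(2) eventually_ge_at_top[of 4]
  proof eventually_elim
    case (elim n)
    thus ?case using gscale_pos[of n \<beta>]
      unfolding F_def ES gscale_def[symmetric] by (simp add: field_simps)
  qed
  have "ereal (c / 4) \<le> liminf F" using F by (intro Liminf_bounded) (auto elim: eventually_mono)
  moreover have "liminf F \<le> limsup F" by (rule Liminf_le_Limsup) simp
  \<comment> \<open>The summand \<open>c / 4\<close> serves only to make the upper constant strictly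
    larger than the lower one.\<close>
  moreover have "limsup F \<le> ereal (D + c / 4)"
  proof (rule Limsup_bounded)
    show "eventually (\<lambda>n. F n \<le> ereal (D + c / 4)) sequentially"
      using F
    proof eventually_elim
      case (elim n)
      have "ereal D \<le> ereal (D + c / 4)" using c(1) by simp
      with elim show ?case by (meson order_trans)
    qed
  qed
  moreover have "0 < c / 4" "c / 4 < D + c / 4" using c(1) D(1) by auto
  ultimately have 1: "\<exists>c3 c4. 0 < c3 \<and> c3 < c4 \<and> ereal c3 \<le> liminf F \<and> liminf F \<le> limsup F \<and> limsup F \<le> ereal c4"
    by blast
  have 2: "AE \<omega> in M. (\<lambda>n. real (num_cutpoints isX (\<lambda>i. Z i \<omega>) n)
      / ((ln (real n)) powr (1 + \<epsilon>) * (ln (ln (real n))) powr (- \<beta>))) \<longlonglongrightarrow> 0" if \<epsilon>: "\<epsilon> > 0" for \<epsilon>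
  proof -
    obtain N where N: "\<And>n. n \<ge> N \<Longrightarrow> expectation (S n) \<le> D * gscale \<beta> n"
      using D(2) unfolding eventually_sequentially S_exp by blast
    have "AE \<omega> in M. (\<lambda>n. S n \<omega> / (ln (real n) powr (1 + \<epsilon>) * ln (ln (real n)) powr (- \<beta>))) \<longlonglongrightarrow> 0"
    proof (rule AE_ratio_tendsto_0[OF M beta(1) \<epsilon> S_int _ _ N])
      show "S n \<omega> \<ge> 0" for n \<omega> unfolding S_def by (intro sum_nonneg) simp
      show "S m \<omega> \<le> S n \<omega>" if "m \<le> n" for m n \<omega>
        unfolding S_def using that by (intro sum_mono2) auto
    qed
    with AE_space show ?thesis by eventually_elim (simp add: S_eq)
  qed
  show ?thesis using 1 2 unfolding F_def by blast
qed

end
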